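(* Let $n\ge5$. The multiplicity and arithmetic degree of $S_{G_n}/J_{G_n}$ are given by $e(S_{G_n}/J_{G_n})=2n$ and $\operatorname{adeg}(S_{G_n}/J_{G_n})=21n^2-33n+2$.
   Context: Graph $G_n$: let $X=\{u_0,\dots,u_{n-1}\}$ and $Y=\{v_0,\dots,v_{n-1}\}$ be disjoint, indices modulo $n$. $G_n$ is the bipartite graph on $X\sqcup Y$ with $\{u_i,v_j\}\in E(G_n)$ iff $j\notin\{i,i-1\}$ modulo $n$ (the bipartite complement of the cycle $C_{2n}$ with edges $\{u_i,v_i\},\{u_i,v_{i-1}\}$). Binomial edge ideal: let $\mathbb K$ be an arbitrary field. For a finite simple graph $G$, $S_G=\mathbb K[x_w,y_w:w\in V(G)]$ (standard graded) and $J_G\subseteq S_G$ is the ideal generated by $x_ay_b-x_by_a$ for all edges $\{a,b\}\in E(G)$. The ideal $J_G$ is radical. For a standard graded finitely generated $\mathbb K$-algebra $R$ of dimension $d$, the multiplicity $e(R)$ is defined by the Hilbert polynomial of $R$ having leading term $\frac{e(R)}{(d-1)!}q^{d-1}$. For the reduced ring $R=S_G/J_G$, the arithmetic degree is $\operatorname{adeg}(R)=\sum_{P\in\operatorname{Min}(J_G)}e(S_G/P)$, the sum over all minimal primes of $J_G$. *)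

theory Defs
  imports
    Complex_Main
    "HOL-Library.Poly_Mapping"
    "HOL-Library.Extended_Nat"
    "HOL-Computational_Algebra.Polynomial"
    "HOL-Algebra.QuotRing"
    "HOL-Algebra.Embedded_Algebras"
begin

text \<open>Monomials are finitely supported exponent functions \<open>'x \<Rightarrow>\<^sub>0 nat\<close>. The variable type may be
  larger than the set \<open>X\<close> of variables of the ring, which is therefore cut out as a carrier set.\<close>

type_synonym ('x, 'k) mpoly = "('x \<Rightarrow>\<^sub>0 nat) \<Rightarrow>\<^sub>0 'k"

definition poly_ring :: "'x set \<Rightarrow> ('x, 'k::field) mpoly ring" where
  "poly_ring X =
    \<lparr>carrier = {p. \<forall>m\<in>Poly_Mapping.keys p. Poly_Mapping.keys m \<subseteq> X},
     mult = (*), one = 1, zero = 0, add = (+)\<rparr>"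

definition const_poly :: "'k \<Rightarrow> ('x, 'k::field) mpoly" where
  "const_poly c = Poly_Mapping.single 0 c"

definition var_poly :: "'x \<Rightarrow> ('x, 'k::field) mpoly" where
  "var_poly x = Poly_Mapping.single (Poly_Mapping.single x 1) 1"

definition monom_degree :: "('x \<Rightarrow>\<^sub>0 nat) \<Rightarrow> nat" where
  "monom_degree m = (\<Sum>x\<in>Poly_Mapping.keys m. Poly_Mapping.lookup m x)"

definition graded_part :: "'x set \<Rightarrow> nat \<Rightarrow> ('x, 'k::field) mpoly set" where
  "graded_part X q =
    {p \<in> carrier (poly_ring X). \<forall>m\<in>Poly_Mapping.keys p. monom_degree m = q}"

text \<open>In the following \<open>I\<close> is meant to be a homogeneous ideal of \<open>poly_ring X\<close>, and the graded
  algebra is \<open>poly_ring X Quot I\<close>. Its scalars and its component of degree \<open>q\<close> are the images of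
  the constants and of \<open>graded_part X q\<close> in the quotient, i.e. sets of cosets.\<close>

definition hilbert_function :: "'x set \<Rightarrow> ('x, 'k::field) mpoly set \<Rightarrow> nat \<Rightarrow> nat" where
  "hilbert_function X I q =
    ring.dim (poly_ring X Quot I)
      ((\<lambda>c. I +>\<^bsub>poly_ring X\<^esub> const_poly c) ` UNIV)
      ((\<lambda>p. I +>\<^bsub>poly_ring X\<^esub> p) ` graded_part X q)"

definition is_hilbert_polynomial ::
    "'x set \<Rightarrow> ('x, 'k::field) mpoly set \<Rightarrow> rat poly \<Rightarrow> bool" where
  "is_hilbert_polynomial X I h \<longleftrightarrow>
    (\<forall>\<^sub>F q in sequentially. of_nat (hilbert_function X I q) = poly h (of_nat q))"

definition krull_dim :: "('a, 'b) ring_scheme \<Rightarrow> enat" where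
  "krull_dim R = Sup {enat l | l. \<exists>P :: nat \<Rightarrow> 'a set.
     (\<forall>i\<le>l. primeideal (P i) R) \<and> (\<forall>i<l. P i \<subset> P (Suc i))}"

text \<open>The multiplicity is only specified in positive Krull dimension, where the leading term of
  the Hilbert polynomial determines it.\<close>

definition hilbert_multiplicity :: "'x set \<Rightarrow> ('x, 'k::field) mpoly set \<Rightarrow> rat" where
  "hilbert_multiplicity X I =
    (THE e. \<exists>d h. krull_dim (poly_ring X Quot I) = enat d \<and> d \<ge> 1 \<and>
       is_hilbert_polynomial X I h \<and> degree h = d - 1 \<and> lead_coeff h = e / fact (d - 1))"

definition minimal_primes :: "('a, 'b) ring_scheme \<Rightarrow> 'a set \<Rightarrow> 'a set set" where
  "minimal_primes R I =
    {P. primeideal P R \<and> I \<subseteq> P \<and> (\<forall>Q. primeideal Q R \<and> I \<subseteq> Q \<and> Q \<subseteq> P \<longrightarrow> Q = P)}"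

text \<open>This is the arithmetic degree of \<open>poly_ring X Quot I\<close> only for radical \<open>I\<close>: embedded
  components and the lengths of the primary components are not taken into account.\<close>

definition arith_degree :: "'x set \<Rightarrow> ('x, 'k::field) mpoly set \<Rightarrow> rat" where
  "arith_degree X I = (\<Sum>P\<in>minimal_primes (poly_ring X) I. hilbert_multiplicity X P)"

text \<open>A simple graph is a pair of a vertex set and a set of edges, the edges being two-element
  sets of vertices.\<close>

type_synonym 'v graph = "'v set \<times> 'v set set"

datatype 'v edge_var = XVar 'v | YVar 'v

definition edge_vars :: "'v graph \<Rightarrow> 'v edge_var set" where
  "edge_vars G = XVar ` fst G \<union> YVar ` fst G"

definition binomial_edge_ideal :: "'v graph \<Rightarrow> ('v edge_var, 'k::field) mpoly set" where
  "binomial_edge_ideal G =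
    Idl\<^bsub>poly_ring (edge_vars G)\<^esub>
      {var_poly (XVar a) * var_poly (YVar b) - var_poly (XVar b) * var_poly (YVar a) | a b.
         {a, b} \<in> snd G}"

text \<open>The bipartite complement of the cycle of length \<open>2n\<close> on \<open>u\<^sub>i\<close>, \<open>v\<^sub>j\<close>. Integers are
  used so that \<open>(i - 1) mod n\<close> is \<open>n - 1\<close> for \<open>i = 0\<close>.\<close>

datatype vert = U nat | V nat

definition Gn :: "nat \<Rightarrow> vert graph" where
  "Gn n =
    (U ` {..<n} \<union> V ` {..<n},
     {{U i, V j} | i j. i < n \<and> j < n \<and>
        int j \<noteq> int i mod int n \<and> int j \<noteq> (int i - 1) mod int n})"

end

theory Submission
  imports Defs "HOL-Computational_Algebra.Computational_Algebra"
begin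

text \<open>
  Let \<open>J\<close> be the binomial edge ideal of a graph with vertex set \<open>W\<close>. If \<open>c\<close> is a common neighbour of
  \<open>a\<close> and \<open>b\<close>, then the products of the binomial of \<open>a b\<close> with the two variables of \<open>c\<close> lie in \<open>J\<close>, so a
  prime over \<open>J\<close> contains this binomial or both variables: one may add the edge \<open>a b\<close> or delete the
  vertex \<open>c\<close>. Iterating this, every prime over \<open>J\<close> contains one of the ideals \<open>P\<^sub>T\<close> generated by the
  variables of a set \<open>T\<close> of deleted vertices and by the binomials of all pairs in a common component of
  the remaining graph (\<open>prime_contains_cut_prime\<close>). The ideal \<open>P\<^sub>T\<close> is the kernel of the monomial map
  that sends \<open>x\<^sub>v\<close> to \<open>t\<^sub>v\<close> and \<open>y\<^sub>v\<close> to \<open>t\<^sub>v s\<^sub>c\<close>, where \<open>c\<close> is the component of \<open>v\<close>, and kills the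
  variables of \<open>T\<close> (\<open>weight_prime_eq_cut_ideal\<close>). Hence it is prime, and its Hilbert function counts
  the monomials of the image. A component with \<open>m\<close> vertices contributes the factor
  \<open>(1 + (m - 1) z) / (1 - z)\<^sup>m\<^sup>+\<^sup>1\<close> to the Hilbert series (\<open>hilbert_series_class_ideal\<close>), so the
  quotient by \<open>P\<^sub>T\<close> has the product of the sizes of the components as its multiplicity, and the number
  of remaining vertices plus the number of components as its dimension. The minimal ones among
  the \<open>P\<^sub>T\<close> belong to the cut sets, those \<open>T\<close> all of whose vertices are adjacent to at least two components
  (\<open>minimal_primes_edge_ideal\<close>).

  In the bipartite complement of a cycle of length \<open>2 n\<close> write \<open>N w\<close> for the two neighbours of \<open>w\<close> in
  the cycle. The
  sets \<open>R\<close> of vertices remaining after the deletion of a cut set are the following (\<open>rest_iff\<close>), with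
  the product of the sizes of the components:

  \<^item> all vertices, which are connected: \<open>2 n\<close>;
  \<^item> one of the two sides, which consists of isolated vertices: \<open>1\<close>, twice;
  \<^item> one side and a vertex \<open>w\<close> of the other side, where the elements of \<open>N w\<close> are isolated: \<open>n - 1\<close>,
    for \<open>2 n\<close> sets;
  \<^item> one side and \<open>N w\<close> for a vertex \<open>w\<close> of this side, which is isolated: \<open>n + 1\<close>, for \<open>2 n\<close> sets;
  \<^item> \<open>w\<close>, \<open>w'\<close>, \<open>N w\<close> and \<open>N w'\<close> for two vertices of the same side with disjoint \<open>N w\<close> and \<open>N w'\<close>: \<open>3 \<cdot> 3\<close>,
    for \<open>n (n - 3)\<close> sets;
  \<^item> \<open>u\<close>, \<open>v\<close>, \<open>N u\<close> and \<open>N v\<close> for an edge \<open>u v\<close> of the complement: \<open>2 \<cdot> 4\<close>, for \<open>n (n - 2)\<close> sets;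
  \<^item> the five vertices of a path in the cycle, whose centre is isolated and whose other vertices
    form two edges: \<open>1 \<cdot> 2 \<cdot> 2\<close>, for \<open>2 n\<close> sets.

  The arithmetic degree is the sum of these products (\<open>sum_mult\<close>).

  For the multiplicity, the choice between adding an edge and deleting a vertex is applied to Hilbert
  functions: that of \<open>J\<close> exceeds that of the prime of the empty cut set by at most a sum of shifted
  Hilbert functions of primes \<open>P\<^sub>T\<close> with nonempty \<open>T\<close> (\<open>hilbert_function_cut_ideal_le\<close>). The
  quotients by the latter have dimension at most \<open>2 n\<close>, which is checked for cut sets (\<open>dim_le\<close>) and
  follows for other \<open>T\<close>, whereas the quotient by the prime of the empty cut set has dimension
  \<open>2 n + 1\<close> and multiplicity \<open>2 n\<close>. So the two Hilbert polynomials have the same leading term.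
  That \<open>J\<close> has a Hilbert polynomial at all follows from standard monomials and Dickson's lemma
  (\<open>hilbert_series_exists\<close>), and Krull dimensions are computed from the growth of Hilbert functions
  (\<open>prime_chain_length_le\<close>) and from explicit chains of primes (\<open>class_ideal_chain\<close>).\<close>

section \<open>The polynomial ring and its ideals\<close>

abbreviation keys :: "('a \<Rightarrow>\<^sub>0 'b::zero) \<Rightarrow> 'a set" where "keys \<equiv> Poly_Mapping.keys"
abbreviation lookup :: "('a \<Rightarrow>\<^sub>0 'b::zero) \<Rightarrow> 'a \<Rightarrow> 'b" where "lookup \<equiv> Poly_Mapping.lookup"
abbreviation single :: "'a \<Rightarrow> 'b \<Rightarrow> ('a \<Rightarrow>\<^sub>0 'b::zero)" where "single \<equiv> Poly_Mapping.single"

lemma keys_add_nat: "keys (a + b :: 'x \<Rightarrow>\<^sub>0 nat) = keys a \<union> keys b"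
  by (auto simp: in_keys_iff lookup_add)

lemma sum_single_lookup:
  assumes "finite A" "keys p \<subseteq> A"
  shows "(\<Sum>m\<in>A. single m (lookup p m)) = p"
  using assms
  by (intro poly_mapping_eqI)
     (auto simp: lookup_sum lookup_single when_def not_in_keys_iff_lookup_eq_zero[symmetric])

lemma poly_ring_simps [simp]:
  "mult (poly_ring X) = (*)" "one (poly_ring X) = 1" "zero (poly_ring X) = 0"
  "add (poly_ring X) = (+)"
  by (simp_all add: poly_ring_def)

lemma carrier_poly_ring: "p \<in> carrier (poly_ring X) \<longleftrightarrow> (\<forall>m\<in>keys p. keys m \<subseteq> X)"
  by (simp add: poly_ring_def)

lemma poly_ring_closed:
  "0 \<in> carrier (poly_ring X)" "1 \<in> carrier (poly_ring X)"
  "const_poly c \<in> carrier (poly_ring X)"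
  "p \<in> carrier (poly_ring X) \<Longrightarrow> q \<in> carrier (poly_ring X) \<Longrightarrow> p + q \<in> carrier (poly_ring X)"
  "p \<in> carrier (poly_ring X) \<Longrightarrow> q \<in> carrier (poly_ring X) \<Longrightarrow> p * q \<in> carrier (poly_ring X)"
  "p \<in> carrier (poly_ring X) \<Longrightarrow> - p \<in> carrier (poly_ring X)"
  "p \<in> carrier (poly_ring X) \<Longrightarrow> q \<in> carrier (poly_ring X) \<Longrightarrow> p - q \<in> carrier (poly_ring X)"
  "x \<in> X \<Longrightarrow> var_poly x \<in> carrier (poly_ring X)"
  "keys m \<subseteq> X \<Longrightarrow> single m c \<in> carrier (poly_ring X)"
proof -
  show "p + q \<in> carrier (poly_ring X)" if "p \<in> carrier (poly_ring X)" "q \<in> carrier (poly_ring X)"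
    using that Poly_Mapping.keys_add[of p q] by (auto simp: carrier_poly_ring)
  show "p * q \<in> carrier (poly_ring X)" if "p \<in> carrier (poly_ring X)" "q \<in> carrier (poly_ring X)"
    using that keys_mult[of p q] by (fastforce simp: carrier_poly_ring keys_add_nat)
  have keys_minus: "keys (- p) = keys p" for p :: "('x, 'k::field) mpoly"
    by (auto simp: in_keys_iff)
  show neg: "- p \<in> carrier (poly_ring X)" if "p \<in> carrier (poly_ring X)" for p
    using that by (simp add: carrier_poly_ring keys_minus)
  show "p - q \<in> carrier (poly_ring X)" if "p \<in> carrier (poly_ring X)" "q \<in> carrier (poly_ring X)"
    using that neg[of q] Poly_Mapping.keys_add[of p "- q"]
    by (force simp: carrier_poly_ring keys_minus)
qed (auto simp: carrier_poly_ring const_poly_def var_poly_def)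

lemma poly_ring_sum_closed:
  "(\<And>i. i \<in> A \<Longrightarrow> f i \<in> carrier (poly_ring X)) \<Longrightarrow> sum f A \<in> carrier (poly_ring X)"
  by (induction A rule: infinite_finite_induct) (auto simp: poly_ring_closed)

lemma const_poly_simps [simp]:
  "const_poly 0 = 0" "const_poly 1 = 1"
  and const_poly_hom:
  "const_poly (a + b) = const_poly a + const_poly b"
  "const_poly (a * b) = const_poly a * const_poly b"
  "const_poly (- a) = - const_poly a"
  "const_poly (a - b) = const_poly a - const_poly b"
  by (simp_all add: const_poly_def single_add mult_single single_uminus single_diff)

lemma const_poly_eq_0_iff [simp]: "const_poly c = 0 \<longleftrightarrow> c = 0"
  by (metis const_poly_def const_poly_simps(1) lookup_single_eq)

lemma const_poly_mult_single: "const_poly c * single m a = single m (c * a)"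
  by (simp add: const_poly_def mult_single)

lemma const_poly_mult_lookup: "lookup (const_poly c * p) m = c * lookup p m"
proof -
  have "const_poly c * p = (\<Sum>m\<in>keys p. single m (c * lookup p m))"
    by (subst sum_single_lookup[of "keys p" p, symmetric])
       (simp_all add: sum_distrib_left const_poly_mult_single)
  then show ?thesis
    by (simp add: lookup_sum lookup_single when_def not_in_keys_iff_lookup_eq_zero[symmetric])
qed

lemma cring_poly_ring: "cring (poly_ring X)"
proof (rule cringI)
  show "abelian_group (poly_ring X)"
  proof (rule abelian_groupI)
    fix p assume "p \<in> carrier (poly_ring X)"
    then show "\<exists>q\<in>carrier (poly_ring X). q \<oplus>\<^bsub>poly_ring X\<^esub> p = \<zero>\<^bsub>poly_ring X\<^esub>"
      by (intro bexI[of _ "- p"]) (auto simp: poly_ring_closed)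
  qed (auto simp: poly_ring_closed add.assoc add.commute)
  show "comm_monoid (poly_ring X)"
    by (rule comm_monoidI) (auto simp: poly_ring_closed mult.assoc mult.commute)
qed (auto simp: distrib_right)

lemma poly_ring_ring: "ring (poly_ring X)"
  using cring_poly_ring by (rule cring.axioms)

lemma a_inv_poly_ring:
  assumes "p \<in> carrier (poly_ring X)"
  shows "\<ominus>\<^bsub>poly_ring X\<^esub> p = - p"
  using abelian_group.minus_equality[OF ring.is_abelian_group[OF poly_ring_ring], of X "- p" p] assms
  by (simp add: poly_ring_closed)

lemma a_minus_poly_ring:
  assumes "p \<in> carrier (poly_ring X)" "q \<in> carrier (poly_ring X)"
  shows "p \<ominus>\<^bsub>poly_ring X\<^esub> q = p - q"
  using assms by (simp add: a_minus_def a_inv_poly_ring)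

lemma ideal_poly_ring_iff:
  "ideal I (poly_ring X) \<longleftrightarrow> I \<subseteq> carrier (poly_ring X) \<and> 0 \<in> I \<and> (\<forall>a\<in>I. \<forall>b\<in>I. a + b \<in> I) \<and>
     (\<forall>r\<in>carrier (poly_ring X). \<forall>a\<in>I. r * a \<in> I)" (is "_ = ?R")
proof
  assume I: "ideal I (poly_ring X)"
  interpret ideal I "poly_ring X" by fact
  show ?R
    using a_subset additive_subgroup.zero_closed[OF additive_subgroup_axioms] I_l_closed
      additive_subgroup.a_closed[OF additive_subgroup_axioms] by auto
next
  assume R: ?R
  have neg: "- a \<in> I" if "a \<in> I" for a
    using R that poly_ring_closed(3)[of "- 1" X]
    by (metis const_poly_hom(3) const_poly_simps(2) mult_minus1)
  have "subgroup I (add_monoid (poly_ring X))"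
  proof (rule group.subgroupI[OF abelian_group.a_group[OF ring.is_abelian_group[OF poly_ring_ring]]])
    fix a assume "a \<in> I"
    then show "inv\<^bsub>add_monoid (poly_ring X)\<^esub> a \<in> I"
      using neg R a_inv_poly_ring[of a X] by (auto simp: a_inv_def)
  qed (use R in auto)
  then show "ideal I (poly_ring X)"
    using R by (intro idealI poly_ring_ring) (auto, metis mult.commute)
qed

lemma idealD:
  assumes "ideal I (poly_ring X)"
  shows "I \<subseteq> carrier (poly_ring X)" "0 \<in> I" "a \<in> I \<Longrightarrow> b \<in> I \<Longrightarrow> a + b \<in> I"
    "r \<in> carrier (poly_ring X) \<Longrightarrow> a \<in> I \<Longrightarrow> r * a \<in> I"
    "a \<in> I \<Longrightarrow> - a \<in> I" "a \<in> I \<Longrightarrow> b \<in> I \<Longrightarrow> a - b \<in> I"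
    "(\<And>i. i \<in> A \<Longrightarrow> f i \<in> I) \<Longrightarrow> sum f A \<in> I"
proof -
  note I = assms[unfolded ideal_poly_ring_iff]
  show "I \<subseteq> carrier (poly_ring X)" "0 \<in> I" "a \<in> I \<Longrightarrow> b \<in> I \<Longrightarrow> a + b \<in> I"
    "r \<in> carrier (poly_ring X) \<Longrightarrow> a \<in> I \<Longrightarrow> r * a \<in> I" using I by auto
  show neg: "- a \<in> I" if "a \<in> I" for a
    using I that poly_ring_closed(3)[of "- 1" X]
    by (metis const_poly_hom(3) const_poly_simps(2) mult_minus1)
  show "a - b \<in> I" if "a \<in> I" "b \<in> I" for a b
    using I that neg[of b] by (metis diff_conv_add_uminus)
  show "sum f A \<in> I" if "\<And>i. i \<in> A \<Longrightarrow> f i \<in> I"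
    using that I by (induction A rule: infinite_finite_induct) auto
qed

lemma primeideal_poly_ring_iff:
  "primeideal P (poly_ring X) \<longleftrightarrow> ideal P (poly_ring X) \<and> 1 \<notin> P \<and>
     (\<forall>a\<in>carrier (poly_ring X). \<forall>b\<in>carrier (poly_ring X). a * b \<in> P \<longrightarrow> a \<in> P \<or> b \<in> P)"
  (is "_ = ?R")
proof
  assume "primeideal P (poly_ring X)"
  then interpret primeideal P "poly_ring X" .
  show ?R
    using is_ideal I_notcarr one_imp_carrier I_prime by auto
next
  assume ?R
  then show "primeideal P (poly_ring X)"
    using poly_ring_closed(2)[of X] by (intro primeidealI cring_poly_ring) auto
qed

lemma coset_eq_iff:
  assumes "ideal I (poly_ring X)" "p \<in> carrier (poly_ring X)" "q \<in> carrier (poly_ring X)"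
  shows "I +>\<^bsub>poly_ring X\<^esub> p = I +>\<^bsub>poly_ring X\<^esub> q \<longleftrightarrow> p - q \<in> I"
  using ring.quotient_eq_iff_same_a_r_cos[OF poly_ring_ring assms] a_minus_poly_ring[OF assms(2,3)]
  by simp

lemma subfield_constants:
  "subfield (range const_poly) (poly_ring X :: ('x, 'k::field) mpoly ring)"
proof -
  let ?C = "(poly_ring X) \<lparr>carrier := range const_poly\<rparr> :: ('x, 'k) mpoly ring"
  have "cring ?C"
  proof (rule cringI)
    show "abelian_group ?C"
    proof (rule abelian_groupI)
      fix p assume "p \<in> carrier ?C"
      then obtain c where "p = const_poly c" by auto
      then have "const_poly (- c) \<oplus>\<^bsub>?C\<^esub> p = \<zero>\<^bsub>?C\<^esub>"
        by (simp add: const_poly_hom)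
      then show "\<exists>q\<in>carrier ?C. q \<oplus>\<^bsub>?C\<^esub> p = \<zero>\<^bsub>?C\<^esub>"
        by auto
    qed (auto simp: const_poly_hom(1)[symmetric] add.assoc add.commute image_iff intro: exI[of _ 0])
    show "comm_monoid ?C"
      by (rule comm_monoidI)
         (auto simp: const_poly_hom(2)[symmetric] mult.assoc mult.commute image_iff
            intro: exI[of _ 1])
  qed (auto simp: distrib_right)
  then have "field ?C"
  proof (rule cring.cring_fieldI)
    show "Units ?C = carrier ?C - {\<zero>\<^bsub>?C\<^esub>}"
    proof (intro equalityI subsetI)
      fix p assume "p \<in> Units ?C"
      then show "p \<in> carrier ?C - {\<zero>\<^bsub>?C\<^esub>}" by (auto simp: Units_def)
    next
      fix p assume "p \<in> carrier ?C - {\<zero>\<^bsub>?C\<^esub>}"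
      then obtain c where c: "p = const_poly c" "c \<noteq> 0" by auto
      then have "const_poly (inverse c) * p = 1" "p * const_poly (inverse c) = 1"
        by (simp_all add: const_poly_hom(2)[symmetric])
      then show "p \<in> Units ?C" using c by (auto simp: Units_def)
    qed
  qed
  then show ?thesis
    by (rule ring.subfield_iff(1)[OF poly_ring_ring]) (auto simp: poly_ring_closed)
qed

section \<open>Linear algebra modulo an ideal\<close>

text \<open>A finite family of polynomials is linearly independent in the quotient, resp. its classes span
  the classes of \<open>W\<close>. Stating this with representatives keeps cosets out of all later arguments.\<close>

definition lincomb :: "'i set \<Rightarrow> ('i \<Rightarrow> ('x, 'k::field) mpoly) \<Rightarrow> ('i \<Rightarrow> 'k) \<Rightarrow> ('x, 'k) mpoly" where
  "lincomb A b c = (\<Sum>i\<in>A. const_poly (c i) * b i)"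

definition indep_mod :: "('x, 'k::field) mpoly set \<Rightarrow> 'i set \<Rightarrow> ('i \<Rightarrow> ('x, 'k) mpoly) \<Rightarrow> bool" where
  "indep_mod I A b \<longleftrightarrow> (\<forall>c. lincomb A b c \<in> I \<longrightarrow> (\<forall>i\<in>A. c i = 0))"

definition spans_mod ::
    "('x, 'k::field) mpoly set \<Rightarrow> 'i set \<Rightarrow> ('i \<Rightarrow> ('x, 'k) mpoly) \<Rightarrow> ('x, 'k) mpoly set \<Rightarrow> bool" where
  "spans_mod I A b W \<longleftrightarrow> (\<forall>p\<in>W. \<exists>c. p - lincomb A b c \<in> I)"

lemma lincomb_closed:
  assumes "\<And>i. i \<in> A \<Longrightarrow> b i \<in> carrier (poly_ring X)"
  shows "lincomb A b c \<in> carrier (poly_ring X)"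
  using assms unfolding lincomb_def
  by (induction A rule: infinite_finite_induct) (auto simp: poly_ring_closed)

locale proper_poly_ideal =
  fixes X :: "'x set" and I :: "('x, 'k::field) mpoly set"
  assumes ideal: "ideal I (poly_ring X)" and proper: "1 \<notin> I"
begin

abbreviation "R \<equiv> poly_ring X"
abbreviation "cls p \<equiv> I +>\<^bsub>R\<^esub> p"
abbreviation "scalars \<equiv> (\<lambda>c. cls (const_poly c)) ` UNIV"

lemma ring_quot: "ring (R Quot I)"
  using ideal.quotient_is_ring[OF ideal] .

lemma cls_closed: "p \<in> carrier R \<Longrightarrow> cls p \<in> carrier (R Quot I)"
  using ring_hom_closed[OF ideal.rcos_ring_hom[OF ideal]] .

lemma cls_hom:
  assumes "p \<in> carrier R" "q \<in> carrier R"
  shows "cls p \<oplus>\<^bsub>R Quot I\<^esub> cls q = cls (p + q)" "cls p \<otimes>\<^bsub>R Quot I\<^esub> cls q = cls (p * q)"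
  using ring_hom_add[OF ideal.rcos_ring_hom[OF ideal] assms]
    ring_hom_mult[OF ideal.rcos_ring_hom[OF ideal] assms] by simp_all

lemma cls_zero: "\<zero>\<^bsub>R Quot I\<^esub> = cls 0"
  using ring_hom_zero[OF ideal.rcos_ring_hom[OF ideal] poly_ring_ring ring_quot] by simp

lemma cls_eq_zero_iff: "p \<in> carrier R \<Longrightarrow> cls p = \<zero>\<^bsub>R Quot I\<^esub> \<longleftrightarrow> p \<in> I"
  using coset_eq_iff[OF ideal, of p 0] by (simp add: cls_zero poly_ring_closed)

lemma subfield_scalars: "subfield scalars (R Quot I)"
proof -
  have one: "\<one>\<^bsub>R Quot I\<^esub> = cls 1"
    using ring_hom_one[OF ideal.rcos_ring_hom[OF ideal]] by simp
  have "\<one>\<^bsub>R Quot I\<^esub> \<noteq> \<zero>\<^bsub>R Quot I\<^esub>"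
    using cls_eq_zero_iff[of 1] proper by (simp add: poly_ring_closed one)
  then have "subfield ((\<lambda>p. cls p) ` range const_poly) (R Quot I)"
    by (intro ring_hom_ring.img_is_subfield(2)[OF ideal.rcos_ring_hom_ring[OF ideal] subfield_constants])
  then show ?thesis by (simp add: image_image)
qed

lemma combine_cls:
  assumes "distinct xs" "\<And>i. i \<in> set xs \<Longrightarrow> b i \<in> carrier R"
  shows "ring.combine (R Quot I) (map (\<lambda>i. cls (const_poly (c i))) xs) (map (\<lambda>i. cls (b i)) xs)
      = cls (lincomb (set xs) b c)"
  using assms
proof (induction xs)
  case Nil
  then show ?case
    by (simp add: ring.combine.simps[OF ring_quot] lincomb_def cls_zero)
next
  case (Cons i xs)
  have "lincomb (set xs) b c \<in> carrier R"
    using Cons.prems by (intro lincomb_closed) auto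
  then show ?case
    using Cons by (simp add: ring.combine.simps[OF ring_quot] lincomb_def cls_hom poly_ring_closed)
qed

lemma scalar_list:
  assumes "distinct xs" "set Ks \<subseteq> scalars" "length Ks = length xs"
  obtains c where "Ks = map (\<lambda>i. cls (const_poly (c i))) xs"
proof -
  have "\<exists>c. Ks = map (\<lambda>i. cls (const_poly (c i))) xs"
    using assms(3,1,2)
  proof (induction Ks xs rule: list_induct2)
    case (Cons K Ks i xs)
    then obtain c where c: "Ks = map (\<lambda>i. cls (const_poly (c i))) xs" by auto
    obtain a where "K = cls (const_poly a)" using Cons.prems by auto
    then have "K # Ks = map (\<lambda>j. cls (const_poly ((c(i := a)) j))) (i # xs)"
      using c Cons.prems by auto
    then show ?case by (rule exI[of _ "c(i := a)"])
  qed auto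
  then show thesis using that by blast
qed

lemma Span_cls:
  assumes "distinct xs" "\<And>i. i \<in> set xs \<Longrightarrow> b i \<in> carrier R"
  shows "ring.Span (R Quot I) scalars (map (\<lambda>i. cls (b i)) xs)
    = range (\<lambda>c. cls (lincomb (set xs) b c))"
proof -
  interpret Q: ring "R Quot I" by (rule ring_quot)
  have "set (map (\<lambda>i. cls (b i)) xs) \<subseteq> carrier (R Quot I)"
    using assms(2) cls_closed by auto
  note * = Q.Span_eq_combine_set_length_version[OF subfield_scalars this]
  show ?thesis unfolding *
  proof (intro equalityI subsetI)
    fix u assume "u \<in> {Q.combine Ks (map (\<lambda>i. cls (b i)) xs) |Ks.
       length Ks = length (map (\<lambda>i. cls (b i)) xs) \<and> set Ks \<subseteq> scalars}"
    then obtain Ks where Ks: "u = Q.combine Ks (map (\<lambda>i. cls (b i)) xs)"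
      "length Ks = length xs" "set Ks \<subseteq> scalars" by auto
    obtain c where "Ks = map (\<lambda>i. cls (const_poly (c i))) xs"
      using scalar_list[OF assms(1) Ks(3,2)] .
    then show "u \<in> range (\<lambda>c. cls (lincomb (set xs) b c))"
      using Ks(1) combine_cls[of xs b c] assms by auto
  next
    fix u assume "u \<in> range (\<lambda>c. cls (lincomb (set xs) b c))"
    then obtain c where "u = cls (lincomb (set xs) b c)" by auto
    then have u: "u = Q.combine (map (\<lambda>i. cls (const_poly (c i))) xs) (map (\<lambda>i. cls (b i)) xs)"
      using combine_cls[of xs b c] assms by simp
    show "u \<in> {Q.combine Ks (map (\<lambda>i. cls (b i)) xs) |Ks.
       length Ks = length (map (\<lambda>i. cls (b i)) xs) \<and> set Ks \<subseteq> scalars}"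
      unfolding u by (intro CollectI exI conjI refl) auto
  qed
qed

lemma independent_cls:
  assumes "distinct xs" "\<And>i. i \<in> set xs \<Longrightarrow> b i \<in> carrier R" "indep_mod I (set xs) b"
  shows "ring.independent (R Quot I) scalars (map (\<lambda>i. cls (b i)) xs)"
proof -
  interpret Q: ring "R Quot I" by (rule ring_quot)
  let ?us = "map (\<lambda>i. cls (b i)) xs"
  have us: "set ?us \<subseteq> carrier (R Quot I)"
    using assms(2) cls_closed by auto
  show ?thesis
  proof (rule ccontr)
    assume "\<not> Q.independent scalars ?us"
    then obtain Ks where Ks: "length Ks = length ?us" "Q.combine Ks ?us = \<zero>\<^bsub>R Quot I\<^esub>"
      "set Ks \<subseteq> scalars" "set Ks \<noteq> {\<zero>\<^bsub>R Quot I\<^esub>}" "Ks \<noteq> []"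
      using Q.dependent_imp_non_trivial_combine[OF subfield_scalars us]
      by (metis Q.li_Nil length_0_conv list.set(1))
    obtain c where c: "Ks = map (\<lambda>i. cls (const_poly (c i))) xs"
      using scalar_list[OF assms(1) Ks(3)] Ks(1) by auto
    have "cls (lincomb (set xs) b c) = \<zero>\<^bsub>R Quot I\<^esub>"
      using Ks(2) combine_cls[of xs b c] assms c by auto
    then have "lincomb (set xs) b c \<in> I"
      using assms(2) by (subst (asm) cls_eq_zero_iff) (auto intro: lincomb_closed)
    then have "\<forall>i\<in>set xs. c i = 0"
      using assms(3) by (auto simp: indep_mod_def)
    then have "set Ks \<subseteq> {\<zero>\<^bsub>R Quot I\<^esub>}" by (auto simp: c cls_zero)
    then show False using Ks(4,5) by (cases Ks) auto
  qed
qed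

end

lemma (in ring) independent_length_le_spanning:
  assumes K: "subfield K R" and Us: "independent K Us" and Vs: "set Vs \<subseteq> carrier R"
    and "set Us \<subseteq> Span K Vs"
  shows "length Us \<le> length Vs"
proof -
  have "\<exists>Ws. independent K Ws \<and> Span K Ws = Span K Vs \<and> length Ws \<le> length Vs"
    using Vs
  proof (induction Vs)
    case (Cons v Vs)
    then obtain Ws where Ws: "independent K Ws" "Span K Ws = Span K Vs" "length Ws \<le> length Vs"
      by auto
    show ?case
    proof (cases "v \<in> Span K Ws")
      case True
      have "set (v # Vs) \<subseteq> Span K Vs"
        using True Ws(2) Span_base_incl[OF K] Cons.prems by auto
      then have "Span K (v # Vs) \<subseteq> Span K Vs"
        using Cons.prems by (intro mono_Span_subset[OF K]) auto
      moreover have "Span K Vs \<subseteq> Span K (v # Vs)"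
        using Cons.prems by (intro mono_Span[OF K]) auto
      ultimately show ?thesis
        using Ws by (intro exI[of _ Ws]) auto
    next
      case False
      then have "independent K (v # Ws)"
        using Ws Cons.prems by (intro li_Cons) auto
      then show ?thesis using Ws by (intro exI[of _ "v # Ws"]) auto
    qed
  qed auto
  then obtain Ws where Ws: "independent K Ws" "Span K Ws = Span K Vs" "length Ws \<le> length Vs"
    by auto
  have "length Us \<le> length Ws"
    using assms Ws by (intro independent_length_le[OF K]) auto
  then show ?thesis using Ws by simp
qed

context proper_poly_ideal
begin

text \<open>Steinitz exchange in the quotient.\<close>

lemma card_indep_le_card_spans:
  assumes "finite A" "finite B" "\<And>i. i \<in> A \<Longrightarrow> a i \<in> carrier R" "\<And>i. i \<in> B \<Longrightarrow> b i \<in> carrier R"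
    and indep: "indep_mod I A a" and spans: "spans_mod I B b (a ` A)"
  shows "card A \<le> card B"
proof -
  interpret Q: ring "R Quot I" by (rule ring_quot)
  obtain xs where xs: "distinct xs" "set xs = A" using finite_distinct_list[OF assms(1)] by auto
  obtain ys where ys: "distinct ys" "set ys = B" using finite_distinct_list[OF assms(2)] by auto
  have "Q.independent scalars (map (\<lambda>i. cls (a i)) xs)"
    using xs assms(3) indep by (intro independent_cls) auto
  moreover have "set (map (\<lambda>i. cls (b i)) ys) \<subseteq> carrier (R Quot I)"
    using ys assms(4) cls_closed by auto
  moreover have "cls (a i) \<in> Q.Span scalars (map (\<lambda>i. cls (b i)) ys)" if i: "i \<in> A" for i
  proof -
    obtain c where "a i - lincomb B b c \<in> I"
      using bspec[OF spans[unfolded spans_mod_def], of "a i"] i by auto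
    moreover have "lincomb B b c \<in> carrier R" using assms(4) by (intro lincomb_closed)
    ultimately have "cls (a i) = cls (lincomb B b c)"
      using assms(3) i by (simp add: coset_eq_iff[OF ideal])
    then show ?thesis
      using Span_cls[of ys b] ys assms(4) by auto
  qed
  ultimately have "length (map (\<lambda>i. cls (a i)) xs) \<le> length (map (\<lambda>i. cls (b i)) ys)"
    using xs by (intro Q.independent_length_le_spanning[OF subfield_scalars]) auto
  then show ?thesis using distinct_card[OF xs(1)] distinct_card[OF ys(1)] xs ys by simp
qed

lemma hilbert_function_eq_card_basis:
  assumes "finite A" "\<And>i. i \<in> A \<Longrightarrow> b i \<in> graded_part X q"
    and indep: "indep_mod I A b" and spans: "spans_mod I A b (graded_part X q)"
  shows "hilbert_function X I q = card A"
proof -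
  interpret Q: ring "R Quot I" by (rule ring_quot)
  obtain xs where xs: "distinct xs" "set xs = A" using finite_distinct_list[OF assms(1)] by auto
  have b: "b i \<in> carrier R" if "i \<in> A" for i
    using assms(2)[OF that] by (simp add: graded_part_def)
  have lin: "lincomb A b c \<in> graded_part X q" for c
    using assms(2) b lincomb_closed[of A b X c]
    by (auto simp: graded_part_def lincomb_def in_keys_iff lookup_sum const_poly_mult_lookup
        dest!: sum.not_neutral_contains_not_neutral)
  have "range (\<lambda>c. cls (lincomb A b c)) = (\<lambda>p. cls p) ` graded_part X q"
  proof (intro equalityI subsetI)
    fix u assume "u \<in> (\<lambda>p. cls p) ` graded_part X q"
    then obtain p where p: "p \<in> graded_part X q" "u = cls p" by auto
    then obtain c where "p - lincomb A b c \<in> I" using spans by (auto simp: spans_mod_def)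
    then have "cls p = cls (lincomb A b c)"
      using p b by (subst coset_eq_iff[OF ideal]) (auto simp: graded_part_def intro: lincomb_closed)
    then show "u \<in> range (\<lambda>c. cls (lincomb A b c))" using p by auto
  qed (use lin in auto)
  then have "Q.Span scalars (map (\<lambda>i. cls (b i)) xs) = (\<lambda>p. cls p) ` graded_part X q"
    using Span_cls[of xs b] xs b by simp
  moreover have "Q.independent scalars (map (\<lambda>i. cls (b i)) xs)"
    using xs b indep by (intro independent_cls) auto
  ultimately have "Q.dimension (card A) scalars ((\<lambda>p. cls p) ` graded_part X q)"
    using Q.dimensionI[OF subfield_scalars] distinct_card[OF xs(1)] xs(2) by (metis length_map)
  then show ?thesis
    unfolding hilbert_function_def ring.dim_def[OF ring_quot] over_def
    using Q.dimension_is_inj[OF subfield_scalars] by (intro the_equality) auto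
qed

end

section \<open>Monomials, degrees and homogeneous components\<close>

definition mons :: "'x set \<Rightarrow> nat \<Rightarrow> ('x \<Rightarrow>\<^sub>0 nat) set" where
  "mons X q = {m. keys m \<subseteq> X \<and> monom_degree m = q}"

lemma monom_degree_superset:
  assumes "finite A" "keys m \<subseteq> A"
  shows "monom_degree m = (\<Sum>x\<in>A. lookup m x)"
  unfolding monom_degree_def using assms
  by (intro sum.mono_neutral_left) (auto simp: in_keys_iff)

lemma monom_degree_add: "monom_degree (a + b) = monom_degree a + monom_degree b"
proof -
  have "monom_degree m = (\<Sum>x\<in>keys a \<union> keys b. lookup m x)" if "keys m \<subseteq> keys a \<union> keys b" for m
    using that by (intro monom_degree_superset) auto
  then show ?thesis by (simp add: keys_add_nat lookup_add sum.distrib)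
qed

lemma monom_degree_single [simp]: "monom_degree (single x k) = k"
  by (simp add: monom_degree_def)

lemma monom_degree_0 [simp]: "monom_degree 0 = 0"
  by (simp add: monom_degree_def)

lemma lookup_le_monom_degree: "lookup m x \<le> monom_degree m"
  unfolding monom_degree_def by (cases "x \<in> keys m") (auto simp: in_keys_iff intro: member_le_sum)

lemma finite_exponents_le:
  assumes "finite X"
  shows "finite {m :: 'x \<Rightarrow>\<^sub>0 nat. keys m \<subseteq> X \<and> (\<forall>x. lookup m x \<le> q)}"
proof (rule inj_on_finite[where f = lookup])
  show "inj_on lookup {m. keys m \<subseteq> X \<and> (\<forall>x. lookup m x \<le> q)}"
    by (rule inj_onI) simp
  show "lookup ` {m. keys m \<subseteq> X \<and> (\<forall>x. lookup m x \<le> q)}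
      \<subseteq> {f. \<forall>x. (x \<in> X \<longrightarrow> f x \<in> {..q}) \<and> (x \<notin> X \<longrightarrow> f x = 0)}"
    by (auto simp: in_keys_iff)
  show "finite {f. \<forall>x. (x \<in> X \<longrightarrow> f x \<in> {..q}) \<and> (x \<notin> X \<longrightarrow> f x = 0)}"
    using assms by (intro finite_set_of_finite_funs) auto
qed

lemma finite_mons: "finite X \<Longrightarrow> finite (mons X q)"
  by (rule finite_subset[OF _ finite_exponents_le[of X q]])
     (auto simp: mons_def lookup_le_monom_degree)

lemma graded_part_alt: "p \<in> graded_part X q \<longleftrightarrow> keys p \<subseteq> mons X q"
  by (auto simp: graded_part_def mons_def carrier_poly_ring)

lemma graded_part_carrier: "graded_part X q \<subseteq> carrier (poly_ring X)"
  by (auto simp: graded_part_def)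

lemma graded_part_closed:
  "0 \<in> graded_part X q"
  "p \<in> graded_part X q \<Longrightarrow> r \<in> graded_part X q \<Longrightarrow> p + r \<in> graded_part X q"
  "p \<in> graded_part X q \<Longrightarrow> r \<in> graded_part X q \<Longrightarrow> p - r \<in> graded_part X q"
  "p \<in> graded_part X q \<Longrightarrow> const_poly c * p \<in> graded_part X q"
  "m \<in> mons X q \<Longrightarrow> single m c \<in> graded_part X q"
proof -
  show "p + r \<in> graded_part X q" if "p \<in> graded_part X q" "r \<in> graded_part X q"
    using that Poly_Mapping.keys_add[of p r] by (auto simp: graded_part_alt)
  show "p - r \<in> graded_part X q" if "p \<in> graded_part X q" "r \<in> graded_part X q"
    using that unfolding graded_part_alt subset_iff by (metis diff_0_right in_keys_iff lookup_minus)
  show "const_poly c * p \<in> graded_part X q" if "p \<in> graded_part X q"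
    using that unfolding graded_part_alt subset_iff
    by (metis const_poly_mult_lookup in_keys_iff mult_zero_right)
qed (auto simp: graded_part_alt)

lemma graded_part_mult:
  assumes "p \<in> graded_part X q" "r \<in> graded_part X s"
  shows "p * r \<in> graded_part X (q + s)"
  using assms keys_mult[of p r]
  by (fastforce simp: graded_part_alt mons_def keys_add_nat monom_degree_add)

lemma lincomb_graded:
  assumes "\<And>i. i \<in> A \<Longrightarrow> b i \<in> graded_part X q"
  shows "lincomb A b c \<in> graded_part X q"
  using assms unfolding lincomb_def
  by (induction A rule: infinite_finite_induct) (auto simp: graded_part_closed)

lemma lookup_mult_sum:
  assumes "finite A" "keys p \<subseteq> A" "finite B" "keys q \<subseteq> B"
  shows "lookup (p * q) m = (\<Sum>a\<in>A. \<Sum>b\<in>B. if a + b = m then lookup p a * lookup q b else 0)"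
proof -
  have "p * q = (\<Sum>a\<in>A. single a (lookup p a)) * (\<Sum>b\<in>B. single b (lookup q b))"
    using assms by (simp add: sum_single_lookup)
  also have "\<dots> = (\<Sum>a\<in>A. \<Sum>b\<in>B. single (a + b) (lookup p a * lookup q b))"
    by (simp add: sum_product mult_single)
  finally show ?thesis
    by (auto simp: lookup_sum lookup_single when_def intro!: sum.cong)
qed

lemma lookup_single_mult: "lookup (single a c * p) (a + m) = c * lookup p m"
  for a :: "'x \<Rightarrow>\<^sub>0 nat"
proof -
  have "lookup (single a c * p) (a + m)
      = (\<Sum>b\<in>keys p. if a + b = a + m then c * lookup p b else 0)"
    by (subst lookup_mult_sum[of "{a}" _ "keys p"]) auto
  also have "\<dots> = (\<Sum>b\<in>keys p. if b = m then c * lookup p b else 0)"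
    by (intro sum.cong) auto
  also have "\<dots> = c * lookup p m" by (simp add: not_in_keys_iff_lookup_eq_zero)
  finally show ?thesis .
qed

definition hcomp :: "nat \<Rightarrow> ('x, 'k::field) mpoly \<Rightarrow> ('x, 'k) mpoly" where
  "hcomp q p = (\<Sum>m\<in>{m \<in> keys p. monom_degree m = q}. single m (lookup p m))"

lemma lookup_hcomp: "lookup (hcomp q p) m = (if monom_degree m = q then lookup p m else 0)"
  by (simp add: hcomp_def lookup_sum lookup_single when_def not_in_keys_iff_lookup_eq_zero)

lemma keys_hcomp: "keys (hcomp q p) = {m \<in> keys p. monom_degree m = q}"
  by (auto simp: in_keys_iff lookup_hcomp split: if_splits)

lemma hcomp_graded: "p \<in> carrier (poly_ring X) \<Longrightarrow> hcomp q p \<in> graded_part X q"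
  by (auto simp: graded_part_alt mons_def keys_hcomp carrier_poly_ring)

lemma hcomp_add: "hcomp q (a + b) = hcomp q a + hcomp q b"
  by (rule poly_mapping_eqI) (simp add: lookup_hcomp lookup_add)

lemma hcomp_0 [simp]: "hcomp q 0 = 0"
  by (rule poly_mapping_eqI) (simp add: lookup_hcomp)

lemma hcomp_sum: "hcomp q (sum f A) = (\<Sum>i\<in>A. hcomp q (f i))"
  by (induction A rule: infinite_finite_induct) (auto simp: hcomp_add)

lemma hcomp_homogeneous:
  assumes "p \<in> graded_part X d"
  shows "hcomp q p = (if q = d then p else 0)"
  using assms
  by (intro poly_mapping_eqI)
     (auto simp: lookup_hcomp graded_part_alt mons_def in_keys_iff)

lemma hcomp_mult:
  assumes f: "f \<in> graded_part X d"
  shows "hcomp q (f * g) = (if d \<le> q then f * hcomp (q - d) g else 0)"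
proof (rule poly_mapping_eqI)
  fix m
  have d: "monom_degree a = d" if "a \<in> keys f" for a
    using that f by (auto simp: graded_part_alt mons_def)
  have "lookup (hcomp q (f * g)) m
      = (\<Sum>a\<in>keys f. \<Sum>b\<in>keys g. if monom_degree m = q \<and> a + b = m then lookup f a * lookup g b else 0)"
    by (simp add: lookup_hcomp lookup_mult_sum[of "keys f" f "keys g" g])
  also have "\<dots> = (\<Sum>a\<in>keys f. \<Sum>b\<in>keys g. if a + b = m then
      lookup f a * (if d \<le> q then lookup (hcomp (q - d) g) b else 0) else 0)"
    using d by (intro sum.cong refl) (auto simp: lookup_hcomp monom_degree_add)
  also have "\<dots> = lookup (if d \<le> q then f * hcomp (q - d) g else 0) m"
  proof (cases "d \<le> q")
    case True
    have "lookup (f * hcomp (q - d) g) m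
        = (\<Sum>a\<in>keys f. \<Sum>b\<in>keys g. if a + b = m then lookup f a * lookup (hcomp (q - d) g) b else 0)"
      by (rule lookup_mult_sum) (auto simp: keys_hcomp)
    with True show ?thesis by (simp cong: if_cong)
  qed (simp cong: if_cong)
  finally show "lookup (hcomp q (f * g)) m = lookup (if d \<le> q then f * hcomp (q - d) g else 0) m" .
qed

definition homogeneous_set :: "('x, 'k::field) mpoly set \<Rightarrow> bool" where
  "homogeneous_set I \<longleftrightarrow> (\<forall>p\<in>I. \<forall>q. hcomp q p \<in> I)"

lemma homogeneous_genideal:
  fixes G :: "('x, 'k::field) mpoly set"
  assumes G: "\<And>g. g \<in> G \<Longrightarrow> \<exists>d. g \<in> graded_part X d"
  shows "homogeneous_set (Idl\<^bsub>poly_ring X\<^esub> G)"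
proof -
  let ?I = "Idl\<^bsub>poly_ring X\<^esub> G"
  have G': "G \<subseteq> carrier (poly_ring X)"
    using G graded_part_carrier by blast
  have I: "ideal ?I (poly_ring X)"
    by (rule ring.genideal_ideal[OF poly_ring_ring G'])
  let ?H = "{p \<in> ?I. \<forall>q. hcomp q p \<in> ?I}"
  have "ideal ?H (poly_ring X)"
    unfolding ideal_poly_ring_iff
  proof (intro conjI ballI)
    fix r a :: "('x, 'k) mpoly" assume r: "r \<in> carrier (poly_ring X)" and a: "a \<in> ?H"
    have "hcomp q (r * a) \<in> ?I" for q
    proof -
      have "hcomp q (r * a) = (\<Sum>m\<in>keys r. hcomp q (single m (lookup r m) * a))"
        by (subst sum_single_lookup[of "keys r" r, symmetric])
           (simp_all add: sum_distrib_right hcomp_sum)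
      also have "\<dots> = (\<Sum>m\<in>keys r. if monom_degree m \<le> q
          then single m (lookup r m) * hcomp (q - monom_degree m) a else 0)"
        using r by (intro sum.cong refl hcomp_mult[where X = X])
          (auto simp: carrier_poly_ring mons_def intro: graded_part_closed)
      also have "\<dots> \<in> ?I"
        using a r by (intro idealD(7)[OF I])
          (auto simp: idealD[OF I] carrier_poly_ring intro!: idealD(4)[OF I] poly_ring_closed)
      finally show ?thesis .
    qed
    then show "r * a \<in> ?H" using a r idealD(4)[OF I] by auto
  qed (use idealD[OF I] in \<open>auto simp: hcomp_add\<close>)
  moreover have "G \<subseteq> ?H"
  proof
    fix g assume g: "g \<in> G"
    then obtain d where "g \<in> graded_part X d" using G by auto
    then show "g \<in> ?H"
      using hcomp_homogeneous[of g X d] g ring.genideal_self[OF poly_ring_ring G'] idealD(2)[OF I]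
      by auto
  qed
  ultimately have "?I \<subseteq> ?H"
    by (rule ring.genideal_minimal[OF poly_ring_ring])
  then show ?thesis by (auto simp: homogeneous_set_def)
qed

section \<open>Standard monomials\<close>

text \<open>Sending the variables to distinct primes turns monomials into positive integers
  multiplicatively and, by unique factorisation, injectively. The order of the integers thus
  becomes a well-founded monomial order.\<close>

lemma monomial_order_exists:
  assumes "finite X"
  obtains \<kappa> :: "('x \<Rightarrow>\<^sub>0 nat) \<Rightarrow> nat" where
    "\<And>a b. \<kappa> (a + b) = \<kappa> a * \<kappa> b" "\<And>a. \<kappa> a > 0" "inj_on \<kappa> {m. keys m \<subseteq> X}"
proof -
  obtain f :: "nat \<Rightarrow> nat" where f: "inj f" "range f \<subseteq> {p. prime p}"
    using infinite_countable_subset[OF primes_infinite] by auto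
  obtain g :: "'x \<Rightarrow> nat" where g: "inj_on g X"
    using finite_imp_inj_to_nat_seg[OF assms] by auto
  define \<pi> where "\<pi> x = f (g x)" for x
  have inj: "inj_on \<pi> X" using f(1) g by (auto simp: inj_on_def inj_def \<pi>_def)
  have prime: "prime (\<pi> x)" for x using f(2) by (auto simp: \<pi>_def)
  define \<kappa> where "\<kappa> m = (\<Prod>x\<in>X. \<pi> x ^ lookup m x)" for m
  have mult: "multiplicity (\<pi> y) (\<kappa> m) = lookup m y" if "y \<in> X" for m y
  proof -
    have "\<kappa> m = (\<Prod>p\<in>\<pi> ` X. p ^ lookup m (inv_into X \<pi> p))"
      using inj by (simp add: \<kappa>_def prod.reindex)
    then show ?thesis
      using multiplicity_prod_prime_powers[of "\<pi> ` X" "\<pi> y" "\<lambda>p. lookup m (inv_into X \<pi> p)"]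
        assms prime that inj by auto
  qed
  show thesis
  proof (rule that[of \<kappa>])
    show "inj_on \<kappa> {m. keys m \<subseteq> X}"
    proof (rule inj_onI)
      fix a b assume ab: "a \<in> {m. keys m \<subseteq> X}" "b \<in> {m. keys m \<subseteq> X}" "\<kappa> a = \<kappa> b"
      show "a = b"
      proof (rule poly_mapping_eqI)
        fix y show "lookup a y = lookup b y"
        proof (cases "y \<in> X")
          case True
          then show ?thesis using mult[of y a] mult[of y b] ab(3) by simp
        next
          case False
          then have "y \<notin> keys a" "y \<notin> keys b" using ab by auto
          then show ?thesis by (simp add: not_in_keys_iff_lookup_eq_zero)
        qed
      qed
    qed
    show "\<kappa> a > 0" for a
      unfolding \<kappa>_def by (rule prod_pos) (use prime prime_gt_0_nat in auto)
  qed (simp add: \<kappa>_def lookup_add power_add prod.distrib)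
qed

text \<open>The product of the leading terms for such an order cannot be cancelled in the product of two
  polynomials, as no other pair of monomials has the same product.\<close>

lemma mpoly_mult_eq_0_iff:
  fixes p q :: "('x, 'k::field) mpoly"
  shows "p * q = 0 \<longleftrightarrow> p = 0 \<or> q = 0"
proof
  assume pq: "p * q = 0"
  show "p = 0 \<or> q = 0"
  proof (rule ccontr)
    assume "\<not> (p = 0 \<or> q = 0)"
    then have ne: "keys p \<noteq> {}" "keys q \<noteq> {}"
      by (metis Poly_Mapping.keys_eq_empty)+
    define X where "X = (\<Union>m\<in>keys p \<union> keys q. keys m)"
    have "finite X" by (auto simp: X_def)
    then obtain \<kappa> :: "('x \<Rightarrow>\<^sub>0 nat) \<Rightarrow> nat" where \<kappa>: "\<And>a b. \<kappa> (a + b) = \<kappa> a * \<kappa> b"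
      "\<And>a. \<kappa> a > 0" "inj_on \<kappa> {m. keys m \<subseteq> X}"
      using monomial_order_exists by blast
    have max: "\<exists>a\<in>A. \<forall>b\<in>A. \<kappa> b \<le> \<kappa> a" if "finite A" "A \<noteq> {}" for A
    proof -
      have "Max (\<kappa> ` A) \<in> \<kappa> ` A" using that by (intro Max_in) auto
      then obtain a where "a \<in> A" "\<kappa> a = Max (\<kappa> ` A)" by auto
      then show ?thesis using that by (intro bexI[of _ a]) auto
    qed
    obtain a where a: "a \<in> keys p" "\<And>b. b \<in> keys p \<Longrightarrow> \<kappa> b \<le> \<kappa> a"
      using max[of "keys p"] ne by auto
    obtain b where b: "b \<in> keys q" "\<And>c. c \<in> keys q \<Longrightarrow> \<kappa> c \<le> \<kappa> b"
      using max[of "keys q"] ne by auto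
    have uniq: "a' = a \<and> b' = b" if "a' \<in> keys p" "b' \<in> keys q" "a' + b' = a + b" for a' b'
    proof -
      have eq: "\<kappa> a' * \<kappa> b' = \<kappa> a * \<kappa> b" using that(3) \<kappa>(1) by metis
      have le: "\<kappa> a' \<le> \<kappa> a" "\<kappa> b' \<le> \<kappa> b" using a b that by auto
      have "\<kappa> a' = \<kappa> a"
      proof (rule ccontr)
        assume "\<kappa> a' \<noteq> \<kappa> a"
        then have "\<kappa> a' * \<kappa> b' < \<kappa> a * \<kappa> b"
          using le \<kappa>(2)[of b'] by (intro mult_less_le_imp_less) auto
        then show False using eq by simp
      qed
      moreover have "keys a' \<subseteq> X" "keys a \<subseteq> X" using that a by (auto simp: X_def)
      ultimately have "a' = a" using \<kappa>(3) by (auto dest: inj_onD)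
      then show ?thesis using that(3) by simp
    qed
    have "lookup (p * q) (a + b)
        = (\<Sum>a'\<in>keys p. \<Sum>b'\<in>keys q. if a' + b' = a + b then lookup p a' * lookup q b' else 0)"
      by (rule lookup_mult_sum) auto
    also have "\<dots> = (\<Sum>a'\<in>keys p. \<Sum>b'\<in>keys q. if b' = b then if a' = a then lookup p a * lookup q b else 0 else 0)"
      using uniq by (intro sum.cong refl) auto
    also have "\<dots> = lookup p a * lookup q b"
      using a b by simp
    also have "\<dots> \<noteq> 0" using a b by (simp add: in_keys_iff)
    finally show False using pq by simp
  qed
qed auto

text \<open>Macaulay's basis theorem, with \<open>L\<close> the set of leading monomials of homogeneous elements of \<open>I\<close>.
  A homogeneous element of \<open>I\<close> has its leading monomial in \<open>L\<close>, so the other monomials are independent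
  modulo \<open>I\<close>. They span, because a leading monomial in \<open>L\<close> can be cancelled by an element of \<open>I\<close>, which
  leaves smaller monomials.\<close>

theorem standard_monomials_basis:
  fixes I :: "('x, 'k::field) mpoly set"
  assumes fin: "finite X" and I: "ideal I (poly_ring X)"
  shows "\<exists>L. (\<forall>m\<in>L. \<forall>a. keys a \<subseteq> X \<longrightarrow> m + a \<in> L) \<and>
    (\<forall>q. indep_mod I (mons X q - L) (\<lambda>m. single m 1) \<and>
      spans_mod I (mons X q - L) (\<lambda>m. single m 1) (graded_part X q))"
proof -
  obtain \<kappa> :: "('x \<Rightarrow>\<^sub>0 nat) \<Rightarrow> nat" where \<kappa>: "\<And>a b. \<kappa> (a + b) = \<kappa> a * \<kappa> b"
    "\<And>a. \<kappa> a > 0" "inj_on \<kappa> {m. keys m \<subseteq> X}"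
    using monomial_order_exists[OF fin] by blast
  define lead where "lead m p \<longleftrightarrow> m \<in> keys p \<and> (\<forall>m'\<in>keys p. \<kappa> m' \<le> \<kappa> m)" for m and p :: "('x, 'k) mpoly"
  define L where "L = {m. \<exists>p\<in>I. \<exists>q. p \<in> graded_part X q \<and> lead m p}"
  have lincomb: "lookup (lincomb A (\<lambda>m. single m 1) c) m = (if m \<in> A then c m else 0)"
    if "finite A" for A m and c :: "('x \<Rightarrow>\<^sub>0 nat) \<Rightarrow> 'k"
    using that by (simp add: lincomb_def const_poly_mult_single lookup_sum lookup_single when_def)
  show ?thesis
  proof (intro exI[of _ L] conjI ballI allI impI)
    fix m and a :: "'x \<Rightarrow>\<^sub>0 nat" assume "m \<in> L" and a: "keys a \<subseteq> X"
    from \<open>m \<in> L\<close> obtain p q where p: "p \<in> I" "p \<in> graded_part X q" "lead m p" by (auto simp: L_def)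
    have "single a 1 * p \<in> I" using p a by (intro idealD(4)[OF I] poly_ring_closed)
    moreover have "single a 1 * p \<in> graded_part X (monom_degree a + q)"
      using p a by (intro graded_part_mult graded_part_closed) (auto simp: mons_def)
    moreover have "keys (single a 1 * p) \<subseteq> {a + b |b. b \<in> keys p}"
      using keys_mult[of "single a 1" p] by auto
    then have "lead (m + a) (single a 1 * p)"
      using p(3) lookup_single_mult[of a 1 p m] \<kappa>(2)[of a] unfolding lead_def
      by (auto simp: in_keys_iff add.commute \<kappa>(1))
    ultimately show "m + a \<in> L" unfolding L_def by blast
  next
    fix q
    show "indep_mod I (mons X q - L) (\<lambda>m. single m 1)"
      unfolding indep_mod_def
    proof (intro allI impI, rule ccontr)
      fix c assume c: "lincomb (mons X q - L) (\<lambda>m. single m 1) c \<in> I"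
        and nz: "\<not> (\<forall>m\<in>mons X q - L. c m = 0)"
      let ?p = "lincomb (mons X q - L) (\<lambda>m. single m 1) c"
      note lk = lincomb[OF finite_Diff[OF finite_mons[OF fin]]]
      have gr: "?p \<in> graded_part X q"
        by (intro lincomb_graded graded_part_closed) auto
      have ne: "keys ?p \<noteq> {}" using nz by (auto simp: lk set_eq_iff in_keys_iff)
      then have "Max (\<kappa> ` keys ?p) \<in> \<kappa> ` keys ?p" by (intro Max_in) auto
      then obtain m where "m \<in> keys ?p" "\<kappa> m = Max (\<kappa> ` keys ?p)" by auto
      then have "lead m ?p" by (auto simp: lead_def)
      then have "m \<in> L" using c gr by (auto simp: L_def)
      moreover have "m \<notin> L" using \<open>m \<in> keys ?p\<close> by (auto simp: in_keys_iff lk split: if_splits)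
      ultimately show False by simp
    qed
  next
    fix q
    let ?B = "mons X q - L"
    have red: "\<exists>c. p - lincomb ?B (\<lambda>m. single m 1) c \<in> I"
      if "p \<in> graded_part X q" "\<And>m. m \<in> keys p \<Longrightarrow> \<kappa> m < N" for p N
      using that
    proof (induction N arbitrary: p)
      case 0
      then have "m \<notin> keys p" for m by auto
      then have "p = 0" by (metis Poly_Mapping.keys_eq_empty ex_in_conv)
      then show ?case
        using idealD(2)[OF I] by (intro exI[of _ "\<lambda>_. 0"]) (simp add: lincomb_def)
    next
      case (Suc N)
      show ?case
      proof (cases "\<exists>m\<in>keys p. \<kappa> m = N")
        case False
        then have "\<kappa> m < N" if "m \<in> keys p" for m using Suc.prems(2)[OF that] that by force
        then show ?thesis using Suc by blast
      next
        case True
        then obtain m where m: "m \<in> keys p" "\<kappa> m = N" by auto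
        have mq: "m \<in> mons X q" using m Suc.prems(1) by (auto simp: graded_part_alt)
        have less: "\<kappa> m' < N"
          if "m' \<in> mons X q" "\<kappa> m' \<le> N" "m' \<noteq> m" for m'
        proof -
          have "\<kappa> m' \<noteq> \<kappa> m"
            using that mq inj_onD[OF \<kappa>(3), of m' m] by (auto simp: mons_def)
          then show ?thesis using that m(2) by linarith
        qed
        show ?thesis
        proof (cases "m \<in> L")
          case True
          then obtain f s where f: "f \<in> I" "f \<in> graded_part X s" "lead m f" by (auto simp: L_def)
          have "s = q" using f mq by (auto simp: graded_part_alt mons_def lead_def)
          let ?a = "lookup p m / lookup f m"
          let ?p = "p - const_poly ?a * f"
          have p': "?p \<in> graded_part X q"
            using f \<open>s = q\<close> Suc.prems by (auto intro: graded_part_closed)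
          moreover have "\<kappa> m' < N" if "m' \<in> keys ?p" for m'
          proof (rule less)
            show "m' \<in> mons X q" using that p' by (auto simp: graded_part_alt)
            have "m' \<in> keys p \<or> m' \<in> keys f"
              using that by (auto simp: in_keys_iff lookup_minus const_poly_mult_lookup)
            then show "\<kappa> m' \<le> N"
              using Suc.prems(2)[of m'] f(3) m(2) by (auto simp: lead_def)
            show "m' \<noteq> m"
              using that f(3) by (auto simp: in_keys_iff lookup_minus const_poly_mult_lookup lead_def)
          qed
          ultimately obtain c where "?p - lincomb ?B (\<lambda>m. single m 1) c \<in> I"
            using Suc.IH by blast
          then have "(?p - lincomb ?B (\<lambda>m. single m 1) c) + const_poly ?a * f \<in> I"
            using f by (intro idealD(3)[OF I] idealD(4)[OF I] poly_ring_closed)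
          then show ?thesis by (intro exI[of _ c]) (simp add: algebra_simps)
        next
          case False
          let ?p = "p - single m (lookup p m)"
          have p': "?p \<in> graded_part X q"
            using mq Suc.prems by (auto intro: graded_part_closed)
          moreover have "\<kappa> m' < N" if "m' \<in> keys ?p" for m'
          proof (rule less)
            show "m' \<in> mons X q" using that p' by (auto simp: graded_part_alt)
            show ne: "m' \<noteq> m" using that by (auto simp: in_keys_iff lookup_minus)
            then have "m' \<in> keys p" using that by (auto simp: in_keys_iff lookup_minus lookup_single)
            then show "\<kappa> m' \<le> N" using Suc.prems(2)[of m'] by auto
          qed
          ultimately obtain c where c: "?p - lincomb ?B (\<lambda>m. single m 1) c \<in> I"
            using Suc.IH by blast
          have fB: "finite ?B" by (intro finite_Diff finite_mons fin)
          have "lookup (single m (lookup p m) + lincomb ?B (\<lambda>m. single m 1) c) m'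
              = lookup (lincomb ?B (\<lambda>m. single m 1) (c(m := c m + lookup p m))) m'" for m'
            unfolding lookup_add lincomb[OF fB] lookup_single using mq False
            by (auto simp: when_def)
          then have eq: "single m (lookup p m) + lincomb ?B (\<lambda>m. single m 1) c
              = lincomb ?B (\<lambda>m. single m 1) (c(m := c m + lookup p m))"
            by (rule poly_mapping_eqI)
          show ?thesis
            using c unfolding diff_diff_add eq
            by (intro exI[of _ "c(m := c m + lookup p m)"])
        qed
      qed
    qed
    show "spans_mod I ?B (\<lambda>m. single m 1) (graded_part X q)"
      unfolding spans_mod_def
    proof
      fix p :: "('x, 'k) mpoly" assume "p \<in> graded_part X q"
      moreover have "\<kappa> m < Suc (Max (\<kappa> ` keys p))" if "m \<in> keys p" for m
        using that by (auto simp: less_Suc_eq_le)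
      ultimately show "\<exists>c. p - lincomb ?B (\<lambda>m. single m 1) c \<in> I" by (rule red)
    qed
  qed
qed

section \<open>Comparison of Hilbert functions\<close>

context proper_poly_ideal
begin

lemma graded_basis:
  assumes "finite X"
  shows "\<exists>B. finite B \<and> B \<subseteq> mons X q \<and> indep_mod I B (\<lambda>m. single m 1) \<and>
    spans_mod I B (\<lambda>m. single m 1) (graded_part X q) \<and> card B = hilbert_function X I q"
proof -
  obtain L where L: "indep_mod I (mons X q - L) (\<lambda>m. single m 1)"
    "spans_mod I (mons X q - L) (\<lambda>m. single m 1) (graded_part X q)"
    using standard_monomials_basis[OF assms ideal] by auto
  have "hilbert_function X I q = card (mons X q - L)"
    using L finite_mons[OF assms]
    by (intro hilbert_function_eq_card_basis[where b = "\<lambda>m. single m 1"])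
       (auto intro: graded_part_closed)
  then show ?thesis
    using L finite_mons[OF assms] by (intro exI[of _ "mons X q - L"]) auto
qed

lemma hilbert_function_le_card_spans:
  assumes fin: "finite X" and "finite B" "\<And>i. i \<in> B \<Longrightarrow> b i \<in> carrier (poly_ring X)"
    and "spans_mod I B b (graded_part X q)"
  shows "hilbert_function X I q \<le> card B"
proof -
  obtain A where A: "finite A" "A \<subseteq> mons X q" "indep_mod I A (\<lambda>m. single m 1)"
    "card A = hilbert_function X I q"
    using graded_basis[OF fin, of q] by auto
  have *: "(\<lambda>m. single m 1) ` A \<subseteq> graded_part X q"
    using A by (auto intro: graded_part_closed)
  have "card A \<le> card B"
  proof (rule card_indep_le_card_spans[OF A(1) assms(2) _ assms(3) A(3)])
    show "single i 1 \<in> carrier (poly_ring X)" if "i \<in> A" for i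
      using that A(2) by (auto simp: mons_def intro: poly_ring_closed)
    show "spans_mod I B b ((\<lambda>m. single m 1) ` A)"
      using assms(4) * by (auto simp: spans_mod_def)
  qed
  then show ?thesis using A by simp
qed

end

lemma hilbert_function_antimono:
  assumes fin: "finite X" and I: "ideal I (poly_ring X)" and J: "ideal J (poly_ring X)"
    and "I \<subseteq> J" "1 \<notin> J"
  shows "hilbert_function X J q \<le> hilbert_function X I q"
proof -
  interpret I: proper_poly_ideal X I by (rule proper_poly_ideal.intro) (use assms in auto)
  interpret J: proper_poly_ideal X J by (rule proper_poly_ideal.intro) (use assms in auto)
  obtain B where B: "finite B" "B \<subseteq> mons X q" "spans_mod I B (\<lambda>m. single m 1) (graded_part X q)"
    "card B = hilbert_function X I q"
    using I.graded_basis[OF fin, of q] by auto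
  have "hilbert_function X J q \<le> card B"
    using B assms(4)
    by (intro J.hilbert_function_le_card_spans[OF fin, where b = "\<lambda>m. single m 1"])
       (fastforce simp: spans_mod_def mons_def intro: poly_ring_closed)+
  then show ?thesis using B by simp
qed

text \<open>A form of degree \<open>q\<close> is modulo \<open>J\<close> a combination of basis monomials of the quotient by \<open>J\<close>. The
  difference lies in \<open>J\<close>, hence is a multiple \<open>f * g\<close> modulo \<open>I\<close>, and as \<open>I\<close> is homogeneous, \<open>g\<close> may be
  replaced by its component of degree \<open>q - d\<close>, which only matters modulo \<open>I'\<close>.\<close>

lemma hilbert_function_le_add:
  assumes fin: "finite X" and I: "ideal I (poly_ring X)" "homogeneous_set I" "1 \<notin> I"
    and I': "ideal I' (poly_ring X)" "1 \<notin> I'"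
    and J: "ideal J (poly_ring X)" "1 \<notin> J"
    and f: "f \<in> graded_part X d"
    and IJ: "\<And>p. p \<in> J \<Longrightarrow> \<exists>i\<in>I. \<exists>g\<in>carrier (poly_ring X). p = i + f * g"
    and fI': "\<And>p. p \<in> I' \<Longrightarrow> f * p \<in> I"
    and "d \<le> q"
  shows "hilbert_function X I q \<le> hilbert_function X J q + hilbert_function X I' (q - d)"
proof -
  interpret I: proper_poly_ideal X I by (rule proper_poly_ideal.intro) (use assms in auto)
  interpret I': proper_poly_ideal X I' by (rule proper_poly_ideal.intro) (use assms in auto)
  interpret J: proper_poly_ideal X J by (rule proper_poly_ideal.intro) (use assms in auto)
  obtain A where A: "finite A" "A \<subseteq> mons X q" "spans_mod J A (\<lambda>m. single m 1) (graded_part X q)"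
    "card A = hilbert_function X J q"
    using J.graded_basis[OF fin, of q] by auto
  obtain B where B: "finite B" "B \<subseteq> mons X (q - d)"
    "spans_mod I' B (\<lambda>m. single m 1) (graded_part X (q - d))"
    "card B = hilbert_function X I' (q - d)"
    using I'.graded_basis[OF fin, of "q - d"] by auto
  define b where "b = (\<lambda>i :: _ + _. case i of Inl m \<Rightarrow> single m (1::'b) | Inr m \<Rightarrow> f * single m 1)"
  have "hilbert_function X I q \<le> card (A <+> B)"
  proof (rule I.hilbert_function_le_card_spans[OF fin, where b = b])
    show "finite (A <+> B)" using A B by simp
    show "b i \<in> carrier (poly_ring X)" if "i \<in> A <+> B" for i
    proof -
      have "f \<in> carrier (poly_ring X)" using f graded_part_carrier by blast
      moreover have "\<forall>m\<in>A \<union> B. keys m \<subseteq> X" using A(2) B(2) by (auto simp: mons_def)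
      ultimately show ?thesis
        using that by (elim PlusE) (simp_all add: b_def poly_ring_closed)
    qed
    show "spans_mod I (A <+> B) b (graded_part X q)"
      unfolding spans_mod_def
    proof
      fix p :: "('a, 'b) mpoly" assume p: "p \<in> graded_part X q"
      obtain c where c: "p - lincomb A (\<lambda>m. single m 1) c \<in> J"
        using A(3) p by (auto simp: spans_mod_def)
      let ?r = "p - lincomb A (\<lambda>m. single m 1) c"
      obtain i g where ig: "i \<in> I" "g \<in> carrier (poly_ring X)" "?r = i + f * g"
        using IJ[OF c] by auto
      have "?r \<in> graded_part X q"
        using A(2) by (intro graded_part_closed p lincomb_graded) auto
      then have r: "?r = hcomp q i + f * hcomp (q - d) g"
        using hcomp_homogeneous[of ?r X q q] hcomp_mult[OF f, of q g] \<open>d \<le> q\<close> ig(3)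
        by (simp add: hcomp_add)
      obtain c' where c': "hcomp (q - d) g - lincomb B (\<lambda>m. single m 1) c' \<in> I'"
        using B(3) hcomp_graded[OF ig(2), of "q - d"] by (auto simp: spans_mod_def)
      have "lincomb (A <+> B) b (case_sum c c')
          = lincomb A (\<lambda>m. single m 1) c + f * lincomb B (\<lambda>m. single m 1) c'"
        using A(1) B(1)
        by (simp add: lincomb_def sum.Plus b_def sum_distrib_left mult.left_commute)
      then have "p - lincomb (A <+> B) b (case_sum c c')
          = hcomp q i + f * (hcomp (q - d) g - lincomb B (\<lambda>m. single m 1) c')"
        using r by (simp add: algebra_simps)
      also have "\<dots> \<in> I"
        using ig(1) I(2) fI'[OF c'] by (intro idealD(3)[OF I(1)]) (auto simp: homogeneous_set_def)
      finally show "\<exists>c. p - lincomb (A <+> B) b c \<in> I" by blast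
    qed
  qed
  also have "\<dots> = hilbert_function X J q + hilbert_function X I' (q - d)"
    using A B by (simp add: card_Plus)
  finally show ?thesis .
qed

section \<open>Hilbert series and Hilbert polynomials\<close>

definition gen_fun :: "(nat \<Rightarrow> nat) \<Rightarrow> rat fps" where
  "gen_fun f = Abs_fps (\<lambda>q. of_nat (f q))"

definition hilbert_series :: "(nat \<Rightarrow> nat) \<Rightarrow> nat \<Rightarrow> rat poly \<Rightarrow> bool" where
  "hilbert_series f D p \<longleftrightarrow> gen_fun f * (1 - fps_X) ^ D = fps_of_poly p"

lemma gen_fun_binomial: "gen_fun (\<lambda>n. (n + k) choose k) * (1 - fps_X) ^ Suc k = 1"
proof (induction k)
  case 0
  have "gen_fun (\<lambda>n. 1) = Abs_fps (\<lambda>_. 1)" by (simp add: gen_fun_def)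
  then show ?case
    using inverse_mult_eq_1'[of "Abs_fps (\<lambda>_. 1 :: rat)"] fps_inverse_gp'[where 'a = rat] by simp
next
  case (Suc k)
  have "gen_fun (\<lambda>n. (n + Suc k) choose Suc k) * (1 - fps_X) = gen_fun (\<lambda>n. (n + k) choose k)"
  proof (rule fps_ext)
    fix n
    have "gen_fun (\<lambda>n. (n + Suc k) choose Suc k) * (1 - fps_X)
        = gen_fun (\<lambda>n. (n + Suc k) choose Suc k) - fps_X * gen_fun (\<lambda>n. (n + Suc k) choose Suc k)"
      by (simp add: algebra_simps)
    then show "(gen_fun (\<lambda>n. (n + Suc k) choose Suc k) * (1 - fps_X)) $ n
        = gen_fun (\<lambda>n. (n + k) choose k) $ n"
      by (cases n) (simp_all add: gen_fun_def)
  qed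
  then have "gen_fun (\<lambda>n. (n + Suc k) choose Suc k) * (1 - fps_X) ^ Suc (Suc k)
      = gen_fun (\<lambda>n. (n + k) choose k) * (1 - fps_X) ^ Suc k"
    by (simp only: power_Suc mult.assoc[symmetric])
  then show ?case using Suc by (rule trans)
qed

lemma monic_linear_prod:
  fixes c :: "nat \<Rightarrow> 'a::field"
  shows "degree (\<Prod>j<k. [:c j, 1:]) = k \<and> lead_coeff (\<Prod>j<k. [:c j, 1:]) = 1"
proof (induction k)
  case (Suc k)
  then have "(\<Prod>j<k. [:c j, 1:]) \<noteq> 0" by auto
  then have "degree (\<Prod>j<Suc k. [:c j, 1:]) = Suc k"
    using Suc unfolding prod.lessThan_Suc by (subst degree_mult_eq) auto
  moreover have "lead_coeff (\<Prod>j<Suc k. [:c j, 1:]) = 1"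
    unfolding prod.lessThan_Suc lead_coeff_mult conjunct2[OF Suc] by simp
  ultimately show ?case by simp
qed auto

text \<open>The coefficients of \<open>1 / (1 - z)\<close> to the power \<open>k + 1\<close> are the values of the polynomial
  \<open>(q + 1) \<dots> (q + k) / k!\<close>, so a rational Hilbert series with numerator \<open>p\<close> is eventually a sum of
  shifts of it.\<close>

theorem hilbert_polynomial_of_series:
  assumes "hilbert_series f (Suc k) p"
  obtains h where "\<forall>\<^sub>F q in sequentially. of_nat (f q) = poly h (of_nat q)"
    "degree h \<le> k" "poly.coeff h k = poly p 1 / fact k"
proof -
  define b :: "nat \<Rightarrow> rat poly" where "b i = (\<Prod>j<k. [:1 + of_nat j - of_nat i, 1:])" for i
  have b: "degree (b i) = k" "poly.coeff (b i) k = 1" for i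
    using monic_linear_prod[of "\<lambda>j. 1 + of_nat j - of_nat i :: rat" k] by (auto simp: b_def)
  have choose: "of_nat ((q - i + k) choose k) = poly (b i) (of_nat q) / fact k" if "i \<le> q" for i q
  proof -
    have "of_nat ((q - i + k) choose k) = (pochhammer (of_nat (q - i) + 1) k / fact k :: rat)"
      by (simp add: binomial_gbinomial gbinomial_pochhammer' add.commute)
    also have "pochhammer (of_nat (q - i) + 1) k = poly (b i) (of_nat q :: rat)"
      using that
      by (auto simp: pochhammer_prod b_def poly_prod lessThan_atLeast0 of_nat_diff algebra_simps
          intro!: prod.cong)
    finally show ?thesis .
  qed
  define h where "h = (\<Sum>i\<le>degree p. Polynomial.smult (poly.coeff p i / fact k) (b i))"
  have "gen_fun f = gen_fun f * ((1 - fps_X) ^ Suc k * gen_fun (\<lambda>n. (n + k) choose k))"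
    using gen_fun_binomial[of k] by (simp only: mult.commute mult_1)
  also have "\<dots> = fps_of_poly p * gen_fun (\<lambda>n. (n + k) choose k)"
    using assms by (simp only: hilbert_series_def mult.assoc[symmetric])
  finally have f: "of_nat (f q) = (\<Sum>i\<le>q. poly.coeff p i * of_nat ((q - i + k) choose k))" for q
    by (auto simp: fps_eq_iff gen_fun_def fps_mult_nth atLeast0AtMost)
  have ev: "of_nat (f q) = poly h (of_nat q)" if "q \<ge> degree p" for q
  proof -
    have "of_nat (f q) = (\<Sum>i\<le>degree p. poly.coeff p i * of_nat ((q - i + k) choose k))"
      unfolding f using that by (intro sum.mono_neutral_right) (auto simp: coeff_eq_0)
    also have "\<dots> = poly h (of_nat q)"
      unfolding h_def poly_sum
    proof (rule sum.cong)
      fix i assume "i \<in> {..degree p}"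
      then show "poly.coeff p i * of_nat ((q - i + k) choose k)
          = poly (Polynomial.smult (poly.coeff p i / fact k) (b i)) (of_nat q)"
        using that by (subst choose) auto
    qed simp
    finally show ?thesis .
  qed
  show thesis
  proof (rule that[of h])
    show "\<forall>\<^sub>F q in sequentially. of_nat (f q) = poly h (of_nat q)"
      using ev by (auto simp: eventually_sequentially)
    show "degree h \<le> k"
      unfolding h_def using b by (intro degree_sum_le) (auto intro: order.trans[OF degree_smult_le])
    show "poly.coeff h k = poly p 1 / fact k"
      by (simp add: h_def coeff_sum b poly_altdef sum_divide_distrib)
  qed
qed

lemma poly_eventually_ge_lead_coeff:
  fixes p :: "'a::linordered_field poly"
  assumes "lead_coeff p > 0"
  shows "\<exists>N. \<forall>x\<ge>N. lead_coeff p \<le> poly p x"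
  using assms
proof (induction p)
  case (pCons a p)
  show ?case
  proof (cases "p = 0")
    case False
    then have "lead_coeff p > 0" using pCons.prems by simp
    then obtain N where N: "\<And>x. x \<ge> N \<Longrightarrow> lead_coeff p \<le> poly p x" using pCons.IH by auto
    have "lead_coeff p \<le> a + x * poly p x" if x: "x \<ge> max N (max 0 (1 + \<bar>a\<bar> / lead_coeff p))" for x
    proof -
      have "lead_coeff p + \<bar>a\<bar> = (1 + \<bar>a\<bar> / lead_coeff p) * lead_coeff p"
      proof -
        have "l + \<bar>a\<bar> = (1 + \<bar>a\<bar> / l) * l" if "l > 0" for l using that by (simp add: field_simps)
        then show ?thesis using \<open>lead_coeff p > 0\<close> .
      qed
      also have "\<dots> \<le> x * lead_coeff p"
        using x \<open>lead_coeff p > 0\<close> by (intro mult_right_mono) auto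
      also have "\<dots> \<le> x * poly p x"
        using N[of x] x by (intro mult_left_mono) auto
      finally show ?thesis by linarith
    qed
    moreover have "lead_coeff (pCons a p) = lead_coeff p"
      using \<open>lead_coeff p > 0\<close> by auto
    ultimately show ?thesis by (metis poly_pCons)
  qed auto
qed auto

lemma degree_le_of_growth:
  fixes g :: "'a::{linordered_field, archimedean_field} poly"
  assumes "\<forall>\<^sub>F q in sequentially. 0 \<le> poly g (of_nat q) \<and> poly g (of_nat q) \<le> C * (of_nat q + 1) ^ j"
  shows "degree g \<le> j"
proof (rule ccontr)
  assume deg: "\<not> degree g \<le> j"
  have ev: "\<forall>\<^sub>F q in sequentially. lead_coeff p \<le> poly p (of_nat q)"
    if pos: "lead_coeff p > 0" for p :: "'a poly"
  proof -
    obtain N where N: "\<And>x. x \<ge> N \<Longrightarrow> lead_coeff p \<le> poly p x"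
      using poly_eventually_ge_lead_coeff[OF pos] by auto
    obtain n :: nat where "N \<le> of_nat n" using real_arch_simple by blast
    then have "lead_coeff p \<le> poly p (of_nat q)" if "q \<ge> n" for q
      using N[of "of_nat q"] that of_nat_mono[of n q] by (meson order.trans)
    then show ?thesis by (auto simp: eventually_sequentially)
  qed
  define h where "h = g - Polynomial.smult C ([:1, 1:] ^ j)"
  have "degree (Polynomial.smult C ([:1, 1:] ^ j)) \<le> j"
    by (rule order.trans[OF degree_smult_le]) (simp add: degree_linear_power)
  then have lt: "degree (Polynomial.smult C ([:1, 1:] ^ j)) < degree g" using deg by linarith
  then have "degree h = degree g"
    unfolding h_def by (metis degree_add_eq_left degree_minus diff_conv_add_uminus)
  moreover have "poly.coeff h (degree g) = lead_coeff g"
    unfolding h_def coeff_diff coeff_eq_0[OF lt] by simp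
  ultimately have lead: "lead_coeff h = lead_coeff g" by simp
  have "lead_coeff g \<noteq> 0" using deg by auto
  then consider "lead_coeff h > 0" | "lead_coeff (- g) > 0" using lead by fastforce
  then show False
  proof cases
    case 1
    have "\<forall>\<^sub>F q in sequentially. False"
      using ev[OF 1] assms by eventually_elim (use 1 in \<open>auto simp: h_def algebra_simps\<close>)
    then show False by simp
  next
    case 2
    have "\<forall>\<^sub>F q in sequentially. False"
      using ev[OF 2] assms by eventually_elim (use 2 in auto)
    then show False by simp
  qed
qed

lemma growth_of_poly:
  fixes f :: "nat \<Rightarrow> nat" and h :: "rat poly"
  assumes ev: "\<forall>\<^sub>F q in sequentially. of_nat (f q) = poly h (of_nat q)" and "degree h \<le> k"
  shows "\<exists>C. \<forall>q. f q \<le> C * (q + 1) ^ k"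
proof -
  obtain N where N: "\<And>q. q \<ge> N \<Longrightarrow> of_nat (f q) = poly h (of_nat q)"
    using ev by (auto simp: eventually_sequentially)
  define S where "S = nat \<lceil>\<Sum>i\<le>degree h. \<bar>poly.coeff h i\<bar>\<rceil>"
  have S: "f q \<le> S * (q + 1) ^ k" if "q \<ge> N" for q
  proof -
    have "of_nat (f q) = (\<Sum>i\<le>degree h. poly.coeff h i * of_nat q ^ i)"
      using N[OF that] by (simp add: poly_altdef)
    also have "\<dots> \<le> (\<Sum>i\<le>degree h. \<bar>poly.coeff h i\<bar> * (of_nat q + 1) ^ k)"
    proof (rule sum_mono)
      fix i assume i: "i \<in> {..degree h}"
      have "(of_nat q :: rat) ^ i \<le> (of_nat q + 1) ^ i" by (intro power_mono) auto
      also have "\<dots> \<le> (of_nat q + 1) ^ k"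
        using i assms(2) by (intro power_increasing) auto
      finally have "\<bar>poly.coeff h i\<bar> * of_nat q ^ i \<le> \<bar>poly.coeff h i\<bar> * (of_nat q + 1) ^ k"
        by (intro mult_left_mono) auto
      moreover have "poly.coeff h i * of_nat q ^ i \<le> \<bar>poly.coeff h i\<bar> * of_nat q ^ i"
        by (intro mult_right_mono) auto
      ultimately show "poly.coeff h i * of_nat q ^ i \<le> \<bar>poly.coeff h i\<bar> * (of_nat q + 1) ^ k" by linarith
    qed
    also have "\<dots> = (\<Sum>i\<le>degree h. \<bar>poly.coeff h i\<bar>) * (of_nat q + 1) ^ k"
      by (simp add: sum_distrib_right)
    also have "\<dots> \<le> of_nat S * (of_nat q + 1) ^ k"
      unfolding S_def by (intro mult_right_mono) (auto simp: of_nat_ceiling)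
    finally have "(of_nat (f q) :: rat) \<le> of_nat (S * (q + 1) ^ k)"
      by (simp only: of_nat_mult of_nat_power of_nat_add of_nat_1)
    then show ?thesis by (simp only: of_nat_le_iff)
  qed
  have "f q \<le> (S + (\<Sum>i<N. f i)) * (q + 1) ^ k" for q
  proof (cases "q < N")
    case True
    then have "f q \<le> (\<Sum>i<N. f i)" by (intro member_le_sum) auto
    also have "\<dots> * 1 \<le> (S + (\<Sum>i<N. f i)) * (q + 1) ^ k"
      by (intro mult_mono) auto
    finally show ?thesis by simp
  next
    case False
    then have "f q \<le> S * (q + 1) ^ k" by (intro S) auto
    also have "\<dots> \<le> (S + (\<Sum>i<N. f i)) * (q + 1) ^ k" by (intro mult_right_mono) auto
    finally show ?thesis .
  qed
  then show ?thesis by blast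
qed

section \<open>The Hilbert series of a monomial ideal\<close>

text \<open>Weighted counts of monomials in disjoint sets of variables convolve.\<close>

lemma gen_fun_disjoint_union:
  fixes f g h :: "('x \<Rightarrow>\<^sub>0 nat) \<Rightarrow> nat"
  assumes fin: "finite X" "finite Y" and disj: "X \<inter> Y = {}"
    and f: "\<And>a b. keys a \<subseteq> X \<Longrightarrow> keys b \<subseteq> Y \<Longrightarrow> f (a + b) = g a * h b"
  shows "gen_fun (\<lambda>q. \<Sum>m\<in>mons (X \<union> Y) q. f m)
    = gen_fun (\<lambda>q. \<Sum>m\<in>mons X q. g m) * gen_fun (\<lambda>q. \<Sum>m\<in>mons Y q. h m)"
proof (rule fps_ext)
  fix q
  let ?D = "SIGMA i:{..q}. mons X i \<times> mons Y (q - i)"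
  let ?restr = "\<lambda>Z m. \<Sum>x\<in>keys m \<inter> Z. single x (lookup m x)"
  have lk: "lookup (?restr Z m) x = (if x \<in> Z then lookup m x else 0)" for Z m and x :: 'x
    by (auto simp: lookup_sum lookup_single when_def not_in_keys_iff_lookup_eq_zero[symmetric])
  have "(\<Sum>m\<in>mons (X \<union> Y) q. f m) = (\<Sum>(i, a, b)\<in>?D. g a * h b)"
  proof (rule sum.reindex_bij_witness[where
        i = "\<lambda>(i, a, b). a + b" and j = "\<lambda>m. (monom_degree (?restr X m), ?restr X m, ?restr Y m)"])
    fix m assume m: "m \<in> mons (X \<union> Y) q"
    have split: "?restr X m + ?restr Y m = m"
    proof (rule poly_mapping_eqI)
      fix x
      have "x \<notin> X \<union> Y \<Longrightarrow> lookup m x = 0"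
        using m by (auto simp: mons_def in_keys_iff)
      then show "lookup (?restr X m + ?restr Y m) x = lookup m x"
        using disj by (auto simp: lookup_add lk)
    qed
    then show "(case (monom_degree (?restr X m), ?restr X m, ?restr Y m) of (i, a, b) \<Rightarrow> a + b) = m"
      by simp
    have k: "keys (?restr Z m) \<subseteq> Z" for Z by (auto simp: in_keys_iff lk split: if_splits)
    have "monom_degree (?restr X m) + monom_degree (?restr Y m) = q"
      using m split monom_degree_add[of "?restr X m" "?restr Y m"] by (simp add: mons_def)
    then show "(monom_degree (?restr X m), ?restr X m, ?restr Y m) \<in> ?D"
      using k by (auto simp: mons_def)
    show "(case (monom_degree (?restr X m), ?restr X m, ?restr Y m) of (i, a, b) \<Rightarrow> g a * h b) = f m"
      using f[of "?restr X m" "?restr Y m"] k split by simp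
  next
    fix t assume t: "t \<in> ?D"
    then obtain i a b where [simp]: "t = (i, a, b)" and ab: "a \<in> mons X i" "b \<in> mons Y (q - i)" "i \<le> q"
      by auto
    have z: "lookup a x = 0" if "x \<notin> X" for x using ab that by (auto simp: mons_def in_keys_iff)
    have z': "lookup b x = 0" if "x \<notin> Y" for x using ab that by (auto simp: mons_def in_keys_iff)
    have "lookup (?restr X (a + b)) x = lookup a x" "lookup (?restr Y (a + b)) x = lookup b x" for x
      unfolding lk using disj z[of x] z'[of x] by (auto simp: lookup_add)
    then have "?restr X (a + b) = a" "?restr Y (a + b) = b"
      by (blast intro: poly_mapping_eqI)+
    then show "(monom_degree (?restr X (case t of (i, a, b) \<Rightarrow> a + b)),
        ?restr X (case t of (i, a, b) \<Rightarrow> a + b), ?restr Y (case t of (i, a, b) \<Rightarrow> a + b)) = t"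
      using ab by (simp add: mons_def)
    show "(case t of (i, a, b) \<Rightarrow> a + b) \<in> mons (X \<union> Y) q"
      using ab by (auto simp: mons_def keys_add_nat monom_degree_add)
  qed
  also have "\<dots> = (\<Sum>i\<le>q. \<Sum>(a, b)\<in>mons X i \<times> mons Y (q - i). g a * h b)"
    using fin by (subst sum.Sigma) (auto simp: finite_mons split_def)
  also have "\<dots> = (\<Sum>i\<le>q. (\<Sum>a\<in>mons X i. g a) * (\<Sum>b\<in>mons Y (q - i). h b))"
    by (simp add: sum_product sum.cartesian_product)
  finally have eq: "(\<Sum>m\<in>mons (X \<union> Y) q. f m)
      = (\<Sum>i\<le>q. (\<Sum>a\<in>mons X i. g a) * (\<Sum>b\<in>mons Y (q - i). h b))" .
  show "gen_fun (\<lambda>q. \<Sum>m\<in>mons (X \<union> Y) q. f m) $ q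
      = (gen_fun (\<lambda>q. \<Sum>m\<in>mons X q. g m) * gen_fun (\<lambda>q. \<Sum>m\<in>mons Y q. h m)) $ q"
    unfolding gen_fun_def fps_mult_nth fps_nth_Abs_fps atLeast0AtMost eq by simp
qed

lemma mons_empty: "mons {} q = (if q = 0 then {0} else {})"
  by (auto simp: mons_def)

lemma mons_singleton: "mons {x} q = {single x q}"
proof (intro equalityI subsetI)
  fix m assume m: "m \<in> mons {x} q"
  then have "lookup m x = q" using monom_degree_superset[of "{x}" m] by (simp add: mons_def)
  moreover have "lookup m y = 0" if "y \<noteq> x" for y
    using m that by (auto simp: mons_def in_keys_iff)
  ultimately have "m = single x q"
    by (intro poly_mapping_eqI) (auto simp: lookup_single when_def)
  then show "m \<in> {single x q}" by simp
qed (auto simp: mons_def)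

lemma gen_fun_card_mons:
  assumes "finite X"
  shows "gen_fun (\<lambda>q. card (mons X q)) * (1 - fps_X) ^ card X = 1"
  using assms
proof (induction X rule: finite_induct)
  case empty
  have "gen_fun (\<lambda>q. card (mons {} q)) = 1"
    by (rule fps_ext) (auto simp: gen_fun_def mons_empty)
  then show ?case by simp
next
  case (insert x X)
  have "gen_fun (\<lambda>q. \<Sum>m\<in>mons ({x} \<union> X) q. 1)
      = gen_fun (\<lambda>q. \<Sum>m\<in>mons {x} q. 1) * gen_fun (\<lambda>q. \<Sum>m\<in>mons X q. 1)"
    using insert by (intro gen_fun_disjoint_union) auto
  then have "gen_fun (\<lambda>q. card (mons (insert x X) q))
      = gen_fun (\<lambda>q. 1) * gen_fun (\<lambda>q. card (mons X q))"
    by (simp add: mons_singleton)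
  moreover have "gen_fun (\<lambda>q. 1) * (1 - fps_X) = 1"
    using gen_fun_binomial[of 0] by simp
  ultimately have "gen_fun (\<lambda>q. card (mons (insert x X) q)) * (1 - fps_X) ^ card (insert x X)
      = (gen_fun (\<lambda>q. 1) * (1 - fps_X)) * (gen_fun (\<lambda>q. card (mons X q)) * (1 - fps_X) ^ card X)"
    using insert by (simp add: mult_ac)
  then show ?case
    using insert.IH \<open>gen_fun (\<lambda>q. 1) * (1 - fps_X) = 1\<close> by (simp only: mult_1)
qed

definition divides :: "('x \<Rightarrow>\<^sub>0 nat) \<Rightarrow> ('x \<Rightarrow>\<^sub>0 nat) \<Rightarrow> bool" where
  "divides f m \<longleftrightarrow> (\<forall>x. lookup f x \<le> lookup m x)"

lemma divides_iff: "divides f m \<longleftrightarrow> m = f + (m - f)"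
  by (auto simp: divides_def poly_mapping_eq_iff fun_eq_iff lookup_add lookup_minus)
     (metis le_add1)

lemma divides_add_iff: "divides f (f0 + a) \<longleftrightarrow> divides (f - f0) a"
  by (auto simp: divides_def lookup_add lookup_minus le_diff_conv add.commute)

text \<open>Remove one generator \<open>f0\<close> from \<open>F\<close>. The monomials that avoid the other ones but are divisible by
  \<open>f0\<close> are the products of \<open>f0\<close> with the monomials that avoid the colon ideal, whose generators \<open>f - f0\<close>
  are fewer than those in \<open>F\<close>. So both counts are known by induction.\<close>

lemma hilbert_series_avoiding:
  assumes "finite X" "finite F"
  shows "\<exists>p. hilbert_series (\<lambda>q. card {m \<in> mons X q. \<forall>f\<in>F. \<not> divides f m}) (card X) p"
  using assms(2)
proof (induction "card F" arbitrary: F rule: less_induct)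
  case less
  show ?case
  proof (cases "F = {}")
    case True
    then show ?thesis
      using gen_fun_card_mons[OF assms(1)]
      by (intro exI[of _ 1]) (simp add: hilbert_series_def)
  next
    case False
    then obtain f0 where f0: "f0 \<in> F" by auto
    define F' where "F' = F - {f0}"
    define F'' where "F'' = (\<lambda>f. f - f0) ` F'"
    have "card F' < card F" unfolding F'_def using f0 less.prems by (meson card_Diff1_less)
    moreover have "card F'' \<le> card F'"
      unfolding F''_def using less.prems by (intro card_image_le) (auto simp: F'_def)
    ultimately have card: "card F' < card F" "card F'' < card F" by auto
    have fin: "finite F'" "finite F''" using less.prems by (auto simp: F'_def F''_def)
    obtain p' where p': "hilbert_series (\<lambda>q. card {m \<in> mons X q. \<forall>f\<in>F'. \<not> divides f m}) (card X) p'"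
      using less.hyps[OF card(1) fin(1)] by auto
    obtain p'' where p'': "hilbert_series (\<lambda>q. card {m \<in> mons X q. \<forall>f\<in>F''. \<not> divides f m}) (card X) p''"
      using less.hyps[OF card(2) fin(2)] by auto
    show ?thesis
    proof (cases "keys f0 \<subseteq> X")
      case False
      have "\<not> divides f0 m" if "m \<in> mons X q" for m q
      proof -
        obtain x where "x \<in> keys f0" "x \<notin> X" using False by auto
        moreover have "x \<notin> keys m" using that \<open>x \<notin> X\<close> by (auto simp: mons_def)
        ultimately show ?thesis
          unfolding divides_def in_keys_iff by (metis le_zero_eq)
      qed
      then have "{m \<in> mons X q. \<forall>f\<in>F. \<not> divides f m} = {m \<in> mons X q. \<forall>f\<in>F'. \<not> divides f m}" for q
        by (auto simp: F'_def)
      then show ?thesis using p' by auto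
    next
      case True
      define d where "d = monom_degree f0"
      define A where "A q = {m \<in> mons X q. \<forall>f\<in>F'. \<not> divides f m}" for q
      define B where "B q = {m \<in> mons X q. \<forall>f\<in>F''. \<not> divides f m}" for q
      define C where "C q = {m \<in> mons X q. \<forall>f\<in>F. \<not> divides f m}" for q
      have finA: "finite (A q)" for q by (simp add: A_def finite_mons assms(1))
      have split: "card (A q) = card (C q) + (if d \<le> q then card (B (q - d)) else 0)" for q
      proof -
        have "A q = C q \<union> {m \<in> A q. divides f0 m}" "C q \<inter> {m \<in> A q. divides f0 m} = {}"
          using f0 by (auto simp: A_def C_def F'_def)
        then have "card (A q) = card (C q) + card {m \<in> A q. divides f0 m}"
          using finA[of q] by (metis (no_types, lifting) card_Un_disjoint finite_Un)
        moreover have "card {m \<in> A q. divides f0 m} = (if d \<le> q then card (B (q - d)) else 0)"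
        proof (cases "d \<le> q")
          case dq: True
          have "bij_betw (\<lambda>a. f0 + a) (B (q - d)) {m \<in> A q. divides f0 m}"
          proof (rule bij_betw_byWitness[where f' = "\<lambda>m. m - f0"])
            show "\<forall>a\<in>B (q - d). f0 + a - f0 = a" by simp
            show "\<forall>m\<in>{m \<in> A q. divides f0 m}. f0 + (m - f0) = m"
              by (auto simp: divides_iff)
            show "(\<lambda>a. f0 + a) ` B (q - d) \<subseteq> {m \<in> A q. divides f0 m}"
              using dq True by (auto simp: A_def B_def F''_def mons_def keys_add_nat monom_degree_add
                  d_def divides_add_iff) (simp add: divides_def lookup_add)
            show "(\<lambda>m. m - f0) ` {m \<in> A q. divides f0 m} \<subseteq> B (q - d)"
            proof (rule image_subsetI)
              fix m assume m: "m \<in> {m \<in> A q. divides f0 m}"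
              define a where "a = m - f0"
              have "m = f0 + a" using m by (simp add: a_def divides_iff)
              then have "a \<in> B (q - d)"
                using m by (auto simp: A_def B_def F''_def mons_def keys_add_nat monom_degree_add
                    d_def divides_add_iff)
              then show "m - f0 \<in> B (q - d)" by (simp add: a_def)
            qed
          qed
          from bij_betw_same_card[OF this] dq show ?thesis by simp
        next
          case False
          have "monom_degree m \<ge> d" if "divides f0 m" for m
            using that monom_degree_add[of f0 "m - f0"] by (simp add: divides_iff d_def)
          then have empty: "{m \<in> A q. divides f0 m} = {}"
            using False by (auto simp: A_def mons_def)
          show ?thesis unfolding empty using False by simp
        qed
        ultimately show ?thesis by simp
      qed
      have "gen_fun (\<lambda>q. card (A q)) = gen_fun (\<lambda>q. card (C q)) + fps_X ^ d * gen_fun (\<lambda>q. card (B q))"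
        by (rule fps_ext) (simp add: gen_fun_def split fps_X_power_mult_nth)
      then have "gen_fun (\<lambda>q. card (C q)) * (1 - fps_X) ^ card X
          = gen_fun (\<lambda>q. card (A q)) * (1 - fps_X) ^ card X
            - fps_X ^ d * (gen_fun (\<lambda>q. card (B q)) * (1 - fps_X) ^ card X)"
        by (simp add: algebra_simps)
      also have "\<dots> = fps_of_poly (p' - Polynomial.monom 1 d * p'')"
        using p' p'' by (simp add: hilbert_series_def A_def B_def fps_of_poly_diff fps_of_poly_mult
            fps_of_poly_monom')
      finally show ?thesis by (auto simp: hilbert_series_def C_def)
    qed
  qed
qed

lemma nondecreasing_subseq:
  fixes s :: "nat \<Rightarrow> nat"
  shows "\<exists>r :: nat \<Rightarrow> nat. strict_mono r \<and> mono (\<lambda>n. s (r n))"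
proof -
  obtain r :: "nat \<Rightarrow> nat" where r: "strict_mono r" "monoseq (\<lambda>n. s (r n))" using seq_monosub by blast
  show ?thesis
  proof (cases "incseq (\<lambda>n. s (r n))")
    case True
    then show ?thesis using r by blast
  next
    case False
    then have dec: "decseq (\<lambda>n. s (r n))" using r(2) by (auto simp: monoseq_iff)
    define v where "v = (LEAST v. \<exists>n. s (r n) = v)"
    have "\<exists>n. s (r n) = v" unfolding v_def by (rule LeastI_ex) auto
    then obtain N where N: "s (r N) = v" by auto
    have "s (r n) = v" if "n \<ge> N" for n
    proof (rule antisym)
      show "s (r n) \<le> v" using dec that N by (auto simp: decseq_def)
      show "v \<le> s (r n)" unfolding v_def by (rule Least_le) auto
    qed
    then show ?thesis
      using r(1) by (intro exI[of _ "\<lambda>n. r (N + n)"]) (auto simp: strict_mono_def mono_def)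
  qed
qed

lemma nondecreasing_subseq_finite:
  fixes s :: "nat \<Rightarrow> 'x \<Rightarrow> nat"
  assumes "finite X"
  shows "\<exists>r :: nat \<Rightarrow> nat. strict_mono r \<and> (\<forall>x\<in>X. mono (\<lambda>n. s (r n) x))"
  using assms
proof (induction X rule: finite_induct)
  case empty
  show ?case by (intro exI[of _ id]) (auto simp: strict_mono_def)
next
  case (insert x X)
  then obtain r :: "nat \<Rightarrow> nat" where r: "strict_mono r" "\<forall>x\<in>X. mono (\<lambda>n. s (r n) x)" by auto
  obtain r' :: "nat \<Rightarrow> nat" where r': "strict_mono r'" "mono (\<lambda>n. s (r (r' n)) x)"
    using nondecreasing_subseq[of "\<lambda>n. s (r n) x"] by auto
  have "mono (\<lambda>n. s (r (r' n)) y)" if "y \<in> X" for y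
    using r(2) that r'(1) by (auto simp: mono_def strict_mono_less_eq)
  then show ?case
    using r r' by (intro exI[of _ "r \<circ> r'"]) (auto simp: strict_mono_def)
qed

text \<open>Dickson's lemma. An infinite set of minimal elements would contain a sequence along which all
  exponents are nondecreasing, contradicting minimality.\<close>

lemma dickson:
  fixes L :: "('x \<Rightarrow>\<^sub>0 nat) set"
  assumes fin: "finite X" and L: "\<And>m. m \<in> L \<Longrightarrow> keys m \<subseteq> X"
  shows "\<exists>F\<subseteq>L. finite F \<and> (\<forall>m\<in>L. \<exists>f\<in>F. divides f m)"
proof -
  define F where "F = {m \<in> L. \<forall>m'\<in>L. divides m' m \<longrightarrow> m' = m}"
  have "finite F"
  proof (rule ccontr)
    assume "infinite F"
    then obtain s :: "nat \<Rightarrow> _" where s: "inj s" "range s \<subseteq> F"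
      using infinite_countable_subset by blast
    obtain r :: "nat \<Rightarrow> nat" where r: "strict_mono r" "\<forall>x\<in>X. mono (\<lambda>n. lookup (s (r n)) x)"
      using nondecreasing_subseq_finite[OF fin, of "\<lambda>n. lookup (s n)"] by auto
    have sF: "s n \<in> F" for n using s by auto
    have "divides (s (r 0)) (s (r 1))"
      unfolding divides_def
    proof
      fix x
      show "lookup (s (r 0)) x \<le> lookup (s (r 1)) x"
      proof (cases "x \<in> X")
        case True
        then show ?thesis using r(2) by (auto simp: mono_def)
      next
        case False
        then have "x \<notin> keys (s (r 0))" using sF[of "r 0"] L by (auto simp: F_def)
        then show ?thesis by (simp add: not_in_keys_iff_lookup_eq_zero)
      qed
    qed
    then have "s (r 0) = s (r 1)" using sF[of "r 0"] sF[of "r 1"] by (auto simp: F_def)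
    then have "r 0 = r 1" using s(1) by (auto dest: injD)
    then show False using strict_monoD[OF r(1), of 0 1] by simp
  qed
  moreover have "\<exists>f\<in>F. divides f m" if "m \<in> L" for m
    using that
  proof (induction "monom_degree m" arbitrary: m rule: less_induct)
    case less
    show ?case
    proof (cases "m \<in> F")
      case True
      then show ?thesis by (auto simp: divides_def)
    next
      case False
      then obtain m' where m': "m' \<in> L" "divides m' m" "m' \<noteq> m" using less.prems by (auto simp: F_def)
      have eq: "m = m' + (m - m')" using m'(2) by (simp add: divides_iff)
      have "m - m' \<noteq> 0" using eq m'(3) by auto
      then obtain x where "lookup (m - m') x \<noteq> 0"
        by (metis lookup_zero poly_mapping_eqI)
      then have "monom_degree (m - m') > 0"
        using lookup_le_monom_degree[of "m - m'" x] by linarith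
      then have "monom_degree m' < monom_degree m"
        using monom_degree_add[of m' "m - m'"] eq by simp
      then obtain f where "f \<in> F" "divides f m'" using less.hyps m'(1) by blast
      then show ?thesis using m'(2) by (meson divides_def order.trans)
    qed
  qed
  ultimately show ?thesis by (intro exI[of _ F]) (auto simp: F_def)
qed

context proper_poly_ideal
begin

text \<open>The monomials outside Macaulay's basis are the multiples of finitely many monomials.\<close>

theorem hilbert_series_exists:
  assumes fin: "finite X"
  shows "\<exists>p. hilbert_series (hilbert_function X I) (card X) p"
proof -
  obtain L where L: "\<forall>m\<in>L. \<forall>a. keys a \<subseteq> X \<longrightarrow> m + a \<in> L"
    "\<And>q. indep_mod I (mons X q - L) (\<lambda>m. single m 1)"
    "\<And>q. spans_mod I (mons X q - L) (\<lambda>m. single m 1) (graded_part X q)"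
    using standard_monomials_basis[OF fin ideal] by auto
  have hf: "hilbert_function X I q = card (mons X q - L)" for q
    using L finite_mons[OF fin]
    by (intro hilbert_function_eq_card_basis[where b = "\<lambda>m. single m 1"])
       (auto intro: graded_part_closed)
  obtain F where F: "F \<subseteq> {m \<in> L. keys m \<subseteq> X}" "finite F"
    "\<forall>m\<in>{m \<in> L. keys m \<subseteq> X}. \<exists>f\<in>F. divides f m"
    using dickson[OF fin, of "{m \<in> L. keys m \<subseteq> X}"] by auto
  have "mons X q - L = {m \<in> mons X q. \<forall>f\<in>F. \<not> divides f m}" for q
  proof (intro equalityI subsetI)
    fix m assume m: "m \<in> mons X q - L"
    have "\<not> divides f m" if "f \<in> F" for f
    proof
      assume "divides f m"
      then have "m = f + (m - f)" by (simp add: divides_iff)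
      moreover have "keys (m - f) \<subseteq> X"
        using m by (auto simp: mons_def in_keys_iff lookup_minus subset_iff)
      ultimately have "m \<in> L" using L(1) F(1) that by (metis (mono_tags, lifting) mem_Collect_eq subsetD)
      then show False using m by simp
    qed
    then show "m \<in> {m \<in> mons X q. \<forall>f\<in>F. \<not> divides f m}" using m by auto
  next
    fix m assume "m \<in> {m \<in> mons X q. \<forall>f\<in>F. \<not> divides f m}"
    then show "m \<in> mons X q - L" using F(3) by (auto simp: mons_def)
  qed
  then have "hilbert_function X I = (\<lambda>q. card {m \<in> mons X q. \<forall>f\<in>F. \<not> divides f m})"
    using hf by auto
  then show ?thesis using hilbert_series_avoiding[OF fin F(2)] by simp
qed

end

section \<open>Prime ideals from weights\<close>

text \<open>A weight sends every variable to a monomial in new variables, hence the polynomial ring to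
  another one; setting the new variables in \<open>Z\<close> to zero afterwards gives a ring homomorphism to a
  domain. Its kernel consists of the polynomials all of whose coefficient sums over the monomials of
  a given weight prime to \<open>Z\<close> vanish.\<close>

definition wt :: "('x \<Rightarrow> ('t \<Rightarrow>\<^sub>0 nat)) \<Rightarrow> ('x \<Rightarrow>\<^sub>0 nat) \<Rightarrow> ('t \<Rightarrow>\<^sub>0 nat)" where
  "wt w m = (\<Sum>x\<in>keys m. \<Sum>i<lookup m x. w x)"

definition push :: "('x \<Rightarrow> ('t \<Rightarrow>\<^sub>0 nat)) \<Rightarrow> 't set \<Rightarrow> ('x, 'k::field) mpoly \<Rightarrow> ('t, 'k) mpoly" where
  "push w Z p = (\<Sum>m\<in>keys p. if keys (wt w m) \<inter> Z = {} then single (wt w m) (lookup p m) else 0)"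

definition weight_prime ::
    "'x set \<Rightarrow> ('x \<Rightarrow> ('t \<Rightarrow>\<^sub>0 nat)) \<Rightarrow> 't set \<Rightarrow> ('x, 'k::field) mpoly set" where
  "weight_prime X w Z = {p \<in> carrier (poly_ring X). push w Z p = 0}"

lemma lookup_wt:
  assumes "finite A" "keys m \<subseteq> A"
  shows "lookup (wt w m) t = (\<Sum>x\<in>A. lookup m x * lookup (w x) t)"
proof -
  have "lookup (wt w m) t = (\<Sum>x\<in>keys m. lookup m x * lookup (w x) t)"
    by (simp add: wt_def lookup_sum)
  also have "\<dots> = (\<Sum>x\<in>A. lookup m x * lookup (w x) t)"
    using assms by (intro sum.mono_neutral_left) (auto simp: in_keys_iff)
  finally show ?thesis .
qed

lemma wt_add: "wt w (a + b) = wt w a + wt w b"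
proof (rule poly_mapping_eqI)
  fix t
  have "lookup (wt w m) t = (\<Sum>x\<in>keys a \<union> keys b. lookup m x * lookup (w x) t)"
    if "keys m \<subseteq> keys a \<union> keys b" for m
    using that by (intro lookup_wt) auto
  then show "lookup (wt w (a + b)) t = lookup (wt w a + wt w b) t"
    by (simp add: keys_add_nat lookup_add algebra_simps sum.distrib)
qed

lemma wt_0 [simp]: "wt w 0 = 0"
  by (simp add: wt_def)

lemma wt_single: "wt w (single x 1) = w x"
  by (simp add: wt_def)

lemma push_superset:
  assumes "finite A" "keys p \<subseteq> A"
  shows "push w Z p = (\<Sum>m\<in>A. if keys (wt w m) \<inter> Z = {} then single (wt w m) (lookup p m) else 0)"
  unfolding push_def using assms
  by (intro sum.mono_neutral_left) (auto simp: in_keys_iff)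

lemma push_add: "push w Z (p + q) = push w Z p + push w Z q"
proof -
  have *: "push w Z r = (\<Sum>m\<in>keys p \<union> keys q.
      if keys (wt w m) \<inter> Z = {} then single (wt w m) (lookup r m) else 0)"
    if "keys r \<subseteq> keys p \<union> keys q" for r
    using that by (intro push_superset) auto
  show ?thesis
    unfolding *[OF Poly_Mapping.keys_add] *[OF Un_upper1] *[OF Un_upper2] sum.distrib[symmetric]
    by (intro sum.cong) (auto simp: lookup_add single_add)
qed

lemma push_0 [simp]: "push w Z 0 = 0"
  by (simp add: push_def)

lemma push_diff: "push w Z (p - q) = push w Z p - push w Z q"
  using push_add[of w Z "p - q" q] by simp

lemma push_sum: "push w Z (sum f A) = (\<Sum>i\<in>A. push w Z (f i))"
  by (induction A rule: infinite_finite_induct) (auto simp: push_add)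

lemma push_single: "push w Z (single m c) = (if keys (wt w m) \<inter> Z = {} then single (wt w m) c else 0)"
  by (cases "c = 0") (simp_all add: push_def)

lemma push_1: "push w Z 1 = 1"
  using push_single[of w Z 0 1] by simp

lemma push_mult: "push w Z (p * q) = push w Z p * push w Z q"
proof -
  have sing: "push w Z (single m c * single n d) = push w Z (single m c) * push w Z (single n d)" for m n c d
    by (auto simp: mult_single push_single wt_add keys_add_nat)
  have "push w Z (p * q)
      = push w Z ((\<Sum>m\<in>keys p. single m (lookup p m)) * (\<Sum>n\<in>keys q. single n (lookup q n)))"
    by (simp add: sum_single_lookup)
  also have "\<dots> = (\<Sum>m\<in>keys p. \<Sum>n\<in>keys q. push w Z (single m (lookup p m)) * push w Z (single n (lookup q n)))"
    by (simp add: sum_product push_sum sing)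
  also have "\<dots> = push w Z (\<Sum>m\<in>keys p. single m (lookup p m)) * push w Z (\<Sum>n\<in>keys q. single n (lookup q n))"
    by (simp add: sum_product push_sum)
  finally show ?thesis by (simp add: sum_single_lookup)
qed

lemma lookup_push:
  assumes "finite A" "keys p \<subseteq> A"
  shows "lookup (push w Z p) \<mu>
    = (if keys \<mu> \<inter> Z = {} then \<Sum>m\<in>A. if wt w m = \<mu> then lookup p m else 0 else 0)"
proof (cases "keys \<mu> \<inter> Z = {}")
  case True
  then show ?thesis
    unfolding push_superset[OF assms] lookup_sum
    by (auto intro!: sum.cong simp: lookup_single when_def)
next
  case False
  then show ?thesis
    unfolding push_superset[OF assms] lookup_sum
    by (auto intro!: sum.neutral simp: lookup_single when_def split: if_splits)
qed

lemma prime_weight_prime: "primeideal (weight_prime X w Z :: ('x, 'k::field) mpoly set) (poly_ring X)"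
  unfolding primeideal_poly_ring_iff
proof (intro conjI ballI impI)
  show "ideal (weight_prime X w Z :: ('x, 'k::field) mpoly set) (poly_ring X)"
    unfolding ideal_poly_ring_iff weight_prime_def
    by (auto simp: poly_ring_closed push_add push_mult)
  show "1 \<notin> (weight_prime X w Z :: ('x, 'k::field) mpoly set)"
    by (simp add: weight_prime_def push_1)
next
  fix a b :: "('x, 'k) mpoly"
  assume "a \<in> carrier (poly_ring X)" "b \<in> carrier (poly_ring X)" "a * b \<in> weight_prime X w Z"
  then show "a \<in> weight_prime X w Z \<or> b \<in> weight_prime X w Z"
    by (simp add: weight_prime_def push_mult mpoly_mult_eq_0_iff)
qed

lemma prime_proper: "primeideal P (poly_ring X) \<Longrightarrow> proper_poly_ideal X P"
  by (simp add: primeideal_poly_ring_iff proper_poly_ideal_def)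

lemma weight_prime_mono:
  assumes "Z \<subseteq> Z'"
  shows "weight_prime X w Z \<subseteq> (weight_prime X w Z' :: ('x, 'k::field) mpoly set)"
proof
  fix p :: "('x, 'k) mpoly" assume p: "p \<in> weight_prime X w Z"
  have "lookup (push w Z' p) \<mu> = 0" for \<mu>
  proof (cases "keys \<mu> \<inter> Z' = {}")
    case True
    then have "keys \<mu> \<inter> Z = {}" using assms by auto
    then have "lookup (push w Z' p) \<mu> = lookup (push w Z p) \<mu>"
      using True by (simp add: lookup_push[OF finite_keys subset_refl])
    then show ?thesis using p by (simp add: weight_prime_def)
  qed (simp add: lookup_push[OF finite_keys subset_refl])
  then have "push w Z' p = 0" by (intro poly_mapping_eqI) simp
  then show "p \<in> weight_prime X w Z'" using p by (simp add: weight_prime_def)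
qed

lemma var_mem_weight_prime_iff:
  assumes "x \<in> X"
  shows "var_poly x \<in> (weight_prime X w Z :: ('x, 'k::field) mpoly set) \<longleftrightarrow> keys (w x) \<inter> Z \<noteq> {}"
proof -
  have "keys (single (w x) (1::'k)) \<noteq> {}" by simp
  then have "single (w x) (1::'k) \<noteq> 0" using keys_zero by force
  moreover have "push w Z (var_poly x) = (if keys (w x) \<inter> Z = {} then single (w x) (1::'k) else 0)"
    unfolding var_poly_def push_single wt_single ..
  moreover have "var_poly x \<in> carrier (poly_ring X :: ('x, 'k) mpoly ring)"
    by (rule poly_ring_closed(8)[OF assms])
  ultimately show ?thesis
    unfolding weight_prime_def by auto
qed

text \<open>One monomial for each weight that avoids \<open>Z\<close> gives a basis of the graded piece, as the quotient
  is isomorphic to the image of the monomial map.\<close>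

lemma hilbert_function_weight_prime:
  assumes fin: "finite X"
  shows "hilbert_function X (weight_prime X w Z :: ('x, 'k::field) mpoly set) q
    = card (wt w ` {m \<in> mons X q. keys (wt w m) \<inter> Z = {}})"
proof -
  let ?P = "weight_prime X w Z :: ('x, 'k) mpoly set"
  let ?M = "{m \<in> mons X q. keys (wt w m) \<inter> Z = {}}"
  interpret proper_poly_ideal X ?P
    by (rule prime_proper[OF prime_weight_prime])
  define s where "s \<mu> = (SOME m. m \<in> ?M \<and> wt w m = \<mu>)" for \<mu>
  have s: "s \<mu> \<in> ?M \<and> wt w (s \<mu>) = \<mu>" if "\<mu> \<in> wt w ` ?M" for \<mu>
    unfolding s_def by (rule someI_ex) (use that in auto)
  let ?b = "\<lambda>\<mu>. single (s \<mu>) (1::'k)"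
  have finA: "finite (wt w ` ?M)" using finite_mons[OF fin] by auto
  have push_lin: "push w Z (lincomb (wt w ` ?M) ?b c) = (\<Sum>\<mu>\<in>wt w ` ?M. single \<mu> (c \<mu>))" for c
    unfolding lincomb_def push_sum using s
    by (intro sum.cong refl) (auto simp: const_poly_mult_single push_single)
  have b: "?b \<mu> \<in> graded_part X q" if "\<mu> \<in> wt w ` ?M" for \<mu>
    using s[OF that] by (intro graded_part_closed) auto
  show ?thesis
  proof (rule hilbert_function_eq_card_basis[OF finA b])
    show "indep_mod ?P (wt w ` ?M) ?b"
      unfolding indep_mod_def
    proof (intro allI impI ballI)
      fix c \<mu> assume "lincomb (wt w ` ?M) ?b c \<in> ?P" and \<mu>: "\<mu> \<in> wt w ` ?M"
      then have "(\<Sum>\<mu>\<in>wt w ` ?M. single \<mu> (c \<mu>)) = 0"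
        by (simp add: weight_prime_def push_lin)
      then have "lookup (\<Sum>\<mu>\<in>wt w ` ?M. single \<mu> (c \<mu>)) \<mu> = 0" by simp
      then show "c \<mu> = 0"
        using \<mu> finA by (simp add: lookup_sum lookup_single when_def)
    qed
    show "spans_mod ?P (wt w ` ?M) ?b (graded_part X q)"
      unfolding spans_mod_def
    proof
      fix p :: "('x, 'k) mpoly" assume p: "p \<in> graded_part X q"
      let ?l = "lincomb (wt w ` ?M) ?b (lookup (push w Z p))"
      have k: "keys (push w Z p) \<subseteq> wt w ` ?M"
      proof
        fix \<mu> assume "\<mu> \<in> keys (push w Z p)"
        then have "lookup (push w Z p) \<mu> \<noteq> 0" by (simp add: in_keys_iff)
        then have "keys \<mu> \<inter> Z = {}" and nz: "(\<Sum>m\<in>keys p. if wt w m = \<mu> then lookup p m else 0) \<noteq> 0"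
          unfolding lookup_push[OF finite_keys subset_refl] by presburger+
        obtain m where "m \<in> keys p" "wt w m = \<mu>"
        proof (rule ccontr)
          assume "\<not> thesis"
          then have "\<forall>m\<in>keys p. wt w m \<noteq> \<mu>" using that by blast
          then show False using nz by (simp add: sum.neutral)
        qed
        then show "\<mu> \<in> wt w ` ?M"
          using p \<open>keys \<mu> \<inter> Z = {}\<close> by (auto simp: graded_part_alt)
      qed
      have "push w Z (p - ?l) = 0"
        unfolding push_diff push_lin sum_single_lookup[OF finA k] by simp
      moreover have "p - ?l \<in> graded_part X q"
        by (rule graded_part_closed(3)[OF p lincomb_graded[OF b]])
      then have "p - ?l \<in> carrier (poly_ring X)" using graded_part_carrier by (rule rev_subsetD)
      ultimately have "p - ?l \<in> ?P" by (simp add: weight_prime_def)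
      then show "\<exists>c. p - lincomb (wt w ` ?M) ?b c \<in> ?P" by blast
    qed
  qed
qed

section \<open>Krull dimension and multiplicity\<close>

definition prime_chain :: "'x set \<Rightarrow> ('x, 'k::field) mpoly set \<Rightarrow> nat \<Rightarrow> (nat \<Rightarrow> ('x, 'k) mpoly set) \<Rightarrow> bool"
  where "prime_chain X I l P \<longleftrightarrow>
    (\<forall>i\<le>l. primeideal (P i) (poly_ring X) \<and> I \<subseteq> P i) \<and> (\<forall>i<l. P i \<subset> P (Suc i))"

context proper_poly_ideal
begin

lemma carrier_quot: "u \<in> carrier (R Quot I) \<Longrightarrow> \<exists>p\<in>carrier R. u = cls p"
  by (auto simp: FactRing_simps a_r_coset_def)

lemma cls_mem_image_iff:
  assumes "ideal P R" "I \<subseteq> P" "p \<in> carrier R"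
  shows "cls p \<in> (\<lambda>p. cls p) ` P \<longleftrightarrow> p \<in> P"
proof
  assume "cls p \<in> (\<lambda>p. cls p) ` P"
  then obtain r where r: "r \<in> P" "cls p = cls r" by auto
  then have "p - r \<in> I"
    using coset_eq_iff[OF ideal assms(3), of r] idealD(1)[OF assms(1)] by auto
  then have "(p - r) + r \<in> P" using assms(2) r by (intro idealD(3)[OF assms(1)]) auto
  then show "p \<in> P" by simp
qed auto

lemma quot_prime:
  assumes P: "primeideal P R" and "I \<subseteq> P"
  shows "primeideal ((\<lambda>p. cls p) ` P) (R Quot I)"
proof (rule primeidealI)
  note P' = P[unfolded primeideal_poly_ring_iff]
  have idP: "ideal P R" using P' by simp
  show "ideal ((\<lambda>p. cls p) ` P) (R Quot I)"
    using ring.ring_ideal_imp_quot_ideal[OF poly_ring_ring ideal idP] .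
  show "cring (R Quot I)" by (rule ideal.quotient_is_cring[OF ideal cring_poly_ring])
  have "1 \<in> carrier R" by (rule poly_ring_closed)
  then have "cls 1 \<in> carrier (R Quot I)" "cls 1 \<notin> (\<lambda>p. cls p) ` P"
    using cls_mem_image_iff[OF idP assms(2), of 1] P' cls_closed by auto
  then show "carrier (R Quot I) \<noteq> (\<lambda>p. cls p) ` P" by blast
next
  fix u v assume uv: "u \<in> carrier (R Quot I)" "v \<in> carrier (R Quot I)"
    "u \<otimes>\<^bsub>R Quot I\<^esub> v \<in> (\<lambda>p. cls p) ` P"
  note P' = P[unfolded primeideal_poly_ring_iff]
  have idP: "ideal P R" using P' by simp
  obtain p where p: "p \<in> carrier R" "u = cls p" using carrier_quot[OF uv(1)] by auto
  obtain r where r: "r \<in> carrier R" "v = cls r" using carrier_quot[OF uv(2)] by auto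
  have "cls (p * r) \<in> (\<lambda>p. cls p) ` P" using uv(3) p r cls_hom(2) by simp
  then have "p * r \<in> P"
    using cls_mem_image_iff[OF idP assms(2) poly_ring_closed(5)[OF p(1) r(1)]] by simp
  then show "u \<in> (\<lambda>p. cls p) ` P \<or> v \<in> (\<lambda>p. cls p) ` P" using P' p r by blast
qed

lemma vimage_prime:
  assumes Q: "primeideal Q (R Quot I)"
  shows "primeideal {p \<in> carrier R. cls p \<in> Q} R" "I \<subseteq> {p \<in> carrier R. cls p \<in> Q}"
proof -
  show "primeideal {p \<in> carrier R. cls p \<in> Q} R"
    by (rule ring_hom_ring.primeideal_vimage[OF ideal.rcos_ring_hom_ring[OF ideal] cring_poly_ring Q])
  interpret Q: primeideal Q "R Quot I" by fact
  have "\<zero>\<^bsub>R Quot I\<^esub> \<in> Q" using additive_subgroup.zero_closed[OF Q.additive_subgroup_axioms] .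
  moreover have "x \<in> carrier R \<and> cls x = \<zero>\<^bsub>R Quot I\<^esub>" if "x \<in> I" for x
    using that idealD(1)[OF ideal] cls_eq_zero_iff[of x] by auto
  ultimately show "I \<subseteq> {p \<in> carrier R. cls p \<in> Q}" by auto
qed

lemma krull_dim_quot:
  "krull_dim (R Quot I) = Sup {enat l | l. \<exists>P. prime_chain X I l P}"
proof -
  have "(\<exists>P :: nat \<Rightarrow> _ set. (\<forall>i\<le>l. primeideal (P i) (R Quot I)) \<and> (\<forall>i<l. P i \<subset> P (Suc i)))
      \<longleftrightarrow> (\<exists>P. prime_chain X I l P)" (is "?L \<longleftrightarrow> ?R") for l
  proof
    assume ?L
    then obtain Q where Q: "\<And>i. i \<le> l \<Longrightarrow> primeideal (Q i) (R Quot I)"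
      "\<And>i. i < l \<Longrightarrow> Q i \<subset> Q (Suc i)" by auto
    have "{p \<in> carrier R. cls p \<in> Q i} \<subset> {p \<in> carrier R. cls p \<in> Q (Suc i)}" if i: "i < l" for i
    proof -
      obtain u where u: "u \<in> Q (Suc i)" "u \<notin> Q i" using Q(2)[OF i] by auto
      interpret primeideal "Q (Suc i)" "R Quot I" using Q(1)[of "Suc i"] i by simp
      have "u \<in> carrier (R Quot I)" using u a_subset by auto
      then obtain p where "p \<in> carrier R" "u = cls p" using carrier_quot by auto
      then show ?thesis using u Q(2)[OF i] by blast
    qed
    then have "prime_chain X I l (\<lambda>i. {p \<in> carrier R. cls p \<in> Q i})"
      unfolding prime_chain_def using vimage_prime[OF Q(1)] by simp
    then show ?R by blast
  next
    assume ?R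
    then obtain P where P: "\<And>i. i \<le> l \<Longrightarrow> primeideal (P i) R" "\<And>i. i \<le> l \<Longrightarrow> I \<subseteq> P i"
      "\<And>i. i < l \<Longrightarrow> P i \<subset> P (Suc i)" by (auto simp: prime_chain_def)
    have "(\<lambda>p. cls p) ` P i \<subset> (\<lambda>p. cls p) ` P (Suc i)" if i: "i < l" for i
    proof -
      obtain p where p: "p \<in> P (Suc i)" "p \<notin> P i" using P(3)[OF i] by auto
      have id: "ideal (P i) R" "ideal (P (Suc i)) R"
        using P(1) i by (auto simp: primeideal_poly_ring_iff)
      have "p \<in> carrier R" using p idealD(1)[OF id(2)] by auto
      then have "cls p \<notin> (\<lambda>p. cls p) ` P i"
        using p cls_mem_image_iff[OF id(1)] P(2)[of i] i by simp
      moreover have "(\<lambda>p. cls p) ` P i \<subseteq> (\<lambda>p. cls p) ` P (Suc i)" using P(3)[OF i] by auto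
      ultimately show ?thesis using p(1) by blast
    qed
    then show ?L
      using quot_prime[OF P(1,2)]
      by (intro exI[of _ "\<lambda>i. (\<lambda>p. cls p) ` P i"] conjI allI impI)
  qed
  then show ?thesis unfolding krull_dim_def by simp
qed

end

text \<open>Picking one element from each step of a chain of primes gives elements that are algebraically
  independent modulo the smallest prime. In a relation, the lowest power of the element of the
  first step can be cancelled, and what remains is a relation modulo the second prime between the
  other elements.\<close>

lemma prime_chain_indep:
  fixes P :: "nat \<Rightarrow> ('x, 'k::field) mpoly set"
  assumes "\<And>i. i \<le> l \<Longrightarrow> primeideal (P i) (poly_ring X)" "\<And>i. i < l \<Longrightarrow> P i \<subseteq> P (Suc i)"
    "\<And>i. i < l \<Longrightarrow> f i \<in> P (Suc i)" "\<And>i. i < l \<Longrightarrow> f i \<notin> P i"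
  shows "indep_mod (P 0) {as. set as \<subseteq> {..q} \<and> length as = l} (\<lambda>as. \<Prod>i<l. f i ^ (as ! i))"
  using assms
proof (induction l arbitrary: P f)
  case 0
  have P: "primeideal (P 0) (poly_ring X)" using 0 by simp
  have set: "{as. set as \<subseteq> {..q} \<and> length as = 0} = {[]}" by auto
  have "c = 0" if "const_poly c \<in> P 0" for c
  proof (rule ccontr)
    assume "c \<noteq> 0"
    have "const_poly (inverse c) * const_poly c \<in> P 0"
      using that P by (intro idealD(4)) (auto simp: primeideal_poly_ring_iff poly_ring_closed)
    then show False
      using P \<open>c \<noteq> 0\<close> by (simp add: const_poly_hom(2)[symmetric] primeideal_poly_ring_iff)
  qed
  then show ?case unfolding set by (simp add: indep_mod_def lincomb_def)
next
  case (Suc l)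
  let ?A = "{as. set as \<subseteq> {..q} \<and> length as = l}"
  let ?b = "\<lambda>as. \<Prod>i<l. f (Suc i) ^ (as ! i)"
  have IH: "indep_mod (P (Suc 0)) ?A ?b"
    using Suc.IH[of "\<lambda>i. P (Suc i)" "\<lambda>i. f (Suc i)"] Suc.prems by simp
  have id: "ideal (P i) (poly_ring X)" if "i \<le> Suc l" for i
    using Suc.prems(1)[OF that] by (simp add: primeideal_poly_ring_iff)
  have fc: "f i \<in> carrier (poly_ring X)" if "i < Suc l" for i
    using Suc.prems(3)[OF that] idealD(1)[OF id[of "Suc i"]] that by auto
  have pw: "f i ^ k \<in> carrier (poly_ring X)" if "i < Suc l" for i k
    using fc[OF that] by (induction k) (auto simp: poly_ring_closed)
  have bc: "?b as \<in> carrier (poly_ring X)" for as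
  proof -
    have "(\<Prod>i<k. f (Suc i) ^ (as ! i)) \<in> carrier (poly_ring X)" if "k \<le> l" for k
      using that by (induction k) (auto simp: poly_ring_closed pw)
    then show ?thesis by simp
  qed
  show ?case
    unfolding indep_mod_def
  proof (intro allI impI)
    fix c
    assume c: "lincomb {as. set as \<subseteq> {..q} \<and> length as = Suc l} (\<lambda>as. \<Prod>i<Suc l. f i ^ (as ! i)) c \<in> P 0"
    define G where "G a = lincomb ?A ?b (\<lambda>as. c (a # as))" for a
    have Gc: "G a \<in> carrier (poly_ring X)" for a
      unfolding G_def by (rule lincomb_closed[OF bc])
    have set: "{as. set as \<subseteq> {..q} \<and> length as = Suc l} = (\<lambda>(a, as). a # as) ` ({..q} \<times> ?A)"
      by (auto simp: length_Suc_conv image_iff)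
    have "lincomb {as. set as \<subseteq> {..q} \<and> length as = Suc l} (\<lambda>as. \<Prod>i<Suc l. f i ^ (as ! i)) c
        = (\<Sum>(a, as)\<in>{..q} \<times> ?A. const_poly (c (a # as)) * (f 0 ^ a * ?b as))"
      unfolding set lincomb_def
      by (subst sum.reindex)
         (auto simp: inj_on_def prod.lessThan_Suc_shift split_def simp del: prod.lessThan_Suc)
    also have "\<dots> = (\<Sum>a\<le>q. f 0 ^ a * G a)"
      unfolding G_def lincomb_def sum.cartesian_product[symmetric]
      by (simp add: sum_distrib_left mult.left_commute)
    finally have sumP: "(\<Sum>a\<le>q. f 0 ^ a * G a) \<in> P 0" using c by simp
    have zero: "\<forall>as\<in>?A. c (a # as) = 0" if "a \<le> q" for a
      using that
    proof (induction a rule: less_induct)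
      case (less a)
      have G0: "G b = 0" if "b < a" for b
        using less that by (simp add: G_def lincomb_def)
      define rest where "rest = (\<Sum>b\<in>{a<..q}. f 0 ^ (b - Suc a) * G b)"
      have "(\<Sum>b\<le>q. f 0 ^ b * G b) = (\<Sum>b\<in>{a..q}. f 0 ^ b * G b)"
        using G0 by (intro sum.mono_neutral_right) auto
      also have "{a..q} = insert a {a<..q}" using less.prems by auto
      also have "(\<Sum>b\<in>insert a {a<..q}. f 0 ^ b * G b) = f 0 ^ a * G a + (\<Sum>b\<in>{a<..q}. f 0 ^ b * G b)"
        by simp
      also have "(\<Sum>b\<in>{a<..q}. f 0 ^ b * G b) = f 0 ^ a * (f 0 * rest)"
        unfolding rest_def sum_distrib_left
      proof (rule sum.cong)
        fix b assume "b \<in> {a<..q}"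
        then have "f 0 ^ b = f 0 ^ a * (f 0 * f 0 ^ (b - Suc a))"
          by (simp add: power_add[symmetric] power_Suc[symmetric] del: power_Suc)
        then show "f 0 ^ b * G b = f 0 ^ a * (f 0 * (f 0 ^ (b - Suc a) * G b))"
          by (simp add: mult.assoc)
      qed simp
      finally have *: "f 0 ^ a * (G a + f 0 * rest) \<in> P 0"
        using sumP by (simp add: distrib_left)
      have P0: "primeideal (P 0) (poly_ring X)" using Suc.prems(1) by simp
      have restc: "rest \<in> carrier (poly_ring X)"
        unfolding rest_def
        using fc Gc pw
        by (intro poly_ring_sum_closed)
           (auto simp: poly_ring_closed)
      have "f 0 ^ k \<notin> P 0" for k
        using P0 Suc.prems(4)[of 0] fc[of 0] pw[of 0]
        by (induction k) (auto simp: primeideal_poly_ring_iff)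
      then have "G a + f 0 * rest \<in> P 0"
        using * P0 pw[of 0 a] Gc[of a] restc fc[of 0]
        unfolding primeideal_poly_ring_iff by (meson poly_ring_closed(4,5) zero_less_Suc)
      then have "G a + f 0 * rest \<in> P (Suc 0)" using Suc.prems(2)[of 0] by auto
      moreover have "f 0 * rest \<in> P (Suc 0)"
        using idealD(4)[OF id[of "Suc 0"] restc, of "f 0"] Suc.prems(3)[of 0] by (simp add: mult.commute)
      ultimately have "(G a + f 0 * rest) - f 0 * rest \<in> P (Suc 0)"
        by (intro idealD(6)[OF id[of "Suc 0"]]) auto
      then have "G a \<in> P (Suc 0)" by simp
      then show ?case using IH unfolding G_def indep_mod_def by blast
    qed
    show "\<forall>as\<in>{as. set as \<subseteq> {..q} \<and> length as = Suc l}. c as = 0"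
      unfolding set using zero by auto
  qed
qed

definition deg_le :: "nat \<Rightarrow> ('x, 'k::field) mpoly \<Rightarrow> bool" where
  "deg_le d p \<longleftrightarrow> (\<forall>m\<in>keys p. monom_degree m \<le> d)"

lemma deg_le_mult: "deg_le a p \<Longrightarrow> deg_le b q \<Longrightarrow> deg_le (a + b) (p * q)"
  using keys_mult[of p q] by (fastforce simp: deg_le_def monom_degree_add intro: add_mono)

lemma deg_le_mono: "deg_le a p \<Longrightarrow> a \<le> b \<Longrightarrow> deg_le b p"
  by (force simp: deg_le_def)

lemma deg_le_power: "deg_le a p \<Longrightarrow> deg_le (k * a) (p ^ k)"
proof (induction k)
  case (Suc k)
  then show ?case using deg_le_mult[of a p "k * a" "p ^ k"] by simp
qed (auto simp: deg_le_def)

lemma deg_le_prod: "(\<And>i. i \<in> A \<Longrightarrow> deg_le (a i) (f i)) \<Longrightarrow> deg_le (\<Sum>i\<in>A. a i) (\<Prod>i\<in>A. f i)"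
  by (induction A rule: infinite_finite_induct) (auto simp: deg_le_def[of 0] deg_le_mult)

lemma sum_hcomp:
  assumes "deg_le d p"
  shows "(\<Sum>k\<le>d. hcomp k p) = p"
  using assms
  by (intro poly_mapping_eqI)
     (auto simp: lookup_sum lookup_hcomp deg_le_def not_in_keys_iff_lookup_eq_zero[symmetric])

text \<open>A chain of length \<open>l\<close> forces the number of linearly independent classes of polynomials of
  degree at most \<open>q\<close> to grow at least like the \<open>l\<close>-th power of \<open>q\<close>. As the primes of
  the chain may be inhomogeneous, all degrees up to \<open>q\<close> are considered together.\<close>

lemma (in proper_poly_ideal) prime_chain_length_le:
  assumes fin: "finite X" and growth: "\<And>q. hilbert_function X I q \<le> C * (q + 1) ^ e"
    and chain: "prime_chain X I l P"
  shows "l \<le> Suc e"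
proof (rule ccontr)
  assume "\<not> l \<le> Suc e"
  then have l: "l \<ge> Suc (Suc e)" by simp
  have P: "\<And>i. i \<le> l \<Longrightarrow> primeideal (P i) R" "\<And>i. i \<le> l \<Longrightarrow> I \<subseteq> P i"
    "\<And>i. i < l \<Longrightarrow> P i \<subset> P (Suc i)" using chain by (auto simp: prime_chain_def)
  have "\<forall>i. \<exists>f. i < l \<longrightarrow> f \<in> P (Suc i) \<and> f \<notin> P i" using P(3) by blast
  then obtain f where f: "\<And>i. i < l \<Longrightarrow> f i \<in> P (Suc i)" "\<And>i. i < l \<Longrightarrow> f i \<notin> P i" by metis
  have fc: "f i \<in> carrier R" if "i < l" for i
    using f(1)[OF that] P(1)[of "Suc i"] that idealD(1) by (auto simp: primeideal_poly_ring_iff)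
  interpret P0: proper_poly_ideal X "P 0" using prime_proper[OF P(1)[of 0]] by simp
  have hf: "hilbert_function X (P 0) q \<le> C * (q + 1) ^ e" for q
    using hilbert_function_antimono[OF fin ideal P0.ideal P(2)[of 0] P0.proper, of q] growth[of q]
    by simp
  define d where "d = Max (insert 0 (monom_degree ` (\<Union>i<l. keys (f i))))"
  have d: "deg_le d (f i)" if "i < l" for i
    using that unfolding deg_le_def d_def by (intro ballI Max_ge) auto
  define K where "K = C * (l * d + 1) ^ Suc e"
  have bound: "(q + 1) ^ l \<le> K * (q + 1) ^ Suc e" for q
  proof -
    let ?A = "{as. set as \<subseteq> {..q} \<and> length as = l}"
    let ?a = "\<lambda>as. \<Prod>i<l. f i ^ (as ! i)"
    define D where "D = l * d * q"
    have "\<forall>k. \<exists>B. finite B \<and> B \<subseteq> mons X k \<and> spans_mod (P 0) B (\<lambda>m. single m 1) (graded_part X k)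
        \<and> card B = hilbert_function X (P 0) k"
      using P0.graded_basis[OF fin] by blast
    then obtain B where B: "\<And>k. finite (B k)" "\<And>k. B k \<subseteq> mons X k"
      "\<And>k. spans_mod (P 0) (B k) (\<lambda>m. single m 1) (graded_part X k)"
      "\<And>k. card (B k) = hilbert_function X (P 0) k"
      by metis
    let ?B = "SIGMA k:{..D}. B k"
    have spans: "spans_mod (P 0) ?B (\<lambda>(k, m). single m 1) {p \<in> carrier R. deg_le D p}"
      unfolding spans_mod_def
    proof
      fix p :: "('x, 'k) mpoly" assume p: "p \<in> {p \<in> carrier R. deg_le D p}"
      have "\<exists>c. hcomp k p - lincomb (B k) (\<lambda>m. single m 1) c \<in> P 0" for k
        using B(3)[of k] hcomp_graded[of p X k] p unfolding spans_mod_def by blast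
      then obtain c where c: "\<And>k. hcomp k p - lincomb (B k) (\<lambda>m. single m 1) (c k) \<in> P 0" by metis
      have "lincomb ?B (\<lambda>(k, m). single m 1) (\<lambda>(k, m). c k m)
          = (\<Sum>k\<le>D. lincomb (B k) (\<lambda>m. single m 1) (c k))"
        unfolding lincomb_def by (subst sum.Sigma) (auto simp: B(1) split_def)
      then have "p - lincomb ?B (\<lambda>(k, m). single m 1) (\<lambda>(k, m). c k m)
          = (\<Sum>k\<le>D. hcomp k p - lincomb (B k) (\<lambda>m. single m 1) (c k))"
        using p sum_hcomp[of D p] by (simp add: sum_subtractf)
      also have "\<dots> \<in> P 0" using c by (intro idealD(7)[OF P0.ideal])
      finally show "\<exists>c. p - lincomb ?B (\<lambda>(k, m). single m 1) c \<in> P 0" by blast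
    qed
    have ac: "?a as \<in> carrier R" for as
    proof -
      have pw: "f i ^ k \<in> carrier R" if "i < l" for i k
        using fc[OF that] by (induction k) (auto simp: poly_ring_closed)
      have "(\<Prod>i<k. f i ^ (as ! i)) \<in> carrier R" if "k \<le> l" for k
        using that by (induction k) (auto simp: poly_ring_closed pw)
      then show ?thesis by simp
    qed
    have ad: "deg_le D (?a as)" if "as \<in> ?A" for as
    proof -
      have "deg_le (\<Sum>i<l. as ! i * d) (?a as)"
        by (intro deg_le_prod deg_le_power d) auto
      moreover have "(\<Sum>i<l. as ! i * d) \<le> (\<Sum>i<l. q * d)"
        using that by (intro sum_mono mult_right_mono) (auto simp: subset_iff)
      ultimately show ?thesis by (auto simp: D_def mult_ac elim: deg_le_mono)
    qed
    have indep: "indep_mod (P 0) ?A ?a"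
      by (rule prime_chain_indep[where X = X]) (use P(1,3) f in \<open>simp_all add: psubset_imp_subset\<close>)
    have "card ?A \<le> card ?B"
    proof (rule P0.card_indep_le_card_spans[OF _ _ _ _ indep])
      show "finite ?A" by (rule finite_lists_length_eq) simp
      show "finite ?B" using B(1) by auto
      show "?a i \<in> carrier R" for i by (rule ac)
      show "(\<lambda>(k, m). single m 1) i \<in> carrier R" if "i \<in> ?B" for i
        using that B(2) by (auto simp: mons_def intro!: poly_ring_closed(9))
      show "spans_mod (P 0) ?B (\<lambda>(k, m). single m 1) (?a ` ?A)"
        using spans ac ad unfolding spans_mod_def by blast
    qed
    also have "card ?B = (\<Sum>k\<le>D. hilbert_function X (P 0) k)"
      using B by simp
    also have "\<dots> \<le> (\<Sum>k\<le>D. C * (D + 1) ^ e)"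
    proof (rule sum_mono)
      fix k assume "k \<in> {..D}"
      then have "C * (k + 1) ^ e \<le> C * (D + 1) ^ e" by (intro mult_left_mono power_mono) auto
      then show "hilbert_function X (P 0) k \<le> C * (D + 1) ^ e" using hf[of k] by linarith
    qed
    also have "\<dots> = C * (D + 1) ^ Suc e" by (simp add: algebra_simps)
    also have "\<dots> \<le> C * ((l * d + 1) * (q + 1)) ^ Suc e"
      by (intro mult_left_mono power_mono) (auto simp: D_def algebra_simps)
    also have "\<dots> = K * (q + 1) ^ Suc e"
      by (simp only: power_mult_distrib K_def mult.assoc)
    finally show ?thesis by (simp add: card_lists_length_eq)
  qed
  \<comment> \<open>With \<open>l \<ge> e + 2\<close> the bound fails at \<open>q = K\<close>.\<close>
  have "(K + 1) ^ Suc (Suc e) \<le> (K + 1) ^ l" using l by (intro power_increasing) auto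
  also have "\<dots> \<le> K * (K + 1) ^ Suc e" by (rule bound)
  finally have "(K + 1) * (K + 1) ^ Suc e \<le> K * (K + 1) ^ Suc e" by simp
  then show False by simp
qed

lemma (in proper_poly_ideal) krull_dim_eq:
  assumes "finite X" "\<And>q. hilbert_function X I q \<le> C * (q + 1) ^ e" "prime_chain X I (Suc e) P"
  shows "krull_dim (R Quot I) = enat (Suc e)"
  unfolding krull_dim_quot
proof (rule antisym)
  show "Sup {enat l |l. \<exists>P. prime_chain X I l P} \<le> enat (Suc e)"
    using prime_chain_length_le[OF assms(1,2)] by (intro Sup_least) auto
  show "enat (Suc e) \<le> Sup {enat l |l. \<exists>P. prime_chain X I l P}"
    using assms(3) by (intro Sup_upper) auto
qed

lemma poly_eventually_unique:
  fixes h h' :: "rat poly"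
  assumes "\<forall>\<^sub>F q in sequentially. poly h (of_nat q) = poly h' (of_nat q)"
  shows "h = h'"
proof (rule ccontr)
  assume "h \<noteq> h'"
  then have "finite {x. poly (h - h') x = 0}" by (intro poly_roots_finite) simp
  moreover obtain N where "\<forall>q\<ge>N. poly h (of_nat q) = poly h' (of_nat q)"
    using assms by (auto simp: eventually_sequentially)
  then have "of_nat ` {N..} \<subseteq> {x. poly (h - h') x = 0}" by auto
  moreover have "infinite (of_nat ` {N..} :: rat set)"
    using finite_imageD[of "of_nat :: nat \<Rightarrow> rat" "{N..}"] infinite_Ici[of N] by (auto simp: inj_on_def)
  ultimately show False using finite_subset by blast
qed

lemma hilbert_multiplicity_eqI:
  assumes dim: "krull_dim (poly_ring X Quot I) = enat (Suc k)"
    and h: "is_hilbert_polynomial X I h" "degree h = k" "lead_coeff h = e / fact k"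
  shows "hilbert_multiplicity X I = e"
  unfolding hilbert_multiplicity_def
proof (rule the_equality)
  show "\<exists>d h. krull_dim (poly_ring X Quot I) = enat d \<and> d \<ge> 1 \<and> is_hilbert_polynomial X I h \<and>
      degree h = d - 1 \<and> lead_coeff h = e / fact (d - 1)"
    using assms by (intro exI[of _ "Suc k"] exI[of _ h]) simp
next
  fix e' assume "\<exists>d h. krull_dim (poly_ring X Quot I) = enat d \<and> d \<ge> 1 \<and> is_hilbert_polynomial X I h \<and>
      degree h = d - 1 \<and> lead_coeff h = e' / fact (d - 1)"
  then obtain d h' where h': "krull_dim (poly_ring X Quot I) = enat d" "is_hilbert_polynomial X I h'"
    "lead_coeff h' = e' / fact (d - 1)" by auto
  have d: "d = Suc k" using dim h'(1) by simp
  have "\<forall>\<^sub>F q in sequentially. poly h (of_nat q) = poly h' (of_nat q)"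
    using h(1) h'(2) unfolding is_hilbert_polynomial_def by eventually_elim simp
  then have "h = h'" by (rule poly_eventually_unique)
  then show "e' = e" using h(3) h'(3) d by simp
qed

text \<open>The order of the pole of the series at \<open>1\<close> bounds the dimension from above, and the given chain
  attains the bound.\<close>

lemma (in proper_poly_ideal) multiplicity_of_series:
  assumes fin: "finite X" and series: "hilbert_series (hilbert_function X I) (Suc k) p"
    and p: "poly p 1 \<noteq> 0" and chain: "prime_chain X I (Suc k) P"
  shows "krull_dim (R Quot I) = enat (Suc k)" "hilbert_multiplicity X I = poly p 1"
    "\<exists>C. \<forall>q. hilbert_function X I q \<le> C * (q + 1) ^ k"
proof -
  obtain h where h: "\<forall>\<^sub>F q in sequentially. of_nat (hilbert_function X I q) = poly h (of_nat q)"
    "degree h \<le> k" "poly.coeff h k = poly p 1 / fact k"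
    by (rule hilbert_polynomial_of_series[OF series])
  show "\<exists>C. \<forall>q. hilbert_function X I q \<le> C * (q + 1) ^ k"
    by (rule growth_of_poly[OF h(1,2)])
  then show dim: "krull_dim (R Quot I) = enat (Suc k)"
    using krull_dim_eq[OF fin _ chain] by auto
  have "degree h = k" using h(2,3) p by (intro antisym le_degree) auto
  then show "hilbert_multiplicity X I = poly p 1"
    using h by (intro hilbert_multiplicity_eqI[OF dim, of h]) (auto simp: is_hilbert_polynomial_def)
qed

text \<open>Killing the new variables one after the other gives a chain, which is strict as long as the
  next one occurs in the weight of a variable that has survived so far.\<close>

lemma weight_prime_chain:
  fixes z :: "nat \<Rightarrow> 't" and w :: "'x \<Rightarrow> ('t \<Rightarrow>\<^sub>0 nat)"
  assumes "\<And>i. i < l \<Longrightarrow> \<exists>x\<in>X. z i \<in> keys (w x) \<and> keys (w x) \<inter> (Z \<union> z ` {..<i}) = {}"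
  shows "prime_chain X (weight_prime X w Z :: ('x, 'k::field) mpoly set) l
    (\<lambda>i. weight_prime X w (Z \<union> z ` {..<i}))"
  unfolding prime_chain_def
proof (intro conjI allI impI)
  fix i
  show "primeideal (weight_prime X w (Z \<union> z ` {..<i}) :: ('x, 'k::field) mpoly set) (poly_ring X)"
    by (rule prime_weight_prime)
  show "weight_prime X w Z \<subseteq> (weight_prime X w (Z \<union> z ` {..<i}) :: ('x, 'k::field) mpoly set)"
    by (rule weight_prime_mono) simp
  assume "i < l"
  then obtain x where x: "x \<in> X" "z i \<in> keys (w x)" "keys (w x) \<inter> (Z \<union> z ` {..<i}) = {}"
    using assms by blast
  have "var_poly x \<in> (weight_prime X w (Z \<union> z ` {..<Suc i}) :: ('x, 'k::field) mpoly set)"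
    "var_poly x \<notin> (weight_prime X w (Z \<union> z ` {..<i}) :: ('x, 'k::field) mpoly set)"
    using x by (auto simp: var_mem_weight_prime_iff)
  moreover have "weight_prime X w (Z \<union> z ` {..<i})
      \<subseteq> (weight_prime X w (Z \<union> z ` {..<Suc i}) :: ('x, 'k::field) mpoly set)"
    by (rule weight_prime_mono) auto
  ultimately show "weight_prime X w (Z \<union> z ` {..<i})
      \<subset> (weight_prime X w (Z \<union> z ` {..<Suc i}) :: ('x, 'k::field) mpoly set)"
    by blast
qed

section \<open>Ideals generated by variables and binomials\<close>

abbreviation gvars :: "'v set \<Rightarrow> 'v edge_var set" where
  "gvars W \<equiv> XVar ` W \<union> YVar ` W"

definition binom :: "'v \<Rightarrow> 'v \<Rightarrow> ('v edge_var, 'k::field) mpoly" where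
  "binom a b = var_poly (XVar a) * var_poly (YVar b) - var_poly (XVar b) * var_poly (YVar a)"

definition cut_gens :: "'v set \<Rightarrow> 'v rel \<Rightarrow> ('v edge_var, 'k::field) mpoly set" where
  "cut_gens T E = (\<lambda>v. var_poly (XVar v)) ` T \<union> (\<lambda>v. var_poly (YVar v)) ` T \<union> {binom a b | a b. (a, b) \<in> E}"

text \<open>For \<open>T = {}\<close> this is the binomial edge ideal of \<open>E\<close>; if \<open>E\<close> is the connectedness relation of the
  vertices outside \<open>T\<close>, it is the prime ideal attached to \<open>T\<close>.\<close>

definition cut_ideal :: "'v set \<Rightarrow> 'v set \<Rightarrow> 'v rel \<Rightarrow> ('v edge_var, 'k::field) mpoly set" where
  "cut_ideal W T E = Idl\<^bsub>poly_ring (gvars W)\<^esub> (cut_gens T E)"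

text \<open>Connectedness in the graph with edges \<open>E\<close> after the vertices in \<open>T\<close> have been deleted.\<close>

definition con :: "'v set \<Rightarrow> 'v set \<Rightarrow> 'v rel \<Rightarrow> 'v rel" where
  "con W T E = Restr ((Restr E (W - T))\<^sup>*) (W - T)"

lemma con_equiv:
  assumes "sym E"
  shows "equiv (W - T) (con W T E)"
proof (rule equivI)
  show "refl_on (W - T) (con W T E)" by (auto simp: refl_on_def con_def)
  have "sym (Restr E (W - T))" using assms by (auto simp: sym_def)
  then have "sym ((Restr E (W - T))\<^sup>*)" by (rule sym_rtrancl)
  then show "sym (con W T E)" unfolding con_def sym_def by blast
  show "trans (con W T E)"
    unfolding con_def by (rule transI) auto
  show "con W T E \<subseteq> (W - T) \<times> (W - T)" by (auto simp: con_def)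
qed

lemma con_subset: "con W T E \<subseteq> (W - T) \<times> (W - T)"
  by (auto simp: con_def)

lemma con_edge: "(a, b) \<in> E \<Longrightarrow> a \<in> W - T \<Longrightarrow> b \<in> W - T \<Longrightarrow> (a, b) \<in> con W T E"
  by (auto simp: con_def)

lemma con_refl: "a \<in> W - T \<Longrightarrow> (a, a) \<in> con W T E"
  by (auto simp: con_def)

lemma con_mono: "E \<subseteq> E' \<Longrightarrow> con W T E \<subseteq> con W T E'"
  unfolding con_def using rtrancl_mono[of "Restr E (W - T)" "Restr E' (W - T)"] by blast

lemma con_minimal:
  assumes "equiv (W - T) Q" "Restr E (W - T) \<subseteq> Q"
  shows "con W T E \<subseteq> Q"
proof
  fix u assume u: "u \<in> con W T E"
  obtain a b where [simp]: "u = (a, b)" by (cases u)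
  have ab: "(a, b) \<in> (Restr E (W - T))\<^sup>*" "a \<in> W - T" using u by (auto simp: con_def)
  from ab(1) have "(a, b) \<in> Q"
  proof (induction rule: rtrancl_induct)
    case base
    then show ?case using assms(1) ab(2) by (auto simp: equiv_def refl_on_def)
  next
    case (step y z)
    then show ?case using assms by (meson equivE subsetD transD)
  qed
  then show "u \<in> Q" by simp
qed

lemma binom_graded:
  assumes "a \<in> W" "b \<in> W"
  shows "(binom a b :: ('v edge_var, 'k::field) mpoly) \<in> graded_part (gvars W) 2"
proof -
  have v: "(var_poly x :: ('v edge_var, 'k) mpoly) \<in> graded_part (gvars W) 1" if "x \<in> gvars W" for x
    using that unfolding var_poly_def by (intro graded_part_closed(5)) (auto simp: mons_def)
  have "(binom a b :: ('v edge_var, 'k) mpoly) \<in> graded_part (gvars W) (1 + 1)"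
    unfolding binom_def using assms
    by (intro graded_part_closed(3) graded_part_mult v) auto
  then show ?thesis by (simp add: numeral_2_eq_2)
qed

lemma binom_commute: "binom b a = - binom a b"
  by (simp add: binom_def)

lemma binom_self [simp]: "binom a a = 0"
  by (simp add: binom_def)

lemma cut_gens_graded:
  assumes "T \<subseteq> W" "E \<subseteq> W \<times> W" "(g :: ('v edge_var, 'k::field) mpoly) \<in> cut_gens T E"
  shows "\<exists>d. g \<in> graded_part (gvars W) d"
proof -
  have v: "(var_poly x :: ('v edge_var, 'k) mpoly) \<in> graded_part (gvars W) 1" if "x \<in> gvars W" for x
    using that unfolding var_poly_def by (intro graded_part_closed(5)) (auto simp: mons_def)
  from assms(3) consider v where "v \<in> T" "g = var_poly (XVar v)" | v where "v \<in> T" "g = var_poly (YVar v)"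
    | a b where "(a, b) \<in> E" "g = binom a b"
    unfolding cut_gens_def by blast
  then show ?thesis
  proof cases
    case 1
    then show ?thesis using v[of "XVar v"] assms(1) by auto
  next
    case 2
    then show ?thesis using v[of "YVar v"] assms(1) by auto
  next
    case 3
    then show ?thesis using binom_graded[of a W b] assms(2) by auto
  qed
qed

lemma cut_gens_carrier:
  assumes "T \<subseteq> W" "E \<subseteq> W \<times> W"
  shows "(cut_gens T E :: ('v edge_var, 'k::field) mpoly set) \<subseteq> carrier (poly_ring (gvars W))"
proof
  fix g :: "('v edge_var, 'k) mpoly" assume "g \<in> cut_gens T E"
  then obtain d where "g \<in> graded_part (gvars W) d" using cut_gens_graded[OF assms] by blast
  then show "g \<in> carrier (poly_ring (gvars W))" using graded_part_carrier by (rule rev_subsetD)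
qed

lemma ideal_cut_ideal:
  assumes "T \<subseteq> W" "E \<subseteq> W \<times> W"
  shows "ideal (cut_ideal W T E) (poly_ring (gvars W))"
  unfolding cut_ideal_def by (rule ring.genideal_ideal[OF poly_ring_ring cut_gens_carrier[OF assms]])

lemma homogeneous_cut_ideal:
  assumes "T \<subseteq> W" "E \<subseteq> W \<times> W"
  shows "homogeneous_set (cut_ideal W T E)"
  unfolding cut_ideal_def by (rule homogeneous_genideal[OF cut_gens_graded[OF assms]])

lemma cut_ideal_least:
  assumes "ideal I (poly_ring (gvars W))"
    and "\<And>v. v \<in> T \<Longrightarrow> var_poly (XVar v) \<in> I" "\<And>v. v \<in> T \<Longrightarrow> var_poly (YVar v) \<in> I"
    and "\<And>a b. (a, b) \<in> E \<Longrightarrow> binom a b \<in> I"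
  shows "cut_ideal W T E \<subseteq> I"
  unfolding cut_ideal_def using assms
  by (intro ring.genideal_minimal[OF poly_ring_ring]) (auto simp: cut_gens_def)

lemma cut_ideal_gens:
  assumes "T \<subseteq> W" "E \<subseteq> W \<times> W"
  shows "v \<in> T \<Longrightarrow> var_poly (XVar v) \<in> cut_ideal W T E" "v \<in> T \<Longrightarrow> var_poly (YVar v) \<in> cut_ideal W T E"
    "(a, b) \<in> E \<Longrightarrow> binom a b \<in> cut_ideal W T E"
  using ring.genideal_self[OF poly_ring_ring cut_gens_carrier[OF assms]]
  unfolding cut_ideal_def[symmetric] unfolding cut_gens_def by blast+

lemma var_carrier:
  "v \<in> W \<Longrightarrow> var_poly (XVar v) \<in> carrier (poly_ring (gvars W))"
  "v \<in> W \<Longrightarrow> var_poly (YVar v) \<in> carrier (poly_ring (gvars W))"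
  by (rule poly_ring_closed; simp)+

lemma binom_mem_of_vars:
  assumes I: "ideal I (poly_ring (gvars W))" and W: "a \<in> W" "b \<in> W"
    and "var_poly (XVar a) \<in> I \<and> var_poly (YVar a) \<in> I \<or> var_poly (XVar b) \<in> I \<and> var_poly (YVar b) \<in> I"
  shows "binom a b \<in> I"
proof -
  have r: "p * r \<in> I" if "p \<in> I" "r \<in> carrier (poly_ring (gvars W))" for p r
    using idealD(4)[OF I that(2,1)] by (simp add: mult.commute)
  note l = idealD(4)[OF I]
  show ?thesis
    unfolding binom_def using assms(4)
    by (elim disjE conjE)
       (intro idealD(6)[OF I]; blast intro: r l var_carrier[OF W(1)] var_carrier[OF W(2)])+
qed

lemma cut_ideal_le_con:
  assumes "T \<subseteq> W" "E \<subseteq> W \<times> W"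
  shows "cut_ideal W T E \<subseteq> cut_ideal W T (con W T E)"
proof (rule cut_ideal_least)
  have c: "con W T E \<subseteq> W \<times> W" using con_subset by blast
  note g = cut_ideal_gens[OF assms(1) c]
  show I: "ideal (cut_ideal W T (con W T E)) (poly_ring (gvars W))"
    by (rule ideal_cut_ideal[OF assms(1) c])
  show "var_poly (XVar v) \<in> cut_ideal W T (con W T E)" "var_poly (YVar v) \<in> cut_ideal W T (con W T E)"
    if "v \<in> T" for v using that g by auto
  show "binom a b \<in> cut_ideal W T (con W T E)" if ab: "(a, b) \<in> E" for a b
  proof (cases "a \<in> T \<or> b \<in> T")
    case True
    then show ?thesis using g(1,2) ab assms(2) by (intro binom_mem_of_vars[OF I]) auto
  next
    case False
    then show ?thesis using con_edge[OF ab, of W T] ab assms(2) by (intro g(3)) auto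
  qed
qed

lemma cut_ideal_mono:
  assumes "T \<subseteq> T'" "T' \<subseteq> W" "E \<subseteq> E'" "E' \<subseteq> W \<times> W"
  shows "cut_ideal W T E \<subseteq> cut_ideal W T' E'"
  by (rule cut_ideal_least[OF ideal_cut_ideal[OF assms(2,4)]])
     (use assms cut_ideal_gens[OF assms(2,4)] in blast)+

section \<open>The prime ideal of a cut set\<close>

text \<open>With \<open>x\<^sub>v = t\<^sub>v\<close> and \<open>y\<^sub>v = t\<^sub>v s\<^sub>c\<close> for the class \<open>c\<close> of \<open>v\<close>, all binomials of pairs
  in a class vanish. The injections \<open>Inl\<close> and \<open>Inr\<close> index the \<open>t\<close>- and the \<open>s\<close>-variables.\<close>

definition class_weight :: "'v rel \<Rightarrow> 'v edge_var \<Rightarrow> ('v + 'v set) \<Rightarrow>\<^sub>0 nat" where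
  "class_weight Q x = (case x of XVar v \<Rightarrow> single (Inl v) 1
     | YVar v \<Rightarrow> single (Inl v) 1 + single (Inr (Q `` {v})) 1)"

lemma class_weight_simps [simp]:
  "class_weight Q (XVar v) = single (Inl v) 1"
  "class_weight Q (YVar v) = single (Inl v) 1 + single (Inr (Q `` {v})) 1"
  by (simp_all add: class_weight_def)

lemma sum_gvars:
  assumes "finite W"
  shows "(\<Sum>x\<in>gvars W. f x) = (\<Sum>v\<in>W. f (XVar v)) + (\<Sum>v\<in>W. f (YVar v))"
  using assms
  by (subst sum.union_disjoint) (auto simp: sum.reindex inj_on_def)

lemma lookup_class_weight:
  assumes fin: "finite W" and m: "keys m \<subseteq> gvars W"
  shows "lookup (wt (class_weight Q) m) (Inl v)
      = (if v \<in> W then lookup m (XVar v) + lookup m (YVar v) else 0)"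
    "lookup (wt (class_weight Q) m) (Inr c) = (\<Sum>v\<in>{v \<in> W. Q `` {v} = c}. lookup m (YVar v))"
proof -
  have *: "lookup (wt (class_weight Q) m) t = (\<Sum>v\<in>W. lookup m (XVar v) * lookup (class_weight Q (XVar v)) t)
      + (\<Sum>v\<in>W. lookup m (YVar v) * lookup (class_weight Q (YVar v)) t)" for t
    using fin m by (subst lookup_wt[of "gvars W"]) (auto simp: sum_gvars)
  have "lookup m (XVar u) * lookup (class_weight Q (XVar u)) (Inl v) = (if u = v then lookup m (XVar v) else 0)"
    "lookup m (YVar u) * lookup (class_weight Q (YVar u)) (Inl v) = (if u = v then lookup m (YVar v) else 0)" for u
    by (simp_all add: lookup_single lookup_add when_def)
  then show "lookup (wt (class_weight Q) m) (Inl v)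
      = (if v \<in> W then lookup m (XVar v) + lookup m (YVar v) else 0)"
    unfolding * using fin by simp
  have "lookup m (XVar u) * lookup (class_weight Q (XVar u)) (Inr c) = 0"
    "lookup m (YVar u) * lookup (class_weight Q (YVar u)) (Inr c)
      = (if Q `` {u} = c then lookup m (YVar u) else 0)" for u
    by (simp_all add: lookup_single lookup_add when_def)
  then show "lookup (wt (class_weight Q) m) (Inr c) = (\<Sum>v\<in>{v \<in> W. Q `` {v} = c}. lookup m (YVar v))"
    unfolding * using fin by (simp add: sum.inter_filter)
qed

lemma push_var: "push w Z (var_poly x) = (if keys (w x) \<inter> Z = {} then single (w x) 1 else 0)"
  unfolding var_poly_def push_single wt_single ..

lemma push_binom:
  assumes "a \<notin> T" "b \<notin> T"
  shows "push (class_weight Q) (Inl ` T) (binom a b :: ('v edge_var, 'k::field) mpoly)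
    = single (single (Inl a) 1 + (single (Inl b) 1 + single (Inr (Q `` {b})) 1)) 1
      - single (single (Inl a) 1 + (single (Inl b) 1 + single (Inr (Q `` {a})) 1)) 1"
proof -
  have "push (class_weight Q) (Inl ` T) (binom a b :: ('v edge_var, 'k) mpoly)
    = single (single (Inl a) 1 + (single (Inl b) 1 + single (Inr (Q `` {b})) 1)) (1 * 1)
      - single (single (Inl b) 1 + (single (Inl a) 1 + single (Inr (Q `` {a})) 1)) (1 * 1)"
    unfolding binom_def push_diff push_mult push_var mult_single[symmetric]
    using assms by (auto simp: keys_add_nat)
  then show ?thesis by (simp only: mult_1 add.left_commute)
qed

lemma monomial_of_dead_weight:
  fixes C :: "('v edge_var, 'k::field) mpoly set"
  assumes C: "ideal C (poly_ring (gvars W))"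
    and T: "\<And>v. v \<in> T \<Longrightarrow> var_poly (XVar v) \<in> C" "\<And>v. v \<in> T \<Longrightarrow> var_poly (YVar v) \<in> C"
    and m: "keys m \<subseteq> gvars W" "keys (wt (class_weight Q) m) \<inter> Inl ` T \<noteq> {}" and fin: "finite W"
  shows "single m c \<in> C"
proof -
  obtain v where v: "v \<in> T" "lookup (wt (class_weight Q) m) (Inl v) \<noteq> 0"
    using m(2) by (auto simp: in_keys_iff)
  then have "lookup m (XVar v) + lookup m (YVar v) \<noteq> 0"
    using lookup_class_weight(1)[OF fin m(1), of Q v] by (simp split: if_splits)
  then obtain x where x: "lookup m x \<noteq> 0" "(var_poly x :: ('v edge_var, 'k) mpoly) \<in> C"
    using T v(1) by (metis add_is_0)
  have "m = (m - single x 1) + single x 1"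
    using x(1) by (intro poly_mapping_eqI) (auto simp: lookup_add lookup_minus lookup_single when_def)
  then have "single m c = single (m - single x 1) c * var_poly x"
    unfolding var_poly_def by (metis mult.right_neutral mult_single)
  moreover have "keys (m - single x 1) \<subseteq> gvars W"
    using m(1) by (auto simp: in_keys_iff lookup_minus subset_iff)
  ultimately show ?thesis
    using x(2) by (simp only:) (intro idealD(4)[OF C] poly_ring_closed(9))
qed

text \<open>Two monomials of equal weight have the same total exponent at every vertex and, in every
  class, the same total exponent of the \<open>y\<close>-variables. Hence they are connected by exchanges of
  \<open>x\<^sub>u y\<^sub>v\<close> for \<open>x\<^sub>v y\<^sub>u\<close> within a class, each of which is a binomial of the ideal.\<close>

lemma monomials_of_equal_weight:
  fixes C :: "('v edge_var, 'k::field) mpoly set"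
  assumes C: "ideal C (poly_ring (gvars W))" and fin: "finite W"
    and Q: "equiv (W - T) Q" and QC: "\<And>a b. (a, b) \<in> Q \<Longrightarrow> binom a b \<in> C"
    and m: "keys m \<subseteq> gvars W" "keys m' \<subseteq> gvars W" "wt (class_weight Q) m = wt (class_weight Q) m'"
    and alive: "keys (wt (class_weight Q) m) \<inter> Inl ` T = {}"
  shows "single m 1 - single m' 1 \<in> C"
  using m(1,3) alive
proof (induction "\<Sum>v\<in>W. lookup m (YVar v) - lookup m' (YVar v)" arbitrary: m rule: less_induct)
  case less
  have tot: "lookup m (XVar v) + lookup m (YVar v) = lookup m' (XVar v) + lookup m' (YVar v)"
    if "v \<in> W" for v
    using lookup_class_weight(1)[OF fin less.prems(1), of Q v]
      lookup_class_weight(1)[OF fin m(2), of Q v] that less.prems(2) by simp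
  have cls: "(\<Sum>u\<in>{u \<in> W. Q `` {u} = c}. lookup m (YVar u)) = (\<Sum>u\<in>{u \<in> W. Q `` {u} = c}. lookup m' (YVar u))" for c
    using lookup_class_weight(2)[OF fin less.prems(1), of Q c]
      lookup_class_weight(2)[OF fin m(2), of Q c] less.prems(2) by simp
  show ?case
  proof (cases "\<exists>v\<in>W. lookup m' (YVar v) < lookup m (YVar v)")
    case False
    have y: "lookup m (YVar v) = lookup m' (YVar v)" if v: "v \<in> W" for v
    proof (rule ccontr)
      let ?c = "{u \<in> W. Q `` {u} = Q `` {v}}"
      assume "lookup m (YVar v) \<noteq> lookup m' (YVar v)"
      then have "lookup m (YVar v) < lookup m' (YVar v)" using False v by force
      then have "(\<Sum>u\<in>?c. lookup m (YVar u)) < (\<Sum>u\<in>?c. lookup m' (YVar u))"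
        using fin v False by (intro sum_strict_mono_ex1) (auto simp: not_less)
      then show False using cls[of "Q `` {v}"] by simp
    qed
    have "m = m'"
    proof (rule poly_mapping_eqI)
      fix x
      show "lookup m x = lookup m' x"
      proof (cases "x \<in> gvars W")
        case True
        then obtain v where v: "v \<in> W" "x = XVar v \<or> x = YVar v" by auto
        then show ?thesis using y[OF v(1)] tot[OF v(1)] by auto
      next
        case False
        then have "x \<notin> keys m" "x \<notin> keys m'" using less.prems(1) m(2) by auto
        then show ?thesis by (simp add: not_in_keys_iff_lookup_eq_zero)
      qed
    qed
    then show ?thesis using idealD(2)[OF C] by simp
  next
    case True
    then obtain v where v: "v \<in> W" "lookup m' (YVar v) < lookup m (YVar v)" by auto
    let ?c = "{u \<in> W. Q `` {u} = Q `` {v}}"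
    have "\<exists>u\<in>?c. lookup m (YVar u) < lookup m' (YVar u)"
    proof (rule ccontr)
      assume "\<not> ?thesis"
      then have "(\<Sum>u\<in>?c. lookup m' (YVar u)) < (\<Sum>u\<in>?c. lookup m (YVar u))"
        using fin v by (intro sum_strict_mono_ex1) (auto simp: not_less)
      then show False using cls[of "Q `` {v}"] by simp
    qed
    then obtain u where u: "u \<in> W" "Q `` {u} = Q `` {v}" "lookup m (YVar u) < lookup m' (YVar u)" by auto
    have uv: "u \<noteq> v" using u v by auto
    have "lookup m (XVar u) > 0" using tot[OF u(1)] u(3) by linarith
    have "v \<notin> T"
    proof
      assume "v \<in> T"
      have "Inl v \<in> keys (wt (class_weight Q) m)"
        using v lookup_class_weight(1)[OF fin less.prems(1), of Q v] by (simp add: in_keys_iff)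
      then show False using less.prems(3) \<open>v \<in> T\<close> by blast
    qed
    then have "(v, v) \<in> Q" using Q v by (auto simp: equiv_def refl_on_def)
    then have "(u, v) \<in> Q" using u(2) by auto
    define n where "n = m - (single (XVar u) 1 + single (YVar v) 1)"
    have mn: "m = n + (single (XVar u) 1 + single (YVar v) 1)"
      unfolding n_def using \<open>lookup m (XVar u) > 0\<close> v
      by (intro poly_mapping_eqI) (auto simp: lookup_add lookup_minus lookup_single when_def)
    define k where "k = n + (single (XVar v) 1 + single (YVar u) 1)"
    have nV: "keys n \<subseteq> gvars W" using less.prems(1) mn by (auto simp: keys_add_nat)
    then have kV: "keys k \<subseteq> gvars W" using u v by (auto simp: k_def keys_add_nat)
    have wk: "wt (class_weight Q) k = wt (class_weight Q) m"
      unfolding k_def mn wt_add wt_single class_weight_simps u(2) by (simp add: add_ac)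
    have lk: "lookup k (YVar a) = (if a = u then lookup m (YVar a) + 1 else if a = v then lookup m (YVar a) - 1
        else lookup m (YVar a))" for a
      using uv unfolding k_def mn by (auto simp: lookup_add lookup_single when_def)
    have "(\<Sum>a\<in>W. lookup k (YVar a) - lookup m' (YVar a)) < (\<Sum>a\<in>W. lookup m (YVar a) - lookup m' (YVar a))"
      using fin u v uv by (intro sum_strict_mono_ex1) (auto simp: lk intro!: bexI[of _ v])
    then have "single k 1 - single m' 1 \<in> C"
      using wk less.prems by (intro less.hyps kV) auto
    moreover have "single m 1 - single k 1 = single n 1 * (binom u v :: ('v edge_var, 'k) mpoly)"
      unfolding mn k_def binom_def var_poly_def by (simp add: algebra_simps mult_single)
    then have "single m 1 - (single k 1 :: ('v edge_var, 'k) mpoly) \<in> C"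
      using idealD(4)[OF C poly_ring_closed(9)[OF nV] QC[OF \<open>(u, v) \<in> Q\<close>]] by simp
    ultimately have "(single m 1 - single k 1) + (single k 1 - single m' 1) \<in> C"
      by (intro idealD(3)[OF C])
    then show ?thesis by simp
  qed
qed

text \<open>Modulo the right-hand side every monomial may be replaced by a fixed monomial of the same weight,
  or by zero if its weight involves \<open>T\<close>. After that the coefficients of an element of the kernel add
  up to zero.\<close>

theorem weight_prime_eq_cut_ideal:
  assumes fin: "finite W" and T: "T \<subseteq> W" and Q: "equiv (W - T) Q"
  shows "weight_prime (gvars W) (class_weight Q) (Inl ` T) = (cut_ideal W T Q :: ('v edge_var, 'k::field) mpoly set)"
    (is "?P = ?C")
proof
  let ?w = "class_weight Q" and ?Z = "Inl ` T :: ('v + 'v set) set"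
  have QV: "Q \<subseteq> (W - T) \<times> (W - T)" using Q by (auto simp: equiv_def refl_on_def)
  then have QV': "Q \<subseteq> W \<times> W" by auto
  have C: "ideal ?C (poly_ring (gvars W))" by (rule ideal_cut_ideal[OF T QV'])
  note gens = cut_ideal_gens[OF T QV']
  show "?C \<subseteq> ?P"
  proof (rule cut_ideal_least)
    show "ideal ?P (poly_ring (gvars W))"
      by (rule proper_poly_ideal.ideal[OF prime_proper[OF prime_weight_prime]])
    show "var_poly (XVar v) \<in> ?P" "var_poly (YVar v) \<in> ?P" if "v \<in> T" for v
      using that T by (subst var_mem_weight_prime_iff; auto simp: keys_add_nat)+
    show "binom a b \<in> ?P" if ab: "(a, b) \<in> Q" for a b
    proof -
      have "a \<in> W" "b \<in> W" "a \<notin> T" "b \<notin> T" using ab QV by auto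
      moreover have "Q `` {a} = Q `` {b}" using ab Q by (rule equiv_class_eq[rotated])
      moreover have "(binom a b :: ('v edge_var, 'k) mpoly) \<in> carrier (poly_ring (gvars W))"
        using binom_graded[of a W b] \<open>a \<in> W\<close> \<open>b \<in> W\<close> graded_part_carrier by blast
      ultimately show ?thesis by (simp add: weight_prime_def push_binom)
    qed
  qed
  show "?P \<subseteq> ?C"
  proof
    fix p :: "('v edge_var, 'k) mpoly" assume p: "p \<in> ?P"
    have pV: "keys m \<subseteq> gvars W" if "m \<in> keys p" for m
      using p that by (simp add: weight_prime_def carrier_poly_ring)
    define A where "A = {m \<in> keys p. keys (wt ?w m) \<inter> ?Z = {}}"
    define s where "s \<mu> = (SOME m. m \<in> A \<and> wt ?w m = \<mu>)" for \<mu>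
    have s: "s (wt ?w m) \<in> A \<and> wt ?w (s (wt ?w m)) = wt ?w m" if "m \<in> A" for m
      unfolding s_def by (rule someI_ex) (use that in auto)
    have finA: "finite A" by (simp add: A_def)
    have "(\<Sum>m\<in>keys p - A. single m (lookup p m)) \<in> ?C"
      using pV by (intro idealD(7)[OF C] monomial_of_dead_weight[OF C gens(1,2) _ _ fin, where Q = Q])
        (auto simp: A_def)
    moreover have "(\<Sum>m\<in>A. const_poly (lookup p m) * (single m 1 - single (s (wt ?w m)) 1)) \<in> ?C"
    proof (rule idealD(7)[OF C])
      fix m assume m: "m \<in> A"
      have "(single m 1 - single (s (wt ?w m)) 1 :: ('v edge_var, 'k) mpoly) \<in> ?C"
        using m s[OF m] pV by (intro monomials_of_equal_weight[OF C fin Q gens(3)]) (auto simp: A_def)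
      then show "const_poly (lookup p m) * (single m 1 - single (s (wt ?w m)) 1) \<in> ?C"
        by (intro idealD(4)[OF C] poly_ring_closed)
    qed
    moreover have "(\<Sum>m\<in>A. single (s (wt ?w m)) (lookup p m)) = 0"
    proof -
      have "(\<Sum>m\<in>A. single (s (wt ?w m)) (lookup p m))
          = (\<Sum>\<mu>\<in>wt ?w ` A. \<Sum>m\<in>{m \<in> A. wt ?w m = \<mu>}. single (s (wt ?w m)) (lookup p m))"
        by (rule sum.image_gen[OF finA])
      also have "\<dots> = (\<Sum>\<mu>\<in>wt ?w ` A. single (s \<mu>) (\<Sum>m\<in>{m \<in> A. wt ?w m = \<mu>}. lookup p m))"
      proof (rule sum.cong)
        fix \<mu>
        have "(\<Sum>m\<in>B. single (s \<mu>) (lookup p m)) = single (s \<mu>) (\<Sum>m\<in>B. lookup p m)" for B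
          by (induction B rule: infinite_finite_induct) (auto simp: single_add)
        then show "(\<Sum>m\<in>{m \<in> A. wt ?w m = \<mu>}. single (s (wt ?w m)) (lookup p m))
            = single (s \<mu>) (\<Sum>m\<in>{m \<in> A. wt ?w m = \<mu>}. lookup p m)" by simp
      qed simp
      also have "\<dots> = 0"
      proof (rule sum.neutral, rule ballI)
        fix \<mu> assume \<mu>: "\<mu> \<in> wt ?w ` A"
        then have alive: "keys \<mu> \<inter> ?Z = {}" by (auto simp: A_def)
        have "(\<Sum>m\<in>{m \<in> A. wt ?w m = \<mu>}. lookup p m) = (\<Sum>m\<in>{m \<in> keys p. wt ?w m = \<mu>}. lookup p m)"
          using alive by (intro sum.cong) (auto simp: A_def)
        also have "\<dots> = lookup (push ?w ?Z p) \<mu>"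
          using alive by (subst lookup_push[OF finite_keys subset_refl]) (simp add: sum.inter_filter)
        also have "\<dots> = 0" using p by (simp add: weight_prime_def)
        finally show "single (s \<mu>) (\<Sum>m\<in>{m \<in> A. wt ?w m = \<mu>}. lookup p m) = 0" by simp
      qed
      finally show ?thesis .
    qed
    moreover have "p = (\<Sum>m\<in>keys p - A. single m (lookup p m)) + (\<Sum>m\<in>A. single m (lookup p m))"
    proof -
      have "p = (\<Sum>m\<in>keys p. single m (lookup p m))" by (simp add: sum_single_lookup)
      also have "\<dots> = (\<Sum>m\<in>keys p - A. single m (lookup p m)) + (\<Sum>m\<in>A. single m (lookup p m))"
        by (intro sum.subset_diff) (auto simp: A_def)
      finally show ?thesis .
    qed
    ultimately have "(\<Sum>m\<in>keys p - A. single m (lookup p m))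
        + (\<Sum>m\<in>A. const_poly (lookup p m) * (single m 1 - single (s (wt ?w m)) 1)) \<in> ?C"
      and eq: "p = (\<Sum>m\<in>keys p - A. single m (lookup p m)) + (\<Sum>m\<in>A. single m (lookup p m))
        - (\<Sum>m\<in>A. single (s (wt ?w m)) (lookup p m))"
      using idealD(3)[OF C] by auto
    then show "p \<in> ?C"
      by (subst eq) (simp add: right_diff_distrib const_poly_mult_single sum_subtractf add_diff_eq)
  qed
qed

section \<open>Hilbert series, dimension and multiplicity of the prime of a cut set\<close>

lemma split_sum_le:
  fixes e :: "'v \<Rightarrow> nat"
  assumes "finite c" "k \<le> (\<Sum>v\<in>c. e v)"
  shows "\<exists>b. (\<forall>v. b v \<le> e v) \<and> (\<Sum>v\<in>c. b v) = k"
  using assms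
proof (induction c arbitrary: k rule: finite_induct)
  case empty
  then show ?case by (intro exI[of _ "\<lambda>_. 0"]) auto
next
  case (insert x c)
  then have "k - min k (e x) \<le> (\<Sum>v\<in>c. e v)" by auto
  then obtain b where b: "\<forall>v. b v \<le> e v" "(\<Sum>v\<in>c. b v) = k - min k (e x)"
    using insert.IH by blast
  have "(\<Sum>v\<in>c. (b(x := min k (e x))) v) = (\<Sum>v\<in>c. b v)"
    using insert by (intro sum.cong) auto
  then have "(\<Sum>v\<in>insert x c. (b(x := min k (e x))) v) = k"
    using insert b by simp
  then show ?case using b(1) by (intro exI[of _ "b(x := min k (e x))"]) auto
qed

lemma class_eq_fiber:
  assumes "equiv (W - T) Q" "c \<in> (W - T) // Q"
  shows "{v \<in> W. Q `` {v} = c} = c"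
proof -
  have QA: "Q \<subseteq> (W - T) \<times> (W - T)" using assms(1) by (auto simp: equiv_def refl_on_def)
  obtain u where u: "u \<in> W - T" "c = Q `` {u}" using assms(2) by (auto simp: quotient_def)
  have "u \<in> c" using u assms(1) by (auto simp: equiv_def refl_on_def)
  show ?thesis
  proof (intro equalityI subsetI)
    fix v assume "v \<in> {v \<in> W. Q `` {v} = c}"
    then have "(v, u) \<in> Q" using \<open>u \<in> c\<close> by auto
    then have "(u, v) \<in> Q" using assms(1) by (auto simp: equiv_def sym_def)
    then show "v \<in> c" using u by auto
  next
    fix v assume "v \<in> c"
    then have "(u, v) \<in> Q" using u by auto
    then show "v \<in> {v \<in> W. Q `` {v} = c}"
      using equiv_class_eq[OF assms(1)] u QA by auto
  qed
qed

text \<open>The monomials of the image ring are those in the \<open>t\<close>-variables times a monomial in the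
  \<open>s\<close>-variables, the exponent of the latter at a class being bounded by the total degree of the
  former in this class.\<close>

lemma card_alive_weights:
  assumes fin: "finite W" and T: "T \<subseteq> W" and Q: "equiv (W - T) Q"
  shows "card (wt (class_weight Q) ` {m \<in> mons (gvars W) q. keys (wt (class_weight Q) m) \<inter> Inl ` T = {}})
    = (\<Sum>e\<in>mons (W - T) q. \<Prod>c\<in>(W - T) // Q. 1 + (\<Sum>v\<in>c. lookup e v))"
proof -
  let ?w = "class_weight Q" and ?A = "W - T" and ?C = "(W - T) // Q"
  let ?S = "wt ?w ` {m \<in> mons (gvars W) q. keys (wt ?w m) \<inter> Inl ` T = {}}"
  let ?D = "SIGMA e:mons ?A q. PiE ?C (\<lambda>c. {..\<Sum>v\<in>c. lookup e v})"
  define g :: "('a \<Rightarrow>\<^sub>0 nat) \<times> ('a set \<Rightarrow> nat) \<Rightarrow> ('a + 'a set) \<Rightarrow>\<^sub>0 nat"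
    where "g = (\<lambda>(e, k). (\<Sum>v\<in>?A. single (Inl v) (lookup e v)) + (\<Sum>c\<in>?C. single (Inr c) (k c)))"
  have finA: "finite ?A" using fin by simp
  have QA: "Q \<subseteq> ?A \<times> ?A" using Q by (auto simp: equiv_def refl_on_def)
  have finC: "finite ?C" using QA by (intro finite_quotient finA) auto
  have finc: "finite c" and subc: "c \<subseteq> ?A" if "c \<in> ?C" for c
    using that finA QA finite_subset[of c ?A] in_quotient_imp_subset[OF Q that] by auto
  have lg: "lookup (g (e, k)) (Inl v) = (if v \<in> ?A then lookup e v else 0)"
    "lookup (g (e, k)) (Inr c) = (if c \<in> ?C then k c else 0)" for e k v c
    using finA finC
    by (simp_all add: g_def lookup_add lookup_sum lookup_single when_def del: Diff_iff)
  have "inj_on g ?D"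
  proof (rule inj_onI)
    fix a b assume a: "a \<in> ?D" and b: "b \<in> ?D" and eq: "g a = g b"
    obtain e k where [simp]: "a = (e, k)" by (cases a)
    obtain e' k' where [simp]: "b = (e', k')" by (cases b)
    have "lookup e v = lookup e' v" for v
    proof (cases "v \<in> ?A")
      case True
      then show ?thesis using lg(1)[of e k v] lg(1)[of e' k' v] eq by simp
    next
      case False
      then have "v \<notin> keys e" "v \<notin> keys e'" using a b by (auto simp: mons_def)
      then show ?thesis by (simp add: not_in_keys_iff_lookup_eq_zero)
    qed
    then have "e = e'" by (rule poly_mapping_eqI)
    moreover have "k = k'"
    proof (rule PiE_ext)
      show "k \<in> PiE ?C (\<lambda>c. {..\<Sum>v\<in>c. lookup e v})" using a by simp
      show "k' \<in> PiE ?C (\<lambda>c. {..\<Sum>v\<in>c. lookup e v})" using b \<open>e = e'\<close> by simp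
      show "k c = k' c" if "c \<in> ?C" for c
        using lg(2)[of e k c] lg(2)[of e' k' c] eq that by simp
    qed
    ultimately show "a = b" by simp
  qed
  moreover have "?S = g ` ?D"
  proof (intro equalityI subsetI)
    fix \<mu> assume "\<mu> \<in> ?S"
    then obtain m where m: "m \<in> mons (gvars W) q" "keys (wt ?w m) \<inter> Inl ` T = {}" "\<mu> = wt ?w m" by auto
    have mV: "keys m \<subseteq> gvars W" using m by (simp add: mons_def)
    note lw = lookup_class_weight[OF fin mV, of Q]
    have dead: "lookup m (XVar v) = 0 \<and> lookup m (YVar v) = 0" if "v \<in> T" for v
    proof -
      have "Inl v \<notin> keys (wt ?w m)" using m(2) that by auto
      then have "lookup (wt ?w m) (Inl v) = 0" by (simp add: not_in_keys_iff_lookup_eq_zero)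
      then show ?thesis using lw(1)[of v] that T by (auto split: if_splits)
    qed
    define e where "e = (\<Sum>v\<in>?A. single v (lookup \<mu> (Inl v)))"
    define k where "k = restrict (\<lambda>c. lookup \<mu> (Inr c)) ?C"
    have le: "lookup e v = (if v \<in> ?A then lookup \<mu> (Inl v) else 0)" for v
      using finA by (simp add: e_def lookup_sum lookup_single when_def del: Diff_iff)
    have "monom_degree e = q"
    proof -
      have "monom_degree e = (\<Sum>v\<in>?A. lookup e v)"
        by (intro monom_degree_superset finA) (auto simp: in_keys_iff le split: if_splits)
      also have "\<dots> = (\<Sum>v\<in>?A. lookup m (XVar v) + lookup m (YVar v))"
        by (intro sum.cong) (auto simp: le m(3) lw)
      also have "\<dots> = (\<Sum>v\<in>W. lookup m (XVar v) + lookup m (YVar v))"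
        using fin dead by (intro sum.mono_neutral_left) auto
      also have "\<dots> = monom_degree m"
        using fin mV by (subst monom_degree_superset[of "gvars W"]) (auto simp: sum_gvars sum.distrib)
      finally show ?thesis using m(1) by (simp add: mons_def)
    qed
    moreover have "keys e \<subseteq> ?A" by (auto simp: in_keys_iff le split: if_splits)
    moreover have "k \<in> PiE ?C (\<lambda>c. {..\<Sum>v\<in>c. lookup e v})"
    proof (rule PiE_I)
      fix c assume c: "c \<in> ?C"
      have "k c = (\<Sum>v\<in>c. lookup m (YVar v))"
        using c lw(2)[of c] m(3) class_eq_fiber[OF Q c] by (simp add: k_def)
      also have "\<dots> \<le> (\<Sum>v\<in>c. lookup e v)"
        using subc[OF c] by (intro sum_mono) (auto simp: le m(3) lw)
      finally show "k c \<in> {..\<Sum>v\<in>c. lookup e v}" by simp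
    qed (simp add: k_def)
    ultimately have "(e, k) \<in> ?D" by (simp add: mons_def)
    moreover have "\<mu> = g (e, k)"
    proof (rule poly_mapping_eqI)
      fix t
      show "lookup \<mu> t = lookup (g (e, k)) t"
      proof (cases t)
        case (Inl v)
        have "lookup \<mu> (Inl v) = 0" if "v \<notin> ?A"
          using that dead[of v] by (auto simp: m(3) lw)
        then show ?thesis using Inl by (auto simp: lg le)
      next
        case (Inr c)
        have "lookup \<mu> (Inr c) = 0" if "c \<notin> ?C"
          unfolding m(3) lw
        proof (intro sum.neutral ballI)
          fix v assume v: "v \<in> {v \<in> W. Q `` {v} = c}"
          then have "v \<notin> ?A" using that by (auto simp: quotient_def)
          then show "lookup m (YVar v) = 0" using v dead by auto
        qed
        then show ?thesis using Inr by (auto simp: lg k_def)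
      qed
    qed
    ultimately show "\<mu> \<in> g ` ?D" by blast
  next
    fix \<mu> assume "\<mu> \<in> g ` ?D"
    then obtain e k where ek: "\<mu> = g (e, k)" "e \<in> mons ?A q" "k \<in> PiE ?C (\<lambda>c. {..\<Sum>v\<in>c. lookup e v})"
      by auto
    have "\<forall>c\<in>?C. \<exists>b. (\<forall>v. b v \<le> lookup e v) \<and> (\<Sum>v\<in>c. b v) = k c"
      using ek(3) finc by (intro ballI split_sum_le) auto
    then obtain b where b: "\<And>c v. c \<in> ?C \<Longrightarrow> b c v \<le> lookup e v" "\<And>c. c \<in> ?C \<Longrightarrow> (\<Sum>v\<in>c. b c v) = k c"
      by metis
    \<comment> \<open>The exponent of each \<open>s\<close>-variable is distributed over the \<open>y\<close>-variables of its class.\<close>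
    define y where "y v = b (Q `` {v}) v" for v
    have y: "y v \<le> lookup e v" if "v \<in> ?A" for v
      unfolding y_def using that by (intro b(1) quotientI)
    define m where "m = (\<Sum>v\<in>?A. single (XVar v) (lookup e v - y v)) + (\<Sum>v\<in>?A. single (YVar v) (y v))"
    have lm: "lookup m (XVar v) = (if v \<in> ?A then lookup e v - y v else 0)"
      "lookup m (YVar v) = (if v \<in> ?A then y v else 0)" for v
      using finA by (simp_all add: m_def lookup_add lookup_sum lookup_single when_def del: Diff_iff)
    have mV: "keys m \<subseteq> gvars W"
    proof
      fix x assume "x \<in> keys m"
      then show "x \<in> gvars W" by (cases x) (auto simp: in_keys_iff lm split: if_splits)
    qed
    note lw = lookup_class_weight[OF fin mV, of Q]
    have e0: "lookup e v = 0" if "v \<notin> ?A" for v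
      using ek(2) that by (auto simp: mons_def not_in_keys_iff_lookup_eq_zero[symmetric])
    have "monom_degree m = (\<Sum>v\<in>W. lookup m (XVar v) + lookup m (YVar v))"
      using fin mV by (subst monom_degree_superset[of "gvars W"]) (auto simp: sum_gvars sum.distrib)
    also have "\<dots> = (\<Sum>v\<in>W. lookup e v)"
      using y e0 by (intro sum.cong) (auto simp: lm)
    also have "\<dots> = monom_degree e"
      using ek(2) fin by (subst monom_degree_superset[of W]) (auto simp: mons_def)
    finally have "m \<in> mons (gvars W) q" using ek(2) mV by (simp add: mons_def)
    moreover have "wt ?w m = \<mu>"
    proof (rule poly_mapping_eqI)
      fix t
      show "lookup (wt ?w m) t = lookup \<mu> t"
      proof (cases t)
        case (Inl v)
        then show ?thesis using y[of v] by (auto simp: lw lg lm ek(1))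
      next
        case (Inr c)
        show ?thesis
        proof (cases "c \<in> ?C")
          case True
          have "(\<Sum>v\<in>c. lookup m (YVar v)) = (\<Sum>v\<in>c. b c v)"
          proof (rule sum.cong)
            fix v assume "v \<in> c"
            then have "v \<in> ?A" "Q `` {v} = c"
              using subc[OF True] class_eq_fiber[OF Q True] by auto
            then show "lookup m (YVar v) = b c v" by (simp add: lm y_def)
          qed simp
          then show ?thesis
            using Inr True b(2) class_eq_fiber[OF Q True] by (simp add: lw lg ek(1))
        next
          case False
          have "lookup m (YVar v) = 0" if "Q `` {v} = c" for v
            using that False by (auto simp: lm quotient_def)
          then show ?thesis using Inr False by (simp add: lw lg ek(1))
        qed
      qed
    qed
    moreover have "keys \<mu> \<inter> Inl ` T = {}" by (auto simp: in_keys_iff ek(1) lg split: if_splits)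
    ultimately show "\<mu> \<in> ?S" by (intro image_eqI[of _ _ m]) auto
  qed
  ultimately have "card ?S = card ?D" by (simp add: card_image)
  also have "\<dots> = (\<Sum>e\<in>mons ?A q. card (PiE ?C (\<lambda>c. {..\<Sum>v\<in>c. lookup e v})))"
    using finA finC by (intro card_SigmaI) (auto simp: finite_mons finite_PiE)
  also have "\<dots> = (\<Sum>e\<in>mons ?A q. \<Prod>c\<in>?C. 1 + (\<Sum>v\<in>c. lookup e v))"
    using finC by (intro sum.cong) (simp_all add: card_PiE)
  finally show ?thesis .
qed

text \<open>The sum over \<open>e\<close> is \<open>q + 1\<close> times the number of monomials of degree \<open>q\<close> in \<open>m\<close> variables, whose
  series is the derivative of \<open>z (1 - z)\<^sup>-\<^sup>m\<close>.\<close>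

lemma single_class_series:
  assumes "finite c" "c \<noteq> {}"
  shows "gen_fun (\<lambda>q. \<Sum>e\<in>mons c q. 1 + (\<Sum>v\<in>c. lookup e v)) * (1 - fps_X) ^ Suc (card c)
    = fps_of_poly [:1, of_nat (card c) - 1:]"
proof -
  let ?F = "gen_fun (\<lambda>q. card (mons c q))"
  obtain k where k: "card c = Suc k" using assms by (metis card_eq_0_iff not0_implies_Suc)
  have F: "?F * (1 - fps_X) ^ Suc k = 1" using gen_fun_card_mons[OF assms(1)] k by simp
  have "(\<Sum>e\<in>mons c q. 1 + (\<Sum>v\<in>c. lookup e v)) = (q + 1) * card (mons c q)" for q
  proof -
    have "(\<Sum>e\<in>mons c q. 1 + (\<Sum>v\<in>c. lookup e v)) = (\<Sum>e\<in>mons c q. 1 + q)"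
      using assms monom_degree_superset[of c] by (intro sum.cong) (auto simp: mons_def)
    then show ?thesis by simp
  qed
  then have "gen_fun (\<lambda>q. \<Sum>e\<in>mons c q. 1 + (\<Sum>v\<in>c. lookup e v)) = fps_deriv (fps_X * ?F)"
    by (intro fps_ext) (simp add: gen_fun_def algebra_simps)
  also have "\<dots> = ?F + fps_X * fps_deriv ?F" by simp
  finally have G: "gen_fun (\<lambda>q. \<Sum>e\<in>mons c q. 1 + (\<Sum>v\<in>c. lookup e v)) = ?F + fps_X * fps_deriv ?F" .
  have "fps_deriv ((1 - fps_X) ^ Suc k :: rat fps) = - of_nat (Suc k) * (1 - fps_X) ^ k"
    by (subst fps_deriv_power) (simp add: fps_of_nat del: of_nat_Suc)
  moreover have "fps_deriv (?F * (1 - fps_X) ^ Suc k) = 0" unfolding F by simp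
  ultimately have "?F * (- of_nat (Suc k) * (1 - fps_X) ^ k) + fps_deriv ?F * ((1 - fps_X) * (1 - fps_X) ^ k) = 0"
    by (simp only: fps_deriv_mult power_Suc)
  moreover have "p * (b * x) = p * (n * a)" if "a * (- n * p) + b * (x * p) = 0" for a b p n x :: "rat fps"
    using that by (simp add: algebra_simps eq_neg_iff_add_eq_0)
  ultimately have "(1 - fps_X) ^ k * (fps_deriv ?F * (1 - fps_X)) = (1 - fps_X) ^ k * (of_nat (Suc k) * ?F)"
    by blast
  moreover have "(1 - fps_X :: rat fps) ^ k \<noteq> 0"
    by (metis F mult_zero_right power_Suc2 mult_zero_left zero_neq_one)
  ultimately have D: "fps_deriv ?F * (1 - fps_X) = of_nat (Suc k) * ?F" by (simp only: mult_cancel_left) simp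
  have "(?F + fps_X * fps_deriv ?F) * (1 - fps_X) ^ Suc (Suc k)
      = (?F * (1 - fps_X) ^ Suc k) * (1 - fps_X) + fps_X * (fps_deriv ?F * (1 - fps_X)) * (1 - fps_X) ^ Suc k"
    by (simp add: algebra_simps)
  also have "\<dots> = (?F * (1 - fps_X) ^ Suc k) * (1 - fps_X) + fps_X * of_nat (Suc k) * (?F * (1 - fps_X) ^ Suc k)"
    unfolding D by (simp only: mult_ac)
  also have "\<dots> = 1 - fps_X + fps_X * of_nat (Suc k)" unfolding F by simp
  also have "\<dots> = fps_of_poly [:1, of_nat (Suc k) - 1:]"
    by (simp add: fps_of_poly_pCons fps_of_nat algebra_simps)
  finally show ?thesis unfolding G k .
qed

lemma class_family_series:
  assumes "finite C" "\<And>c. c \<in> C \<Longrightarrow> finite c \<and> c \<noteq> {}" "pairwise disjnt C"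
  shows "gen_fun (\<lambda>q. \<Sum>e\<in>mons (\<Union>C) q. \<Prod>c\<in>C. 1 + (\<Sum>v\<in>c. lookup e v)) * (1 - fps_X) ^ (card (\<Union>C) + card C)
    = fps_of_poly (\<Prod>c\<in>C. [:1, of_nat (card c) - 1:])"
  using assms
proof (induction C rule: finite_induct)
  case empty
  have "gen_fun (\<lambda>q. \<Sum>e\<in>mons {} q. 1) = 1"
    by (rule fps_ext) (auto simp: gen_fun_def mons_empty)
  then show ?case by simp
next
  case (insert c C)
  have disj: "c \<inter> \<Union>C = {}" using insert.prems(2) insert.hyps(2) by (auto simp: pairwise_def disjnt_def)
  have fin: "finite c" "finite (\<Union>C)" using insert by auto
  have "gen_fun (\<lambda>q. \<Sum>e\<in>mons (c \<union> \<Union>C) q. \<Prod>c\<in>insert c C. 1 + (\<Sum>v\<in>c. lookup e v))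
      = gen_fun (\<lambda>q. \<Sum>e\<in>mons c q. 1 + (\<Sum>v\<in>c. lookup e v))
        * gen_fun (\<lambda>q. \<Sum>e\<in>mons (\<Union>C) q. \<Prod>c\<in>C. 1 + (\<Sum>v\<in>c. lookup e v))"
  proof (rule gen_fun_disjoint_union[OF fin disj])
    fix a b :: "'a \<Rightarrow>\<^sub>0 nat" assume a: "keys a \<subseteq> c" and b: "keys b \<subseteq> \<Union>C"
    have "lookup b v = 0" if "v \<in> c" for v
      using b disj that by (auto simp: not_in_keys_iff_lookup_eq_zero[symmetric])
    then have "(\<Sum>v\<in>c. lookup (a + b) v) = (\<Sum>v\<in>c. lookup a v)" by (simp add: lookup_add)
    moreover have "(\<Sum>v\<in>c'. lookup (a + b) v) = (\<Sum>v\<in>c'. lookup b v)" if "c' \<in> C" for c'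
    proof (rule sum.cong)
      fix v assume "v \<in> c'"
      then have "v \<notin> keys a" using a disj that by auto
      then show "lookup (a + b) v = lookup b v"
        by (simp add: lookup_add not_in_keys_iff_lookup_eq_zero)
    qed simp
    ultimately show "(\<Prod>c\<in>insert c C. 1 + (\<Sum>v\<in>c. lookup (a + b) v))
        = (1 + (\<Sum>v\<in>c. lookup a v)) * (\<Prod>c\<in>C. 1 + (\<Sum>v\<in>c. lookup b v))"
      using insert.hyps by simp
  qed
  moreover have "card (\<Union>(insert c C)) + card (insert c C) = Suc (card c) + (card (\<Union>C) + card C)"
    using insert.hyps fin disj by (simp add: card_Un_disjoint)
  ultimately have "gen_fun (\<lambda>q. \<Sum>e\<in>mons (\<Union>(insert c C)) q. \<Prod>c\<in>insert c C. 1 + (\<Sum>v\<in>c. lookup e v))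
        * (1 - fps_X) ^ (card (\<Union>(insert c C)) + card (insert c C))
      = (gen_fun (\<lambda>q. \<Sum>e\<in>mons c q. 1 + (\<Sum>v\<in>c. lookup e v)) * (1 - fps_X) ^ Suc (card c))
        * (gen_fun (\<lambda>q. \<Sum>e\<in>mons (\<Union>C) q. \<Prod>c\<in>C. 1 + (\<Sum>v\<in>c. lookup e v))
          * (1 - fps_X) ^ (card (\<Union>C) + card C))"
    by (simp only: power_add Union_insert mult_ac)
  also have "\<dots> = fps_of_poly [:1, of_nat (card c) - 1:] * fps_of_poly (\<Prod>c\<in>C. [:1, of_nat (card c) - 1:])"
    using insert by (subst single_class_series, simp, simp, subst insert.IH) (auto simp: pairwise_def disjnt_def)
  also have "\<dots> = fps_of_poly (\<Prod>c\<in>insert c C. [:1, of_nat (card c) - 1:])"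
    using insert.hyps by (simp add: fps_of_poly_mult)
  finally show ?case .
qed

theorem hilbert_series_class_ideal:
  assumes fin: "finite W" and T: "T \<subseteq> W" and Q: "equiv (W - T) Q"
  shows "hilbert_series (hilbert_function (gvars W) (cut_ideal W T Q :: ('v edge_var, 'k::field) mpoly set))
    (card (W - T) + card ((W - T) // Q)) (\<Prod>c\<in>(W - T) // Q. [:1, of_nat (card c) - 1:])"
proof -
  let ?A = "W - T" and ?C = "(W - T) // Q"
  have QA: "Q \<subseteq> ?A \<times> ?A" using Q by (auto simp: equiv_def refl_on_def)
  have un: "\<Union>?C = ?A" using Q by (rule Union_quotient)
  have C: "finite ?C" "pairwise disjnt ?C"
    using fin QA quotient_disj[OF Q] by (auto simp: pairwise_def disjnt_def intro!: finite_quotient)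
  have ne: "finite c \<and> c \<noteq> {}" if "c \<in> ?C" for c
    using that in_quotient_imp_subset[OF Q that] in_quotient_imp_non_empty[OF Q that] fin
    by (auto intro: finite_subset)
  have "hilbert_function (gvars W) (cut_ideal W T Q :: ('v edge_var, 'k) mpoly set)
      = (\<lambda>q. \<Sum>e\<in>mons (\<Union>?C) q. \<Prod>c\<in>?C. 1 + (\<Sum>v\<in>c. lookup e v))"
    unfolding weight_prime_eq_cut_ideal[OF assms, symmetric] un
    by (rule ext, subst hilbert_function_weight_prime) (auto simp: fin card_alive_weights[OF assms])
  then show ?thesis
    using class_family_series[OF C(1) ne C(2)] by (simp only: hilbert_series_def un)
qed

lemma numerator_at_1: "poly (\<Prod>c\<in>C. [:1, of_nat (card c) - 1:]) 1 = (\<Prod>c\<in>C. of_nat (card c) :: rat)"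
  by (simp add: poly_prod)

text \<open>First the \<open>s\<close>-variables are killed, then the \<open>t\<close>-variables. In this order each of them occurs in
  the weight of a surviving variable, \<open>y\<^sub>v\<close> in the first phase and \<open>x\<^sub>v\<close> in the second one.\<close>

lemma class_ideal_chain:
  assumes fin: "finite W" and T: "T \<subseteq> W" and Q: "equiv (W - T) Q"
  shows "\<exists>P. prime_chain (gvars W) (cut_ideal W T Q :: ('v edge_var, 'k::field) mpoly set)
    (card (W - T) + card ((W - T) // Q)) P"
proof -
  let ?A = "W - T" and ?C = "(W - T) // Q"
  have QA: "Q \<subseteq> ?A \<times> ?A" using Q by (auto simp: equiv_def refl_on_def)
  have "finite ?C" using fin QA by (intro finite_quotient) auto
  then obtain cs where cs: "set cs = ?C" "distinct cs" using finite_distinct_list by blast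
  obtain vs where vs: "set vs = ?A" "distinct vs" using fin finite_distinct_list[of ?A] by blast
  define zs where "zs = map Inr cs @ map Inl vs"
  have dist: "distinct zs" using cs vs by (auto simp: zs_def distinct_map inj_on_def)
  have len: "length zs = card ?A + card ?C"
    using distinct_card[OF cs(2)] distinct_card[OF vs(2)] cs vs by (simp add: zs_def)
  have step: "\<exists>x\<in>gvars W. zs ! i \<in> keys (class_weight Q x) \<and>
      keys (class_weight Q x) \<inter> (Inl ` T \<union> (!) zs ` {..<i}) = {}" if i: "i < length zs" for i
  proof -
    have new: "zs ! i \<noteq> zs ! j" if "j < i" for j
      using dist i that by (simp add: nth_eq_iff_index_eq)
    show ?thesis
    proof (cases "i < length cs")
      case True
      have "cs ! i \<in> ?C" using nth_mem[OF True] unfolding cs(1) .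
      then obtain v where v: "v \<in> ?A" "cs ! i = Q `` {v}" by (elim quotientE)
      have early: "zs ! j = Inr (cs ! j)" if "j \<le> i" for j
        using that True by (simp add: zs_def nth_append)
      have "keys (class_weight Q (YVar v)) = {Inl v, zs ! i}"
        using early[of i] v(2) by (auto simp: keys_add_nat)
      moreover have "Inl v \<notin> (!) zs ` {..<i}"
      proof
        assume "Inl v \<in> (!) zs ` {..<i}"
        then obtain j where "j < i" "Inl v = zs ! j" by auto
        then show False using early[of j] by simp
      qed
      moreover have "zs ! i \<notin> (!) zs ` {..<i}" using new by auto
      moreover have "zs ! i \<notin> Inl ` T" using early[of i] by auto
      ultimately show ?thesis
        using v(1) by (intro bexI[of _ "YVar v"]) auto
    next
      case False
      let ?v = "vs ! (i - length cs)"
      have z: "zs ! i = Inl ?v" and "i - length cs < length vs"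
        using i False by (auto simp: zs_def nth_append)
      then have v: "?v \<in> ?A" using nth_mem vs(1) by metis
      have "keys (class_weight Q (XVar ?v)) = {zs ! i}" using z by simp
      moreover have "zs ! i \<notin> Inl ` T" using z v by auto
      ultimately show ?thesis
        using v new by (intro bexI[of _ "XVar ?v"]) auto
    qed
  qed
  have "prime_chain (gvars W) (weight_prime (gvars W) (class_weight Q) (Inl ` T) :: ('v edge_var, 'k) mpoly set)
      (length zs) (\<lambda>i. weight_prime (gvars W) (class_weight Q) (Inl ` T \<union> (!) zs ` {..<i}))"
    by (rule weight_prime_chain[OF step])
  then show ?thesis
    unfolding weight_prime_eq_cut_ideal[OF assms] len by blast
qed

lemma prime_class_ideal:
  assumes "finite W" "T \<subseteq> W" "equiv (W - T) Q"
  shows "primeideal (cut_ideal W T Q :: ('v edge_var, 'k::field) mpoly set) (poly_ring (gvars W))"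
  using prime_weight_prime[of "gvars W" "class_weight Q" "Inl ` T"]
  unfolding weight_prime_eq_cut_ideal[OF assms] .

lemma var_mem_class_ideal_iff:
  assumes "finite W" "T \<subseteq> W" "equiv (W - T) Q" "v \<in> W"
  shows "var_poly (XVar v) \<in> (cut_ideal W T Q :: ('v edge_var, 'k::field) mpoly set) \<longleftrightarrow> v \<in> T"
  unfolding weight_prime_eq_cut_ideal[OF assms(1-3), symmetric]
  using assms(4) by (subst var_mem_weight_prime_iff) auto

lemma binom_mem_class_ideal_iff:
  assumes fin: "finite W" and T: "T \<subseteq> W" and Q: "equiv (W - T) Q" and ab: "a \<in> W - T" "b \<in> W - T"
  shows "binom a b \<in> (cut_ideal W T Q :: ('v edge_var, 'k::field) mpoly set) \<longleftrightarrow> (a, b) \<in> Q"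
proof
  have QW: "Q \<subseteq> W \<times> W" using Q by (auto simp: equiv_def refl_on_def)
  show "binom a b \<in> cut_ideal W T Q" if "(a, b) \<in> Q"
    using cut_ideal_gens(3)[OF T QW that] .
  assume "binom a b \<in> (cut_ideal W T Q :: ('v edge_var, 'k) mpoly set)"
  then have p0: "push (class_weight Q) (Inl ` T) (binom a b :: ('v edge_var, 'k) mpoly) = 0"
    unfolding weight_prime_eq_cut_ideal[OF fin T Q, symmetric] by (simp add: weight_prime_def)
  have ab': "a \<notin> T" "b \<notin> T" using ab by auto
  have "single (single (Inl a) (1::nat) + (single (Inl b) 1 + single (Inr (Q `` {b})) 1)) (1 :: 'k)
      - single (single (Inl a) (1::nat) + (single (Inl b) 1 + single (Inr (Q `` {a})) 1)) 1 = 0"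
    using p0 unfolding push_binom[OF ab'] .
  then have "single (single (Inl a) (1::nat) + (single (Inl b) 1 + single (Inr (Q `` {b})) 1)) (1 :: 'k)
      = single (single (Inl a) (1::nat) + (single (Inl b) 1 + single (Inr (Q `` {a})) 1)) 1"
    unfolding right_minus_eq .
  then have "keys (single (single (Inl a) (1::nat) + (single (Inl b) 1 + single (Inr (Q `` {b})) 1)) (1 :: 'k))
      = keys (single (single (Inl a) (1::nat) + (single (Inl b) 1 + single (Inr (Q `` {a})) 1)) (1 :: 'k))"
    by (rule arg_cong)
  then have "single (Inr (Q `` {b})) (1::nat) = single (Inr (Q `` {a}) :: 'v + 'v set) 1"
    by (simp only: keys_single) auto
  then have "keys (single (Inr (Q `` {b})) (1::nat)) = keys (single (Inr (Q `` {a}) :: 'v + 'v set) (1::nat))"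
    by (rule arg_cong)
  then have "Q `` {b} = Q `` {a}" by simp
  then show "(a, b) \<in> Q" using eq_equiv_class[of Q b a] Q ab by (auto simp: equiv_def sym_def)
qed

lemma growth_of_series:
  assumes "hilbert_series f D p" "D \<le> Suc e"
  shows "\<exists>C. \<forall>q. f q \<le> C * (q + 1) ^ e"
proof -
  have "(1 - fps_X :: rat fps) ^ Suc e = (1 - fps_X) ^ D * (1 - fps_X) ^ (Suc e - D)"
    using assms(2) by (metis le_add_diff_inverse power_add)
  then have "gen_fun f * (1 - fps_X) ^ Suc e = fps_of_poly p * (1 - fps_X) ^ (Suc e - D)"
    using assms(1) by (simp only: hilbert_series_def mult.assoc[symmetric])
  also have "\<dots> = fps_of_poly (p * [:1, - 1:] ^ (Suc e - D))"
  proof -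
    have "fps_of_poly [:1, - 1:] = (1 - fps_X :: rat fps)" by (simp add: fps_of_poly_pCons)
    then show ?thesis by (simp only: fps_of_poly_mult fps_of_poly_power)
  qed
  finally have "hilbert_series f (Suc e) (p * [:1, - 1:] ^ (Suc e - D))" by (simp add: hilbert_series_def)
  then obtain h where h: "\<forall>\<^sub>F q in sequentially. of_nat (f q) = poly h (of_nat q)" "degree h \<le> e"
    "poly.coeff h e = poly (p * [:1, - 1:] ^ (Suc e - D)) 1 / fact e"
    by (rule hilbert_polynomial_of_series)
  then show ?thesis by (intro growth_of_poly)
qed

section \<open>The primes over a binomial edge ideal\<close>

lemma path_products:
  fixes I :: "('v edge_var, 'k::field) mpoly set"
  assumes I: "ideal I (poly_ring (gvars W))" and W: "a \<in> W" "b \<in> W"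
    and "binom a c \<in> I" "binom c b \<in> I"
  shows "binom a b * var_poly (XVar c) \<in> I" "binom a b * var_poly (YVar c) \<in> I"
proof -
  have "binom a b * var_poly (XVar c) = var_poly (XVar a) * binom c b + var_poly (XVar b) * (binom a c :: ('v edge_var, 'k) mpoly)"
    by (simp add: binom_def algebra_simps)
  then show "binom a b * var_poly (XVar c) \<in> I"
    using assms by (simp only:) (intro idealD(3,4)[OF I] var_carrier)
  have "binom a b * var_poly (YVar c) = var_poly (YVar a) * binom c b + var_poly (YVar b) * (binom a c :: ('v edge_var, 'k) mpoly)"
    by (simp add: binom_def algebra_simps)
  then show "binom a b * var_poly (YVar c) \<in> I"
    using assms by (simp only:) (intro idealD(3,4)[OF I] var_carrier)
qed

lemma con_add_edge:
  assumes "sym E" "a \<in> W - T" "b \<in> W - T" "c \<in> W - T" "(a, c) \<in> E" "(c, b) \<in> E"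
  shows "con W T (E \<union> {(a, b), (b, a)}) = con W T E"
proof
  have eq: "equiv (W - T) (con W T E)" by (rule con_equiv[OF assms(1)])
  have "(a, c) \<in> con W T E" "(c, b) \<in> con W T E" using assms by (auto intro: con_edge)
  then have ab: "(a, b) \<in> con W T E" using eq by (meson equivE transD)
  then have "(b, a) \<in> con W T E" using eq by (meson equivE symD)
  then show "con W T (E \<union> {(a, b), (b, a)}) \<subseteq> con W T E"
    using ab con_edge[of _ _ E W T] by (intro con_minimal[OF eq]) auto
qed (rule con_mono, blast)

text \<open>Under this closure condition the components are complete graphs.\<close>

lemma cut_ideal_con_eq:
  assumes "sym E" "T \<subseteq> W" "E \<subseteq> W \<times> W"
    and closed: "\<And>a b c. a \<in> W - T \<Longrightarrow> b \<in> W - T \<Longrightarrow> c \<in> W - T \<Longrightarrow> (a, c) \<in> E \<Longrightarrow> (c, b) \<in> E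
      \<Longrightarrow> a \<noteq> b \<Longrightarrow> (a, b) \<in> E"
  shows "cut_ideal W T (con W T E) = cut_ideal W T E"
proof
  let ?Q = "Restr E (W - T) \<union> Id_on (W - T)"
  have "equiv (W - T) ?Q"
  proof (rule equivI)
    show "sym ?Q" using assms(1) by (auto simp: sym_def)
    show "trans ?Q" using closed by (intro transI) blast
  qed (auto simp: refl_on_def)
  then have "con W T E \<subseteq> ?Q" by (rule con_minimal) auto
  then have con: "binom a b \<in> cut_ideal W T E" if "(a, b) \<in> con W T E" for a b
  proof (cases "a = b")
    case True
    then show ?thesis using idealD(2)[OF ideal_cut_ideal[OF assms(2,3)]] by simp
  next
    case False
    then have "(a, b) \<in> E" using that \<open>con W T E \<subseteq> ?Q\<close> by blast
    then show ?thesis by (rule cut_ideal_gens(3)[OF assms(2,3)])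
  qed
  show "cut_ideal W T (con W T E) \<subseteq> cut_ideal W T E"
    by (rule cut_ideal_least[OF ideal_cut_ideal[OF assms(2,3)] cut_ideal_gens(1)[OF assms(2,3)]
          cut_ideal_gens(2)[OF assms(2,3)] con])
qed (rule cut_ideal_le_con[OF assms(2,3)])

text \<open>If \<open>c\<close> is a common neighbour of the vertices \<open>a\<close> and \<open>b\<close>, then the product of their
  binomial with each variable of \<open>c\<close> lies in the ideal. So a prime over the ideal allows one
  either to add the edge \<open>a b\<close>, which does not change the components, or to delete \<open>c\<close>. This
  goes on until all components are complete.\<close>

theorem prime_contains_cut_prime:
  fixes P :: "('v edge_var, 'k::field) mpoly set"
  assumes fin: "finite W" and P: "primeideal P (poly_ring (gvars W))"
    and "sym E" "E \<subseteq> W \<times> W" "T \<subseteq> W" "cut_ideal W T E \<subseteq> P"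
  shows "\<exists>T'\<subseteq>W. cut_ideal W T' (con W T' E) \<subseteq> P"
  using assms(3-)
proof (induction "card (W - T) + card (W \<times> W - E)" arbitrary: T E rule: less_induct)
  case less
  note E = less.prems(1,2) and T = less.prems(3) and TP = less.prems(4)
  have I: "ideal P (poly_ring (gvars W))"
    by (rule proper_poly_ideal.ideal[OF prime_proper[OF P]])
  note gens = cut_ideal_gens[OF T E(2)]
  note gensP = subsetD[OF TP gens(1)] subsetD[OF TP gens(2)] subsetD[OF TP gens(3)]
  show ?case
  proof (cases "\<exists>a\<in>W - T. \<exists>b\<in>W - T. \<exists>c\<in>W - T. (a, c) \<in> E \<and> (c, b) \<in> E \<and> a \<noteq> b \<and> (a, b) \<notin> E")
    case False
    have "cut_ideal W T (con W T E) = (cut_ideal W T E :: ('v edge_var, 'k) mpoly set)"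
      by (rule cut_ideal_con_eq[OF E(1) T E(2)]) (use False in blast)
    then show ?thesis using TP T by auto
  next
    case True
    then obtain a b c where abc: "a \<in> W - T" "b \<in> W - T" "c \<in> W - T" "(a, c) \<in> E" "(c, b) \<in> E"
      "a \<noteq> b" "(a, b) \<notin> E" by blast
    have pr: "p \<in> P \<or> r \<in> P" if "p * r \<in> P" "p \<in> carrier (poly_ring (gvars W))" "r \<in> carrier (poly_ring (gvars W))" for p r
      using P that by (auto simp: primeideal_poly_ring_iff)
    have bc: "(binom a b :: ('v edge_var, 'k) mpoly) \<in> carrier (poly_ring (gvars W))"
      using binom_graded[of a W b] graded_part_carrier abc by blast
    have "binom a c \<in> P" "binom c b \<in> P" using gensP(3) abc by auto
    then have "binom a b * var_poly (XVar c) \<in> P" "binom a b * var_poly (YVar c) \<in> P"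
      using path_products[OF I, of a b c] abc by auto
    then consider "binom a b \<in> P" | "var_poly (XVar c) \<in> P" "var_poly (YVar c) \<in> P"
      using pr bc var_carrier[of c W] abc(3) by (metis DiffD1)
    then show ?thesis
    proof cases
      case 1
      let ?E = "E \<union> {(a, b), (b, a)}"
      have E': "sym ?E" "?E \<subseteq> W \<times> W" using E abc by (auto simp: sym_def)
      have "W \<times> W - ?E \<subset> W \<times> W - E" using abc by auto
      then have "card (W \<times> W - ?E) < card (W \<times> W - E)" using fin by (intro psubset_card_mono) auto
      moreover have "binom b a \<in> P" using idealD(5)[OF I 1] by (simp add: binom_commute[of a b])
      then have "cut_ideal W T ?E \<subseteq> P"
        using 1 gensP by (intro cut_ideal_least[OF I]) auto
      ultimately obtain T' where T': "T' \<subseteq> W" "cut_ideal W T' (con W T' ?E) \<subseteq> P"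
        using less.hyps[of T ?E] E' T by auto
      have "con W T' ?E \<subseteq> W \<times> W" using con_subset by blast
      then have "cut_ideal W T' (con W T' E) \<subseteq> cut_ideal W T' (con W T' ?E)"
        using T'(1) by (intro cut_ideal_mono con_mono) auto
      then show ?thesis using T' by blast
    next
      case 2
      have "W - insert c T \<subset> W - T" using abc by auto
      then have "card (W - insert c T) < card (W - T)" using fin by (intro psubset_card_mono) auto
      moreover have "cut_ideal W (insert c T) E \<subseteq> P"
        using 2 gensP by (intro cut_ideal_least[OF I]) auto
      ultimately show ?thesis using less.hyps[of "insert c T" E] E T abc by auto
    qed
  qed
qed

text \<open>The Krull dimension of the quotient by the prime of \<open>T\<close>.\<close>

definition cut_dim :: "'v set \<Rightarrow> 'v set \<Rightarrow> 'v rel \<Rightarrow> nat" where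
  "cut_dim W T E = card (W - T) + card ((W - T) // con W T E)"

lemma card_quotient_antimono:
  assumes "finite A" "equiv A Q" "equiv A Q'" "Q \<subseteq> Q'"
  shows "card (A // Q') \<le> card (A // Q)"
proof (rule surj_card_le[where f = "\<lambda>c. Q' `` c"])
  have "Q \<subseteq> A \<times> A" using assms(2) by (auto simp: equiv_def refl_on_def)
  then show "finite (A // Q)" using assms(1) by (intro finite_quotient)
  show "A // Q' \<subseteq> (\<lambda>c. Q' `` c) ` (A // Q)"
  proof
    fix c assume "c \<in> A // Q'"
    then obtain x where x: "x \<in> A" "c = Q' `` {x}" by (elim quotientE)
    have "Q' `` (Q `` {x}) = Q' `` {x}"
    proof
      show "Q' `` (Q `` {x}) \<subseteq> Q' `` {x}"
        using assms(3,4) by (auto simp: equiv_def trans_def)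
      have "(x, x) \<in> Q" using assms(2) x by (auto simp: equiv_def refl_on_def)
      then show "Q' `` {x} \<subseteq> Q' `` (Q `` {x})" by auto
    qed
    then show "c \<in> (\<lambda>c. Q' `` c) ` (A // Q)"
      using x(2) quotientI[OF x(1), of Q] by (intro image_eqI[of _ _ "Q `` {x}"]) simp_all
  qed
qed

lemma finite_gvars: "finite W \<Longrightarrow> finite (gvars W)"
  by simp

lemma con_subset_W: "con W T E \<subseteq> W \<times> W"
  using con_subset by blast

lemma proper_cut_ideal:
  assumes "finite W" "sym E" "E \<subseteq> W \<times> W" "T \<subseteq> W"
  shows "1 \<notin> (cut_ideal W T E :: ('v edge_var, 'k::field) mpoly set)"
proof -
  have "1 \<notin> (cut_ideal W T (con W T E) :: ('v edge_var, 'k) mpoly set)"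
    using prime_class_ideal[OF assms(1,4) con_equiv[OF assms(2)]] prime_proper proper_poly_ideal.proper
    by blast
  then show ?thesis using cut_ideal_le_con[OF assms(4,3)] by blast
qed

text \<open>The same dichotomy bounds the Hilbert function: passing from \<open>E\<close> to \<open>E\<close> with the new edge
  costs at most the Hilbert function of the ideal with \<open>c\<close> deleted, shifted by the degree of the
  binomial. The prime of \<open>T\<close> is met exactly once; everything else belongs to larger sets, for which
  the bound on the dimension makes the Hilbert function grow at most like the \<open>e\<close>-th power of \<open>q\<close>.\<close>

theorem hilbert_function_cut_ideal_le:
  assumes fin: "finite W" and "sym E" "E \<subseteq> W \<times> W" "T \<subseteq> W"
    and "\<And>T'. T \<subset> T' \<Longrightarrow> T' \<subseteq> W \<Longrightarrow> cut_dim W T' E \<le> Suc e"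
  shows "\<exists>C. \<forall>q. hilbert_function (gvars W) (cut_ideal W T E :: ('v edge_var, 'k::field) mpoly set) q
    \<le> hilbert_function (gvars W) (cut_ideal W T (con W T E) :: ('v edge_var, 'k) mpoly set) q + C * (q + 1) ^ e"
  using assms(2-)
proof (induction "card (W - T) + card (W \<times> W - E)" arbitrary: T E rule: less_induct)
  case less
  let ?H = "\<lambda>I :: ('v edge_var, 'k) mpoly set. hilbert_function (gvars W) I"
  note E = less.prems(1,2) and T = less.prems(3) and dim = less.prems(4)
  let ?I = "cut_ideal W T E :: ('v edge_var, 'k) mpoly set"
  have I: "ideal ?I (poly_ring (gvars W))" by (rule ideal_cut_ideal[OF T E(2)])
  note gens = cut_ideal_gens[OF T E(2)]
  show ?case
  proof (cases "\<exists>a\<in>W - T. \<exists>b\<in>W - T. \<exists>c\<in>W - T. (a, c) \<in> E \<and> (c, b) \<in> E \<and> a \<noteq> b \<and> (a, b) \<notin> E")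
    case False
    have "cut_ideal W T (con W T E) = ?I"
      by (rule cut_ideal_con_eq[OF E(1) T E(2)]) (use False in blast)
    then show ?thesis by auto
  next
    case True
    then obtain a b c where abc: "a \<in> W - T" "b \<in> W - T" "c \<in> W - T" "(a, c) \<in> E" "(c, b) \<in> E"
      "a \<noteq> b" "(a, b) \<notin> E" by blast
    let ?E = "E \<union> {(a, b), (b, a)}" and ?T = "insert c T"
    let ?J = "cut_ideal W T ?E :: ('v edge_var, 'k) mpoly set"
    let ?I' = "cut_ideal W ?T E :: ('v edge_var, 'k) mpoly set"
    let ?f = "binom a b :: ('v edge_var, 'k) mpoly"
    have E': "sym ?E" "?E \<subseteq> W \<times> W" using E abc by (auto simp: sym_def)
    have T': "?T \<subseteq> W" using T abc by auto
    have J: "ideal ?J (poly_ring (gvars W))" by (rule ideal_cut_ideal[OF T E'(2)])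
    have I': "ideal ?I' (poly_ring (gvars W))" by (rule ideal_cut_ideal[OF T' E(2)])
    have f: "?f \<in> graded_part (gvars W) 2" using abc by (intro binom_graded) auto
    then have fc: "?f \<in> carrier (poly_ring (gvars W))" using graded_part_carrier by blast
    have conE: "con W T ?E = con W T E" using abc by (intro con_add_edge[OF E(1)]) auto
    have IJ: "\<exists>i\<in>?I. \<exists>g\<in>carrier (poly_ring (gvars W)). p = i + ?f * g" if "p \<in> ?J" for p
    proof -
      let ?K = "{i + ?f * g | i g. i \<in> ?I \<and> g \<in> carrier (poly_ring (gvars W))}"
      have IK: "i \<in> ?K" if "i \<in> ?I" for i
        using that poly_ring_closed(1)[of "gvars W"] by force
      have "ideal ?K (poly_ring (gvars W))"
        unfolding ideal_poly_ring_iff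
      proof (intro conjI ballI)
        show "?K \<subseteq> carrier (poly_ring (gvars W))"
          using idealD(1)[OF I] fc by (auto intro!: poly_ring_closed(4,5))
        show "0 \<in> ?K" by (rule IK[OF idealD(2)[OF I]])
      next
        fix x y :: "('v edge_var, 'k) mpoly" assume "x \<in> ?K" "y \<in> ?K"
        then obtain i g j h where "x = i + ?f * g" "i \<in> ?I" "g \<in> carrier (poly_ring (gvars W))"
          "y = j + ?f * h" "j \<in> ?I" "h \<in> carrier (poly_ring (gvars W))" by blast
        moreover from this have "x + y = (i + j) + ?f * (g + h)" by (simp add: algebra_simps)
        ultimately show "x + y \<in> ?K"
          using idealD(3)[OF I, of i j] poly_ring_closed(4)[of g "gvars W" h] by blast
      next
        fix r x :: "('v edge_var, 'k) mpoly" assume r: "r \<in> carrier (poly_ring (gvars W))" and "x \<in> ?K"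
        then obtain i g where "x = i + ?f * g" "i \<in> ?I" "g \<in> carrier (poly_ring (gvars W))" by blast
        moreover from this have "r * x = r * i + ?f * (r * g)" by (simp add: algebra_simps)
        ultimately show "r * x \<in> ?K"
          using idealD(4)[OF I r, of i] poly_ring_closed(5)[OF r, of g] by blast
      qed
      moreover have "?f \<in> ?K"
        using idealD(2)[OF I] poly_ring_closed(2)[of "gvars W"] by force
      moreover have "binom b a \<in> ?K"
        using idealD(5)[OF \<open>ideal ?K (poly_ring (gvars W))\<close> \<open>?f \<in> ?K\<close>] by (simp add: binom_commute[of a b])
      ultimately have "?J \<subseteq> ?K"
        using IK[OF gens(1)] IK[OF gens(2)] IK[OF gens(3)] by (intro cut_ideal_least) auto
      then show ?thesis using that by blast
    qed
    have fI': "?f * p \<in> ?I" if "p \<in> ?I'" for p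
    proof -
      let ?K = "{p \<in> carrier (poly_ring (gvars W)). ?f * p \<in> ?I}"
      have "ideal ?K (poly_ring (gvars W))"
        unfolding ideal_poly_ring_iff
        using idealD(2,3,4)[OF I]
        by (auto simp: poly_ring_closed distrib_left mult.left_commute[of ?f])
      moreover have IK: "p \<in> ?K" if "p \<in> ?I" for p
        using that idealD(1)[OF I] idealD(4)[OF I fc] by auto
      moreover have "var_poly (XVar c) \<in> ?K" "var_poly (YVar c) \<in> ?K"
        using path_products[OF I, of a b c] gens(3) abc var_carrier[of c W] by auto
      ultimately have "?I' \<subseteq> ?K"
        using IK[OF gens(1)] IK[OF gens(2)] IK[OF gens(3)] by (intro cut_ideal_least) auto
      then show ?thesis using that by blast
    qed
    have step: "?H ?I q \<le> ?H ?J q + ?H ?I' (q - 2)" if "2 \<le> q" for q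
      by (rule hilbert_function_le_add[OF finite_gvars[OF fin] I homogeneous_cut_ideal[OF T E(2)]
          proper_cut_ideal[OF fin E T] I' proper_cut_ideal[OF fin E T'] J proper_cut_ideal[OF fin E' T]
          f IJ fI' that])
    have dim_mono: "cut_dim W S ?E \<le> cut_dim W S E" for S
      unfolding cut_dim_def using fin E(1) E'(1)
      by (intro add_left_mono card_quotient_antimono con_equiv con_mono) auto
    have "W \<times> W - ?E \<subset> W \<times> W - E" using abc by auto
    then have "card (W \<times> W - ?E) < card (W \<times> W - E)" using fin by (intro psubset_card_mono) auto
    then have "\<exists>C. \<forall>q. ?H ?J q \<le> ?H (cut_ideal W T (con W T ?E)) q + C * (q + 1) ^ e"
      by (intro less.hyps E' T order.trans[OF dim_mono dim]) auto
    then obtain C1 where C1: "\<And>q. ?H ?J q \<le> ?H (cut_ideal W T (con W T E)) q + C1 * (q + 1) ^ e"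
      unfolding conE by auto
    have "W - ?T \<subset> W - T" using abc by auto
    then have "card (W - ?T) < card (W - T)" using fin by (intro psubset_card_mono) auto
    then have "\<exists>C. \<forall>q. ?H ?I' q \<le> ?H (cut_ideal W ?T (con W ?T E)) q + C * (q + 1) ^ e"
      by (intro less.hyps E T' dim) auto
    then obtain C2 where C2: "\<And>q. ?H ?I' q \<le> ?H (cut_ideal W ?T (con W ?T E)) q + C2 * (q + 1) ^ e"
      by auto
    have "cut_dim W ?T E \<le> Suc e" using abc T' by (intro dim) auto
    then have "\<exists>C. \<forall>q. ?H (cut_ideal W ?T (con W ?T E)) q \<le> C * (q + 1) ^ e"
      unfolding cut_dim_def by (rule growth_of_series[OF hilbert_series_class_ideal[OF fin T' con_equiv[OF E(1)]]])
    then obtain C3 where C3: "\<And>q. ?H (cut_ideal W ?T (con W ?T E)) q \<le> C3 * (q + 1) ^ e" by auto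
    have "?H ?I q \<le> ?H (cut_ideal W T (con W T E)) q + (C1 + C2 + C3 + ?H ?I 0 + ?H ?I 1) * (q + 1) ^ e" for q
    proof (cases "2 \<le> q")
      case True
      have "(C3 + C2) * (q - 2 + 1) ^ e \<le> (C3 + C2) * (q + 1) ^ e"
        by (intro mult_left_mono power_mono) auto
      then have "?H ?I q \<le> ?H (cut_ideal W T (con W T E)) q + (C1 + C2 + C3) * (q + 1) ^ e"
        using step[OF True] C1[of q] C2[of "q - 2"] C3[of "q - 2"] by (simp add: algebra_simps)
      also have "\<dots> \<le> ?H (cut_ideal W T (con W T E)) q + (C1 + C2 + C3 + ?H ?I 0 + ?H ?I 1) * (q + 1) ^ e"
        by (intro add_left_mono mult_right_mono) auto
      finally show ?thesis .
    next
      case False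
      then have "q = 0 \<or> q = 1" by auto
      then have "?H ?I q * 1 \<le> (C1 + C2 + C3 + ?H ?I 0 + ?H ?I 1) * (q + 1) ^ e"
        by (intro mult_mono) auto
      then show ?thesis by simp
    qed
    then show ?thesis by blast
  qed
qed

section \<open>Minimal primes\<close>

text \<open>Putting back any vertex of \<open>T\<close> joins components, so \<open>T\<close> has the cut point property in the graph.\<close>

definition cutset :: "'v set \<Rightarrow> 'v rel \<Rightarrow> 'v set \<Rightarrow> bool" where
  "cutset W E T \<longleftrightarrow> T \<subseteq> W \<and>
    (\<forall>v\<in>T. \<exists>a\<in>W - T. \<exists>b\<in>W - T. (v, a) \<in> E \<and> (v, b) \<in> E \<and> (a, b) \<notin> con W T E)"

abbreviation cut_prime :: "'v set \<Rightarrow> 'v rel \<Rightarrow> 'v set \<Rightarrow> ('v edge_var, 'k::field) mpoly set" where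
  "cut_prime W E T \<equiv> cut_ideal W T (con W T E)"

lemma cut_prime_subset_imp:
  assumes "finite W" "sym E" "T \<subseteq> W" "T' \<subseteq> W"
    and sub: "(cut_prime W E T' :: ('v edge_var, 'k::field) mpoly set) \<subseteq> cut_prime W E T"
  shows "T' \<subseteq> T"
proof
  fix v assume v: "v \<in> T'"
  then have "(var_poly (XVar v) :: ('v edge_var, 'k) mpoly) \<in> cut_prime W E T"
    using cut_ideal_gens(1)[OF assms(4) con_subset_W v] sub by blast
  then show "v \<in> T"
    using var_mem_class_ideal_iff[OF assms(1,3) con_equiv[OF assms(2)], of v] v assms(4) by auto
qed

text \<open>A vertex \<open>v\<close> that only sees one component of the remaining graph can be put back: a path
  through \<open>v\<close> can be replaced by one within that component.\<close>

lemma cut_prime_remove: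
  assumes W: "sym E" "T \<subseteq> W" and v: "v \<in> T"
    and one: "\<And>a b. a \<in> W - T \<Longrightarrow> b \<in> W - T \<Longrightarrow> (v, a) \<in> E \<Longrightarrow> (v, b) \<in> E \<Longrightarrow> (a, b) \<in> con W T E"
  shows "cut_prime W E (T - {v}) \<subseteq> cut_prime W E T"
proof (rule cut_ideal_least)
  note gens = cut_ideal_gens[OF W(2) con_subset_W]
  show I: "ideal (cut_prime W E T) (poly_ring (gvars W))"
    by (rule ideal_cut_ideal[OF W(2) con_subset_W])
  show "var_poly (XVar u) \<in> cut_prime W E T" "var_poly (YVar u) \<in> cut_prime W E T" if "u \<in> T - {v}" for u
    using that gens by auto
  have eq: "equiv (W - T) (con W T E)" by (rule con_equiv[OF W(1)])
  have tr: "(x, z) \<in> con W T E" if "(x, y) \<in> con W T E" "(y, z) \<in> con W T E" for x y z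
    using that eq by (meson equivE transD)
  fix a b assume ab: "(a, b) \<in> con W (T - {v}) E"
  show "binom a b \<in> cut_prime W E T"
  proof (cases "a \<in> T \<or> b \<in> T")
    case True
    then show ?thesis
      using gens ab con_subset_W by (intro binom_mem_of_vars[OF I]) blast+
  next
    case False
    have a: "a \<in> W - T" using False ab con_subset by blast
    have "(a, b) \<in> (Restr E (W - (T - {v})))\<^sup>*" using ab by (simp add: con_def)
    then have "(b \<noteq> v \<longrightarrow> (a, b) \<in> con W T E) \<and> (b = v \<longrightarrow> (\<exists>c\<in>W - T. (v, c) \<in> E \<and> (a, c) \<in> con W T E))"
    proof (induction rule: rtrancl_induct)
      case base
      then show ?case using a v con_refl[OF a] by auto
    next
      case (step y z)
      show ?case
      proof (cases "y = v")
        case True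
        then obtain c where c: "c \<in> W - T" "(v, c) \<in> E" "(a, c) \<in> con W T E" using step.IH by auto
        show ?thesis
        proof (cases "z = v")
          case False
          then have "z \<in> W - T" "(v, z) \<in> E" using step.hyps True by auto
          then have "(c, z) \<in> con W T E" using one c by blast
          then show ?thesis using tr c False by blast
        qed (use c in blast)
      next
        case False
        then have y: "(a, y) \<in> con W T E" "y \<in> W - T" using step by auto
        show ?thesis
        proof (cases "z = v")
          case True
          then have "(v, y) \<in> E" using step.hyps W(1) by (auto simp: sym_def)
          then show ?thesis using y True by blast
        next
          case False
          then have "(y, z) \<in> con W T E" using y step.hyps by (intro con_edge) auto
          then show ?thesis using tr y False by blast
        qed
      qed
    qed
    moreover have "b \<noteq> v" using False v by auto
    ultimately show ?thesis using gens(3) by blast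
  qed
qed

lemma cutset_below:
  assumes "finite W" "sym E" "T \<subseteq> W"
  shows "\<exists>S. cutset W E S \<and> (cut_prime W E S :: ('v edge_var, 'k::field) mpoly set) \<subseteq> cut_prime W E T"
  using assms(3)
proof (induction "card T" arbitrary: T rule: less_induct)
  case less
  show ?case
  proof (cases "cutset W E T")
    case False
    then obtain v where v: "v \<in> T"
      "\<And>a b. a \<in> W - T \<Longrightarrow> b \<in> W - T \<Longrightarrow> (v, a) \<in> E \<Longrightarrow> (v, b) \<in> E \<Longrightarrow> (a, b) \<in> con W T E"
      using less.prems by (auto simp: cutset_def)
    have "finite T" using less.prems assms(1) by (rule finite_subset)
    then have "card (T - {v}) < card T" using v(1) by (meson card_Diff1_less)
    then obtain S where "cutset W E S"
      "(cut_prime W E S :: ('v edge_var, 'k) mpoly set) \<subseteq> cut_prime W E (T - {v})"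
      using less.hyps[of "T - {v}"] less.prems by auto
    moreover have "(cut_prime W E (T - {v}) :: ('v edge_var, 'k) mpoly set) \<subseteq> cut_prime W E T"
      by (rule cut_prime_remove[OF assms(2) less.prems v])
    ultimately show ?thesis by blast
  qed auto
qed

text \<open>A vertex of \<open>T\<close> outside \<open>T'\<close> would join two components, and the binomial of two of its neighbours
  in them would lie in the first prime but not in the second one.\<close>

lemma cutset_minimal:
  assumes W: "finite W" "sym E" and T: "cutset W E T" and T': "T' \<subseteq> W"
    and sub: "(cut_prime W E T' :: ('v edge_var, 'k::field) mpoly set) \<subseteq> cut_prime W E T"
  shows "T' = T"
proof (rule antisym)
  have TW: "T \<subseteq> W" using T by (simp add: cutset_def)
  show "T' \<subseteq> T" by (rule cut_prime_subset_imp[OF W TW T' sub])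
  show "T \<subseteq> T'"
  proof (rule ccontr)
    assume "\<not> T \<subseteq> T'"
    then obtain v where v: "v \<in> T" "v \<notin> T'" by auto
    then obtain a b where ab: "a \<in> W - T" "b \<in> W - T" "(v, a) \<in> E" "(v, b) \<in> E" "(a, b) \<notin> con W T E"
      using T by (auto simp: cutset_def)
    have vW: "v \<in> W - T'" "a \<in> W - T'" "b \<in> W - T'" using v ab \<open>T' \<subseteq> T\<close> TW by auto
    have "(a, v) \<in> con W T' E" "(v, b) \<in> con W T' E"
      using ab vW W(2) by (auto intro!: con_edge simp: sym_def)
    then have "(a, b) \<in> con W T' E" using con_equiv[OF W(2), of W T'] by (meson equivE transD)
    then have "(binom a b :: ('v edge_var, 'k) mpoly) \<in> cut_prime W E T"
      using cut_ideal_gens(3)[OF T' con_subset_W] sub by blast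
    then show False
      using binom_mem_class_ideal_iff[OF W(1) TW con_equiv[OF W(2)] ab(1,2)] ab(5) by blast
  qed
qed

text \<open>Every prime over the ideal lies over the prime of some set, hence of some cut set, and there
  are no inclusions among the latter.\<close>

theorem minimal_primes_edge_ideal:
  assumes W: "finite W" "sym E" "E \<subseteq> W \<times> W"
  shows "minimal_primes (poly_ring (gvars W)) (cut_ideal W {} E :: ('v edge_var, 'k::field) mpoly set)
    = cut_prime W E ` {T. cutset W E T}"
proof -
  let ?J = "cut_ideal W {} E :: ('v edge_var, 'k) mpoly set"
  have pr: "primeideal (cut_prime W E T :: ('v edge_var, 'k) mpoly set) (poly_ring (gvars W))"
    and JT: "?J \<subseteq> cut_prime W E T" if "T \<subseteq> W" for T
  proof -
    show "primeideal (cut_prime W E T :: ('v edge_var, 'k) mpoly set) (poly_ring (gvars W))"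
      by (rule prime_class_ideal[OF W(1) that con_equiv[OF W(2)]])
    show "?J \<subseteq> cut_prime W E T"
      using cut_ideal_mono[of "{}" T W E E] cut_ideal_le_con[OF that W(3)] that W(3) by blast
  qed
  have above: "\<exists>S. cutset W E S \<and> cut_prime W E S \<subseteq> P"
    if P: "primeideal P (poly_ring (gvars W))" "?J \<subseteq> P" for P
  proof -
    obtain T where "T \<subseteq> W" "cut_prime W E T \<subseteq> P"
      using prime_contains_cut_prime[OF W(1) P(1) W(2,3) _ P(2)] by auto
    then show ?thesis using cutset_below[OF W(1,2), of T, where 'k = 'k] by blast
  qed
  show ?thesis
  proof (intro equalityI subsetI)
    fix P assume P: "P \<in> minimal_primes (poly_ring (gvars W)) ?J"
    then obtain S where S: "cutset W E S" "cut_prime W E S \<subseteq> P"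
      using above[of P] by (auto simp: minimal_primes_def)
    then have "S \<subseteq> W" by (simp add: cutset_def)
    then have "cut_prime W E S = P"
      using P S pr[of S] JT[of S] unfolding minimal_primes_def by blast
    then show "P \<in> cut_prime W E ` {T. cutset W E T}" using S by auto
  next
    fix P assume "P \<in> (cut_prime W E ` {T. cutset W E T} :: ('v edge_var, 'k) mpoly set set)"
    then obtain T where T: "cutset W E T" "P = cut_prime W E T" by auto
    then have TW: "T \<subseteq> W" by (simp add: cutset_def)
    have "Q = P" if Q: "primeideal Q (poly_ring (gvars W))" "?J \<subseteq> Q" "Q \<subseteq> P" for Q
    proof -
      obtain S where S: "cutset W E S" "cut_prime W E S \<subseteq> Q" using above[OF Q(1,2)] by auto
      then have "S \<subseteq> W" by (simp add: cutset_def)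
      moreover have "(cut_prime W E S :: ('v edge_var, 'k) mpoly set) \<subseteq> cut_prime W E T"
        using S(2) Q(3) T(2) by blast
      ultimately have "S = T" by (intro cutset_minimal[OF W(1,2) T(1), where 'k = 'k])
      then show "Q = P" using S(2) Q(3) T(2) by auto
    qed
    then show "P \<in> minimal_primes (poly_ring (gvars W)) ?J"
      unfolding minimal_primes_def using pr[OF TW] JT[OF TW] T(2) by blast
  qed
qed

section \<open>Multiplicity and arithmetic degree of a binomial edge ideal\<close>

lemma cut_prime_invariants:
  assumes W: "finite W" "sym E" "T \<subseteq> W" "T \<noteq> W"
  shows "hilbert_multiplicity (gvars W) (cut_prime W E T :: ('v edge_var, 'k::field) mpoly set)
      = (\<Prod>c\<in>(W - T) // con W T E. of_nat (card c))"
    and "\<And>l P. prime_chain (gvars W) (cut_prime W E T :: ('v edge_var, 'k) mpoly set) l P \<Longrightarrow> l \<le> cut_dim W T E"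
proof -
  let ?P = "cut_prime W E T :: ('v edge_var, 'k) mpoly set" and ?C = "(W - T) // con W T E"
  interpret proper_poly_ideal "gvars W" ?P
    by (rule prime_proper[OF prime_class_ideal[OF W(1,3) con_equiv[OF W(2)]]])
  have "W - T \<noteq> {}" using W by auto
  then have "card (W - T) > 0" using W(1) by (simp add: card_gt_0_iff)
  then obtain k where k: "cut_dim W T E = Suc k" unfolding cut_dim_def by (metis add_is_0 not0_implies_Suc neq0_conv)
  have "card c \<noteq> 0" if "c \<in> ?C" for c
  proof -
    have "c \<subseteq> W - T" "c \<noteq> {}"
      using that in_quotient_imp_subset in_quotient_imp_non_empty con_equiv[OF W(2)] by blast+
    then show ?thesis using W(1) finite_subset[of c "W - T"] by auto
  qed
  moreover have "finite ?C" using W(1) con_subset by (intro finite_quotient) auto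
  ultimately have nz: "poly (\<Prod>c\<in>?C. [:1, of_nat (card c) - 1:]) 1 \<noteq> (0 :: rat)"
    unfolding numerator_at_1 by (simp add: prod_zero_iff)
  obtain Q where Q: "prime_chain (gvars W) ?P (Suc k) Q"
    using class_ideal_chain[OF W(1,3) con_equiv[OF W(2)], where 'k = 'k] k unfolding cut_dim_def by metis
  note series = hilbert_series_class_ideal[OF W(1,3) con_equiv[OF W(2)], where 'k = 'k,
      folded cut_dim_def, unfolded k]
  note res = multiplicity_of_series[OF finite_gvars[OF W(1)] series nz Q]
  show "hilbert_multiplicity (gvars W) ?P = (\<Prod>c\<in>?C. of_nat (card c))"
    using res(2) unfolding numerator_at_1 .
  show "l \<le> cut_dim W T E" if "prime_chain (gvars W) ?P l P" for l P
    using res(3) prime_chain_length_le[OF finite_gvars[OF W(1)] _ that] k by auto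
qed

theorem arith_degree_edge_ideal:
  assumes W: "finite W" "W \<noteq> {}" "sym E" "E \<subseteq> W \<times> W"
  shows "arith_degree (gvars W) (cut_ideal W {} E :: ('v edge_var, 'k::field) mpoly set)
    = (\<Sum>T\<in>{T. cutset W E T}. \<Prod>c\<in>(W - T) // con W T E. of_nat (card c))"
proof -
  have inj: "inj_on (cut_prime W E :: _ \<Rightarrow> ('v edge_var, 'k) mpoly set) {T. cutset W E T}"
  proof (rule inj_onI)
    fix S T assume "S \<in> {T. cutset W E T}" "T \<in> {T. cutset W E T}"
      "(cut_prime W E S :: ('v edge_var, 'k) mpoly set) = cut_prime W E T"
    then show "S = T"
      using cutset_minimal[OF W(1,3), of T S, where 'k = 'k] by (auto simp: cutset_def)
  qed
  have "T \<subseteq> W \<and> T \<noteq> W" if "cutset W E T" for T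
    using that W(2) by (auto simp: cutset_def)
  then show ?thesis
    unfolding arith_degree_def minimal_primes_edge_ideal[OF W(1,3,4)] sum.reindex[OF inj] o_def
    by (intro sum.cong) (auto simp: cut_prime_invariants(1)[OF W(1,3)])
qed

text \<open>For connected graphs the prime of the empty cut set has dimension \<open>card W + 1\<close>. For a nonempty cut
  set the dimension is at most \<open>card W\<close> by assumption. The prime of any other nonempty set lies over
  that of such a cut set or strictly over that of the empty one, so the same bound holds for it.
  Hence the Hilbert polynomials of the ideal and of the prime of the empty set differ by a polynomial
  of degree less than \<open>card W\<close>.\<close>

theorem multiplicity_edge_ideal:
  assumes W: "finite W" "W \<noteq> {}" "sym E" "E \<subseteq> W \<times> W"
    and conn: "con W {} E = W \<times> W"
    and dim: "\<And>T. cutset W E T \<Longrightarrow> T \<noteq> {} \<Longrightarrow> cut_dim W T E \<le> card W"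
  shows "hilbert_multiplicity (gvars W) (cut_ideal W {} E :: ('v edge_var, 'k::field) mpoly set) = of_nat (card W)"
proof -
  let ?J = "cut_ideal W {} E :: ('v edge_var, 'k) mpoly set"
  let ?P = "\<lambda>T. cut_prime W E T :: ('v edge_var, 'k) mpoly set"
  let ?H = "\<lambda>I :: ('v edge_var, 'k) mpoly set. hilbert_function (gvars W) I"
  have finX: "finite (gvars W)" using W(1) by (rule finite_gvars)
  have quot: "W // (W \<times> W) = {W}" using W(2) by (auto simp: quotient_def)
  then have cd: "cut_dim W {} E = Suc (card W)" by (simp add: cut_dim_def conn)
  have pr: "primeideal (?P T) (poly_ring (gvars W))" if "T \<subseteq> W" for T
    by (rule prime_class_ideal[OF W(1) that con_equiv[OF W(3)]])
  have dim': "cut_dim W T E \<le> card W" if T: "T \<subseteq> W" "T \<noteq> {}" for T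
  proof -
    obtain S where S: "cutset W E S" "?P S \<subseteq> ?P T" using cutset_below[OF W(1,3) T(1)] by blast
    have SW: "S \<subseteq> W" "S \<noteq> W" using S(1) W(2) by (auto simp: cutset_def)
    obtain Q where Q: "prime_chain (gvars W) (?P T) (cut_dim W T E) Q"
      using class_ideal_chain[OF W(1) T(1) con_equiv[OF W(3)], where 'k = 'k] unfolding cut_dim_def by auto
    show ?thesis
    proof (cases "S = {}")
      case False
      have "prime_chain (gvars W) (?P S) (cut_dim W T E) Q"
        using Q S(2) unfolding prime_chain_def by blast
      then have "cut_dim W T E \<le> cut_dim W S E" by (rule cut_prime_invariants(2)[OF W(1,3) SW])
      then show ?thesis using dim[OF S(1) False] by simp
    next
      case True
      have "?P {} \<noteq> ?P T"
        using cut_prime_subset_imp[OF W(1,3), of "{}" T, where 'k = 'k] T by auto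
      then have lt: "?P {} \<subset> ?P T" using S(2) True by auto
      define Q' where "Q' i = (case i of 0 \<Rightarrow> ?P {} | Suc j \<Rightarrow> Q j)" for i
      have "prime_chain (gvars W) (?P {}) (Suc (cut_dim W T E)) Q'"
        unfolding prime_chain_def
      proof (intro conjI allI impI)
        fix i assume "i \<le> Suc (cut_dim W T E)"
        then show "primeideal (Q' i) (poly_ring (gvars W))" "?P {} \<subseteq> Q' i"
          using Q lt pr[of "{}"] by (auto simp: Q'_def prime_chain_def split: nat.splits)
      next
        fix i assume "i < Suc (cut_dim W T E)"
        then show "Q' i \<subset> Q' (Suc i)"
          using Q lt by (auto simp: Q'_def prime_chain_def split: nat.splits)
      qed
      then have "Suc (cut_dim W T E) \<le> cut_dim W {} E"
        using W(2) by (intro cut_prime_invariants(2)[OF W(1,3)]) auto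
      then show ?thesis using cd by simp
    qed
  qed
  obtain e where e: "card W = Suc e" using W(1,2) by (metis card_eq_0_iff not0_implies_Suc)
  obtain C where C: "\<And>q. ?H ?J q \<le> ?H (?P {}) q + C * (q + 1) ^ e"
    using hilbert_function_cut_ideal_le[OF W(1,3,4), of "{}" e, where 'k = 'k] dim' e by auto
  have JP: "?J \<subseteq> ?P {}" by (rule cut_ideal_le_con[OF _ W(4)]) simp
  interpret J: proper_poly_ideal "gvars W" ?J
    by (rule proper_poly_ideal.intro[OF ideal_cut_ideal[OF _ W(4)] proper_cut_ideal[OF W(1,3,4)]]) auto
  interpret P: proper_poly_ideal "gvars W" "?P {}"
    by (rule prime_proper[OF pr]) simp
  have mono: "?H (?P {}) q \<le> ?H ?J q" for q
    by (rule hilbert_function_antimono[OF finX J.ideal P.ideal JP P.proper])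
  note series = hilbert_series_class_ideal[OF W(1) empty_subsetI con_equiv[OF W(3)], where 'k = 'k,
      folded cut_dim_def, unfolded cd]
  have num: "poly (\<Prod>c\<in>(W - {}) // con W {} E. [:1, of_nat (card c) - 1:]) 1 = (of_nat (card W) :: rat)"
    unfolding numerator_at_1 by (simp add: conn quot)
  obtain h0 :: "rat poly" where h0: "\<forall>\<^sub>F q in sequentially. of_nat (?H (?P {}) q) = poly h0 (of_nat q)"
    "degree h0 \<le> card W" "poly.coeff h0 (card W) = of_nat (card W) / fact (card W)"
    by (rule hilbert_polynomial_of_series[OF series, unfolded num])
  have "card (gvars W) \<noteq> 0" using finX W(2) by auto
  then obtain k where k: "card (gvars W) = Suc k" by (metis not0_implies_Suc)
  obtain pJ where "hilbert_series (?H ?J) (Suc k) pJ" using J.hilbert_series_exists[OF finX] k by auto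
  then obtain h :: "rat poly" where h: "\<forall>\<^sub>F q in sequentially. of_nat (?H ?J q) = poly h (of_nat q)"
    "degree h \<le> k" "poly.coeff h k = poly pJ 1 / fact k"
    by (rule hilbert_polynomial_of_series)
  have "\<forall>\<^sub>F q in sequentially. 0 \<le> poly (h - h0) (of_nat q) \<and> poly (h - h0) (of_nat q) \<le> of_nat C * (of_nat q + 1) ^ e"
    using h(1) h0(1)
  proof eventually_elim
    case (elim q)
    have "of_nat (?H ?J q) \<le> (of_nat (?H (?P {}) q + C * (q + 1) ^ e) :: rat)"
      using C[of q] by (simp only: of_nat_le_iff)
    moreover have "of_nat (?H (?P {}) q) \<le> (of_nat (?H ?J q) :: rat)"
      using mono[of q] by (simp only: of_nat_le_iff)
    ultimately show ?case using elim by (simp add: add.commute)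
  qed
  then have "degree (h - h0) \<le> e" by (rule degree_le_of_growth)
  then have coeff: "poly.coeff h i = poly.coeff h0 i" if "i > e" for i
    using coeff_eq_0[of "h - h0" i] that by simp
  have lead: "poly.coeff h (card W) = of_nat (card W) / fact (card W)"
    using coeff[of "card W"] e h0(3) by simp
  have "degree h = card W"
  proof (rule antisym)
    show "degree h \<le> card W"
      by (rule degree_le) (use coeff e h0(2) in \<open>auto simp: coeff_eq_0\<close>)
    show "card W \<le> degree h" by (rule le_degree) (use lead e in simp)
  qed
  moreover have "krull_dim (poly_ring (gvars W) Quot ?J) = enat (Suc (card W))"
  proof -
    have "\<exists>C. \<forall>q. ?H ?J q \<le> C * (q + 1) ^ card W"
      using h(1) \<open>degree h = card W\<close> by (intro growth_of_poly) auto
    then obtain C' where C': "\<And>q. ?H ?J q \<le> C' * (q + 1) ^ card W" by auto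
    obtain Q where "prime_chain (gvars W) (?P {}) (Suc (card W)) Q"
      using class_ideal_chain[OF W(1) empty_subsetI con_equiv[OF W(3)], where 'k = 'k] cd
      unfolding cut_dim_def by metis
    then have "prime_chain (gvars W) ?J (Suc (card W)) Q"
      using JP unfolding prime_chain_def by blast
    then show ?thesis by (rule J.krull_dim_eq[OF finX C'])
  qed
  ultimately show ?thesis
    using h(1) lead
    by (intro hilbert_multiplicity_eqI[of _ _ "card W" h]) (auto simp: is_hilbert_polynomial_def)
qed

section \<open>Components of induced subgraphs\<close>

text \<open>\<open>P\<close> is certified to be the set of components of the subgraph induced on \<open>R\<close>: different members are
  not joined by edges, and each member has a vertex from which the others are reached.\<close>

definition parts :: "'v rel \<Rightarrow> 'v set \<Rightarrow> 'v set \<Rightarrow> 'v set set \<Rightarrow> bool" where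
  "parts E W R P \<longleftrightarrow> R \<subseteq> W \<and> \<Union>P = R \<and> {} \<notin> P \<and>
    (\<forall>c\<in>P. \<forall>c'\<in>P. c \<noteq> c' \<longrightarrow> c \<inter> c' = {} \<and> (\<forall>x\<in>c. \<forall>y\<in>c'. (x, y) \<notin> E)) \<and>
    (\<forall>c\<in>P. \<exists>h\<in>c. \<forall>x\<in>c. (h, x) \<in> con W (W - R) E)"

lemma parts_Union: "parts E W R P \<Longrightarrow> \<Union>P = R"
  by (simp add: parts_def)

lemma parts_disjoint:
  assumes "parts E W R P" "x \<in> c" "x \<in> c'" "c \<in> P" "c' \<in> P"
  shows "c = c'"
proof (rule ccontr)
  assume "c \<noteq> c'"
  then have "c \<inter> c' = {}" using assms by (simp add: parts_def)
  then show False using assms(2,3) by auto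
qed

lemma partsD:
  assumes "sym E" "parts E W R P"
  shows "(x, y) \<in> con W (W - R) E \<longleftrightarrow> (\<exists>c\<in>P. x \<in> c \<and> y \<in> c)" "R // con W (W - R) E = P"
proof -
  have R: "R \<subseteq> W" "\<Union>P = R" "{} \<notin> P" "W - (W - R) = R" using assms(2) by (auto simp: parts_def)
  have hub: "\<exists>h\<in>c. \<forall>x\<in>c. (h, x) \<in> con W (W - R) E" if "c \<in> P" for c
    using assms(2) that by (simp add: parts_def)
  have disj: "c = c'" if "x \<in> c" "x \<in> c'" "c \<in> P" "c' \<in> P" for c c' x
    using assms(2) that unfolding parts_def by blast
  have cross: "c = c'" if "(x, y) \<in> E" "x \<in> c" "y \<in> c'" "c \<in> P" "c' \<in> P" for c c' x y
    using assms(2) that unfolding parts_def by blast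
  let ?Q = "{(x, y). \<exists>c\<in>P. x \<in> c \<and> y \<in> c}"
  have eq: "equiv R (con W (W - R) E)" using con_equiv[OF assms(1), of W "W - R"] R(4) by simp
  have "equiv R ?Q"
  proof (rule equivI)
    show "refl_on R ?Q" using R(2) by (auto simp: refl_on_def)
    show "trans ?Q" using disj by (intro transI) blast
    show "?Q \<subseteq> R \<times> R" using R(2) by blast
  qed (auto simp: sym_def)
  moreover have "Restr E (W - (W - R)) \<subseteq> ?Q"
  proof
    fix u assume u: "u \<in> Restr E (W - (W - R))"
    obtain x y where [simp]: "u = (x, y)" by (cases u)
    obtain c c' where c: "x \<in> c" "c \<in> P" "y \<in> c'" "c' \<in> P" using u R by auto
    have "(x, y) \<in> E" using u by simp
    then have "c = c'" using cross c by blast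
    then show "u \<in> ?Q" using c by auto
  qed
  ultimately have "con W (W - R) E \<subseteq> ?Q" using R(4) by (intro con_minimal) auto
  moreover have "?Q \<subseteq> con W (W - R) E"
  proof
    fix u assume "u \<in> ?Q"
    then obtain c x y where c: "u = (x, y)" "c \<in> P" "x \<in> c" "y \<in> c" by auto
    then obtain h where "(h, x) \<in> con W (W - R) E" "(h, y) \<in> con W (W - R) E"
      using hub[OF c(2)] by auto
    moreover have "sym (con W (W - R) E)" "trans (con W (W - R) E)" using eq by (auto elim: equivE)
    ultimately show "u \<in> con W (W - R) E" unfolding c(1) by (blast dest: symD transD)
  qed
  ultimately have con: "con W (W - R) E = ?Q" by blast
  then show "(x, y) \<in> con W (W - R) E \<longleftrightarrow> (\<exists>c\<in>P. x \<in> c \<and> y \<in> c)" by auto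
  have cls: "?Q `` {x} = c" if "x \<in> c" "c \<in> P" for x c
    using that disj by blast
  show "R // con W (W - R) E = P"
    unfolding con
  proof (intro equalityI subsetI)
    fix c assume "c \<in> R // ?Q"
    then obtain x where x: "x \<in> R" "c = ?Q `` {x}" by (elim quotientE)
    then obtain c' where "x \<in> c'" "c' \<in> P" using R(2) by auto
    then show "c \<in> P" using cls x(2) by auto
  next
    fix c assume c: "c \<in> P"
    then obtain x where x: "x \<in> c" using R(3) by (metis equals0I)
    then have "x \<in> R" using R(2) c by auto
    then have "?Q `` {x} \<in> R // ?Q" by (rule quotientI)
    then show "c \<in> R // ?Q" using cls[OF x c] by simp
  qed
qed

section \<open>The bipartite complement of a cycle\<close>

text \<open>The relevant properties of the cycle are local: it is bipartite and 2-regular and has no cycles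
  of length 4 or 6, where the former amount to distinct vertices with the same neighbours. Here \<open>N\<close> gives the two neighbours in the cycle, that is the non-neighbours on
  the other side in the complement.\<close>

locale cocycle =
  fixes X Y :: "'v set" and N :: "'v \<Rightarrow> 'v set" and n :: nat
  assumes fin: "finite X" "finite Y" and card_sides: "card X = n" "card Y = n" and n: "n \<ge> 5"
    and disj: "X \<inter> Y = {}"
    and N_sub: "\<And>x. x \<in> X \<Longrightarrow> N x \<subseteq> Y" "\<And>y. y \<in> Y \<Longrightarrow> N y \<subseteq> X"
    and card_N: "\<And>w. w \<in> X \<union> Y \<Longrightarrow> card (N w) = 2"
    and N_sym: "\<And>a b. a \<in> X \<union> Y \<Longrightarrow> b \<in> X \<union> Y \<Longrightarrow> b \<in> N a \<Longrightarrow> a \<in> N b"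
    and N_inj: "\<And>a b. a \<in> X \<union> Y \<Longrightarrow> b \<in> X \<union> Y \<Longrightarrow> N a = N b \<Longrightarrow> a = b"
    and no_hexagon: "\<And>w a b a' b' t. w \<in> X \<union> Y \<Longrightarrow> a \<in> N w \<Longrightarrow> b \<in> N w \<Longrightarrow> a \<noteq> b \<Longrightarrow>
      a' \<in> N a - {w} \<Longrightarrow> b' \<in> N b - {w} \<Longrightarrow> t \<in> N a' \<Longrightarrow> t \<in> N b' \<Longrightarrow> False"

definition co_edges :: "'v set \<Rightarrow> 'v set \<Rightarrow> ('v \<Rightarrow> 'v set) \<Rightarrow> 'v rel" where
  "co_edges X Y N = {(a, b). (a \<in> X \<and> b \<in> Y \<or> a \<in> Y \<and> b \<in> X) \<and> b \<notin> N a}"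

lemma co_edges_swap: "co_edges Y X N = co_edges X Y N"
  by (auto simp: co_edges_def)

lemma cocycle_swap: "cocycle X Y N n \<Longrightarrow> cocycle Y X N n"
  unfolding cocycle_def Un_commute[of Y X] Int_commute[of Y X]
  by (elim conjE, intro conjI) assumption+

context cocycle
begin

abbreviation "W \<equiv> X \<union> Y"
abbreviation "E \<equiv> co_edges X Y N"
abbreviation "cn R \<equiv> con W (W - R) E"

lemma finW: "finite W"
  using fin by simp

lemma cardW: "card W = 2 * n"
  using fin disj card_sides by (simp add: card_Un_disjoint)

lemma E_sub: "E \<subseteq> W \<times> W"
  by (auto simp: co_edges_def)

lemma symE: "sym E"
  using N_sym by (auto simp: sym_def co_edges_def)

lemma adj:
  assumes "x \<in> X" "y \<in> Y"
  shows "(x, y) \<in> E \<longleftrightarrow> y \<notin> N x" "(y, x) \<in> E \<longleftrightarrow> y \<notin> N x" "x \<in> N y \<longleftrightarrow> y \<in> N x"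
proof -
  show *: "x \<in> N y \<longleftrightarrow> y \<in> N x" using N_sym[of x y] N_sym[of y x] assms by auto
  show "(x, y) \<in> E \<longleftrightarrow> y \<notin> N x" "(y, x) \<in> E \<longleftrightarrow> y \<notin> N x"
    using assms disj * by (auto simp: co_edges_def)
qed

lemma not_adj: "x \<in> X \<Longrightarrow> x' \<in> X \<Longrightarrow> (x, x') \<notin> E" "y \<in> Y \<Longrightarrow> y' \<in> Y \<Longrightarrow> (y, y') \<notin> E"
  using disj by (auto simp: co_edges_def)

lemma N_pair:
  assumes "w \<in> W"
  obtains p q where "N w = {p, q}" "p \<noteq> q"
  using card_N[OF assms] by (auto simp: card_2_iff)

lemma fin_N: "w \<in> W \<Longrightarrow> finite (N w)"
  using card_N by (metis card.infinite zero_neq_numeral)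

lemma N_two: "w \<in> W \<Longrightarrow> p \<in> N w \<Longrightarrow> q \<in> N w \<Longrightarrow> p \<noteq> q \<Longrightarrow> N w = {p, q}"
  using card_N[of w] by (auto simp: card_2_iff)

lemma N_eq_of_sub: "w \<in> W \<Longrightarrow> S \<subseteq> N w \<Longrightarrow> card S \<ge> 2 \<Longrightarrow> S = N w"
  using card_N[of w] fin_N[of w] by (intro card_seteq) auto

text \<open>No cycle of length 4.\<close>

lemma common_N: "a \<in> W \<Longrightarrow> b \<in> W \<Longrightarrow> p \<in> N a \<Longrightarrow> q \<in> N a \<Longrightarrow> p \<in> N b \<Longrightarrow> q \<in> N b \<Longrightarrow> p \<noteq> q \<Longrightarrow> a = b"
  using N_inj N_two by metis

lemma ex_N_diff: "a \<in> W \<Longrightarrow> b \<in> W \<Longrightarrow> a \<noteq> b \<Longrightarrow> \<exists>p\<in>N a. p \<notin> N b"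
  using N_inj[of a b] N_eq_of_sub[of b "N a"] card_N by auto

lemma ex_avoid:
  assumes "finite F" "card F < n"
  shows "\<exists>x\<in>X. x \<notin> F" "\<exists>y\<in>Y. y \<notin> F"
proof -
  have "\<not> X \<subseteq> F" using card_mono[OF assms(1), of X] assms(2) card_sides by auto
  then show "\<exists>x\<in>X. x \<notin> F" by auto
  have "\<not> Y \<subseteq> F" using card_mono[OF assms(1), of Y] assms(2) card_sides by auto
  then show "\<exists>y\<in>Y. y \<notin> F" by auto
qed

lemma ex_avoid_N:
  assumes "a \<in> W" "b \<in> W"
  shows "\<exists>x\<in>X. x \<notin> N a \<and> x \<notin> N b" "\<exists>y\<in>Y. y \<notin> N a \<and> y \<notin> N b"
proof -
  have "card (N a \<union> N b) \<le> card (N a) + card (N b)" by (rule card_Un_le)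
  then have c: "card (N a \<union> N b) < n" using card_N assms n by simp
  have f: "finite (N a \<union> N b)" using fin_N assms by auto
  show "\<exists>x\<in>X. x \<notin> N a \<and> x \<notin> N b" "\<exists>y\<in>Y. y \<notin> N a \<and> y \<notin> N b"
    using ex_avoid[OF f c] by auto
qed

lemma cn_equiv: "R \<subseteq> W \<Longrightarrow> equiv R (cn R)"
  using con_equiv[OF symE, of W "W - R"] by (simp add: double_diff)

lemma cn_refl: "x \<in> R \<Longrightarrow> R \<subseteq> W \<Longrightarrow> (x, x) \<in> cn R"
  using cn_equiv[of R] by (auto simp: equiv_def refl_on_def)

lemma cn_edge: "(x, y) \<in> E \<Longrightarrow> x \<in> R \<Longrightarrow> y \<in> R \<Longrightarrow> (x, y) \<in> cn R"
  using E_sub by (intro con_edge) auto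

lemma cn_trans: "(x, y) \<in> cn R \<Longrightarrow> (y, z) \<in> cn R \<Longrightarrow> R \<subseteq> W \<Longrightarrow> (x, z) \<in> cn R"
  using cn_equiv[of R] by (meson equivE transD)

lemma cn_sym: "(x, y) \<in> cn R \<Longrightarrow> R \<subseteq> W \<Longrightarrow> (y, x) \<in> cn R"
  using cn_equiv[of R] by (meson equivE symD)

lemma cn_path2: "(x, y) \<in> E \<Longrightarrow> (y, z) \<in> E \<Longrightarrow> x \<in> R \<Longrightarrow> y \<in> R \<Longrightarrow> z \<in> R \<Longrightarrow> R \<subseteq> W \<Longrightarrow> (x, z) \<in> cn R"
  by (meson cn_edge cn_trans)

text \<open>Cut sets are described by the sets of the remaining vertices, most of which are small.\<close>

definition rest :: "'v set \<Rightarrow> bool" where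
  "rest R \<longleftrightarrow> R \<subseteq> W \<and> (\<forall>v\<in>W - R. \<exists>a\<in>R. \<exists>b\<in>R. (v, a) \<in> E \<and> (v, b) \<in> E \<and> (a, b) \<notin> cn R)"

lemma cutset_iff_rest: "T \<subseteq> W \<Longrightarrow> cutset W E T \<longleftrightarrow> rest (W - T)"
proof -
  assume T: "T \<subseteq> W"
  then have "W - (W - T) = T" by (rule double_diff) simp
  then show ?thesis
    unfolding cutset_def rest_def using T by (simp only: Diff_subset simp_thms)
qed

lemma restI:
  assumes "parts E W R P"
    and "\<And>v. v \<in> W - R \<Longrightarrow> \<exists>c\<in>P. \<exists>c'\<in>P. c \<noteq> c' \<and> (\<exists>a\<in>c. \<exists>b\<in>c'. (v, a) \<in> E \<and> (v, b) \<in> E)"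
  shows "rest R"
  unfolding rest_def
proof (intro conjI ballI)
  show "R \<subseteq> W" using assms(1) by (simp add: parts_def)
  fix v assume "v \<in> W - R"
  then obtain c c' a b where c: "c \<in> P" "c' \<in> P" "c \<noteq> c'" "a \<in> c" "b \<in> c'" "(v, a) \<in> E" "(v, b) \<in> E"
    using assms(2) by blast
  have "(a, b) \<notin> cn R"
  proof
    assume "(a, b) \<in> cn R"
    then obtain d where "d \<in> P" "a \<in> d" "b \<in> d" using partsD(1)[OF symE assms(1)] by auto
    then have "c = d" "c' = d" using parts_disjoint[OF assms(1)] c by blast+
    then show False using c(3) by simp
  qed
  moreover have "a \<in> R" "b \<in> R" using c parts_Union[OF assms(1)] by auto
  ultimately show "\<exists>a\<in>R. \<exists>b\<in>R. (v, a) \<in> E \<and> (v, b) \<in> E \<and> (a, b) \<notin> cn R"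
    using c(6,7) by (intro bexI[of _ a] bexI[of _ b]) auto
qed

section \<open>Examples of cut sets\<close>

lemma parts_whole: "parts E W W {W}"
  unfolding parts_def
proof (intro conjI ballI impI)
  show "{} \<notin> {W}" using card_sides n by auto
  fix c assume c: "c \<in> {W}"
  obtain h where h: "h \<in> X" using card_sides n fin by (metis card.empty equals0I not_numeral_le_zero)
  have X: "(h, x) \<in> cn W" if x: "x \<in> X" for x
  proof -
    obtain y where y: "y \<in> Y" "y \<notin> N h" "y \<notin> N x" using ex_avoid_N(2)[of h x] h x by auto
    then show ?thesis using h x by (intro cn_path2[of h y x]) (auto simp: adj)
  qed
  have "(h, y) \<in> cn W" if y: "y \<in> Y" for y
  proof -
    obtain x where x: "x \<in> X" "x \<notin> N y" using ex_avoid_N(1)[of y y] y by auto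
    then have "(x, y) \<in> cn W" using y adj(1,3)[of x y] by (intro cn_edge) auto
    then show ?thesis using cn_trans[OF X[OF x(1)]] by auto
  qed
  then show "\<exists>h\<in>c. \<forall>x\<in>c. (h, x) \<in> con W (W - W) E" using X c h by auto
qed auto

lemma parts_side: "parts E W X ((\<lambda>x. {x}) ` X)"
  unfolding parts_def using cn_refl[of _ X] not_adj(1) by auto

lemma rest_side: "rest X"
proof (rule restI[OF parts_side])
  fix v assume "v \<in> W - X"
  then have v: "v \<in> Y" by auto
  obtain a where a: "a \<in> X" "a \<notin> N v" using ex_avoid_N(1)[of v v] v by auto
  have "card (insert a (N v)) \<le> Suc (card (N v))" by (rule card_insert_le_m1) auto
  then have "card (insert a (N v)) < n" using card_N[of v] v n by auto
  then obtain b where b: "b \<in> X" "b \<notin> insert a (N v)"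
    using ex_avoid(1)[of "insert a (N v)"] fin_N[of v] v by auto
  have "(v, a) \<in> E" "(v, b) \<in> E"
    using a b v adj(2,3)[of a v] adj(2,3)[of b v] by auto
  then show "\<exists>c\<in>(\<lambda>x. {x}) ` X. \<exists>c'\<in>(\<lambda>x. {x}) ` X. c \<noteq> c' \<and> (\<exists>a\<in>c. \<exists>b\<in>c'. (v, a) \<in> E \<and> (v, b) \<in> E)"
    using a b by (intro bexI[of _ "{a}"] bexI[of _ "{b}"]) auto
qed

lemma parts_star:
  assumes w: "w \<in> X" and pq: "N w = {p, q}" "p \<noteq> q"
  shows "parts E W (insert w Y) {insert w (Y - {p, q}), {p}, {q}}"
proof -
  have Y: "p \<in> Y" "q \<in> Y" using N_sub(1)[OF w] pq by auto
  have wY: "w \<notin> Y" using w disj by auto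
  have sub: "insert w Y \<subseteq> W" using w by auto
  have "(w, y) \<in> cn (insert w Y)" if "y \<in> insert w (Y - {p, q})" for y
  proof (cases "y = w")
    case True
    then show ?thesis using cn_refl[OF _ sub] by auto
  next
    case False
    then show ?thesis using that w pq by (intro cn_edge) (auto simp: adj)
  qed
  moreover have "(p, p) \<in> cn (insert w Y)" "(q, q) \<in> cn (insert w Y)"
    using cn_refl[OF _ sub] Y by auto
  moreover have "(w, p) \<notin> E" "(w, q) \<notin> E" "(p, w) \<notin> E" "(q, w) \<notin> E" using w Y pq by (auto simp: adj)
  ultimately show ?thesis
    unfolding parts_def using Y w wY pq not_adj(2) by (auto; blast)
qed

lemma rest_star:
  assumes w: "w \<in> X"
  shows "rest (insert w Y)"
proof -
  obtain p q where pq: "N w = {p, q}" "p \<noteq> q" using N_pair[of w] w by auto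
  have Y: "p \<in> Y" "q \<in> Y" using N_sub(1)[OF w] pq by auto
  show ?thesis
  proof (rule restI[OF parts_star[OF w pq]])
    fix v assume "v \<in> W - insert w Y"
    then have v: "v \<in> X" "v \<noteq> w" by auto
    then obtain r where r: "r \<in> N w" "r \<notin> N v" using ex_N_diff[of w v] w by auto
    obtain y where y: "y \<in> Y" "y \<notin> N w" "y \<notin> N v" using ex_avoid_N(2)[of w v] w v by auto
    have "(v, r) \<in> E" "(v, y) \<in> E" using v w r y N_sub(1)[OF w] by (auto simp: adj)
    moreover have "{r} \<in> {insert w (Y - {p, q}), {p}, {q}}" using r pq by auto
    moreover have "insert w (Y - {p, q}) \<noteq> {r}" using y pq r by auto
    moreover have "y \<in> insert w (Y - {p, q})" using y pq by auto
    ultimately show "\<exists>c\<in>{insert w (Y - {p, q}), {p}, {q}}. \<exists>c'\<in>{insert w (Y - {p, q}), {p}, {q}}.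
        c \<noteq> c' \<and> (\<exists>a\<in>c. \<exists>b\<in>c'. (v, a) \<in> E \<and> (v, b) \<in> E)"
      by (intro bexI[of _ "insert w (Y - {p, q})"] bexI[of _ "{r}"]) auto
  qed
qed

lemma parts_isolated:
  assumes w: "w \<in> X"
  shows "parts E W (X \<union> N w) {{w}, (X - {w}) \<union> N w}"
proof -
  obtain p q where pq: "N w = {p, q}" "p \<noteq> q" using N_pair[of w] w by auto
  have Y: "p \<in> Y" "q \<in> Y" using N_sub(1)[OF w] pq by auto
  have wY: "w \<notin> Y" using w disj by auto
  have sub: "X \<union> N w \<subseteq> W" using Y pq by auto
  obtain h where h: "h \<in> X" "h \<notin> N p" "h \<notin> N q" using ex_avoid_N(1)[of p q] Y by auto
  have hw: "h \<noteq> w" using h pq w Y N_sym[of w p] by auto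
  have hp: "(h, p) \<in> cn (X \<union> N w)" "(h, q) \<in> cn (X \<union> N w)"
    using h Y pq adj(1,3)[of h p] adj(1,3)[of h q] by (auto intro!: cn_edge)
  have "(h, x) \<in> cn (X \<union> N w)" if x: "x \<in> (X - {w}) \<union> N w" for x
  proof (cases "x \<in> N w")
    case True
    then show ?thesis using hp pq by auto
  next
    case False
    then have x: "x \<in> X" "x \<noteq> w" using x by auto
    then obtain r where r: "r \<in> N w" "r \<notin> N x" using ex_N_diff[of w x] w by auto
    then have "(r, x) \<in> cn (X \<union> N w)"
      using x N_sub(1)[OF w] by (intro cn_edge) (auto simp: adj)
    moreover have "(h, r) \<in> cn (X \<union> N w)" using r hp pq by auto
    ultimately show ?thesis using cn_trans sub by blast
  qed
  moreover have "(w, w) \<in> cn (X \<union> N w)" using cn_refl[OF _ sub] w by auto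
  moreover have "(w, y) \<notin> E" "(y, w) \<notin> E" if "y \<in> (X - {w}) \<union> N w" for y
    using that w N_sub(1)[OF w] not_adj(1) by (auto simp: adj)
  moreover have "w \<notin> N w" using wY N_sub(1)[OF w] by auto
  ultimately show ?thesis
    unfolding parts_def using sub w h(1) hw by (intro conjI) auto
qed

lemma rest_isolated:
  assumes w: "w \<in> X"
  shows "rest (X \<union> N w)"
proof (rule restI[OF parts_isolated[OF w]])
  fix v assume "v \<in> W - (X \<union> N w)"
  then have v: "v \<in> Y" "v \<notin> N w" by auto
  have "card (insert w (N v)) \<le> Suc (card (N v))" by (rule card_insert_le_m1) auto
  then have "card (insert w (N v)) < n" using card_N[of v] v n by auto
  then obtain b where b: "b \<in> X" "b \<notin> insert w (N v)"
    using ex_avoid(1)[of "insert w (N v)"] fin_N[of v] v by auto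
  have "(v, w) \<in> E" "(v, b) \<in> E"
    using b v w adj(2,3)[of w v] adj(2,3)[of b v] by auto
  then show "\<exists>c\<in>{{w}, X - {w} \<union> N w}. \<exists>c'\<in>{{w}, X - {w} \<union> N w}.
      c \<noteq> c' \<and> (\<exists>a\<in>c. \<exists>b\<in>c'. (v, a) \<in> E \<and> (v, b) \<in> E)"
    using b by (intro bexI[of _ "{w}"] bexI[of _ "X - {w} \<union> N w"]) auto
qed

lemma parts_two_centres:
  assumes w: "w \<in> X" "w' \<in> X" and N: "N w \<inter> N w' = {}"
  shows "parts E W ({w, w'} \<union> N w \<union> N w') {insert w (N w'), insert w' (N w)}"
proof -
  let ?R = "{w, w'} \<union> N w \<union> N w'"
  have NY: "N w \<subseteq> Y" "N w' \<subseteq> Y" using N_sub(1) w by auto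
  have sub: "?R \<subseteq> W" using w NY by auto
  have ne: "w \<noteq> w'" using N card_N[of w] w by auto
  have "(w, x) \<in> cn ?R" if x: "x \<in> insert w (N w')" for x
  proof (cases "x = w")
    case True
    then show ?thesis using cn_refl[OF _ sub] by auto
  next
    case False
    then have "x \<in> N w'" "x \<in> Y" "x \<notin> N w" using x N NY by auto
    then show ?thesis using adj(1)[of w x] w by (intro cn_edge) auto
  qed
  moreover have "(w', x) \<in> cn ?R" if x: "x \<in> insert w' (N w)" for x
  proof (cases "x = w'")
    case True
    then show ?thesis using cn_refl[OF _ sub] by auto
  next
    case False
    then have "x \<in> N w" "x \<in> Y" "x \<notin> N w'" using x N NY by auto
    then show ?thesis using adj(1)[of w' x] w by (intro cn_edge) auto
  qed
  moreover have "(x, y) \<notin> E" "(y, x) \<notin> E" if "x \<in> insert w (N w')" "y \<in> insert w' (N w)" for x y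
    using that w NY not_adj by (auto simp: adj subset_iff)
  moreover have "insert w (N w') \<inter> insert w' (N w) = {}" using ne N w NY disj by auto
  ultimately show ?thesis
    unfolding parts_def using sub by (intro conjI) auto
qed

lemma rest_two_centres:
  assumes w: "w \<in> X" "w' \<in> X" and N: "N w \<inter> N w' = {}"
  shows "rest ({w, w'} \<union> N w \<union> N w')"
proof (rule restI[OF parts_two_centres[OF assms]])
  have NY: "N w \<subseteq> Y" "N w' \<subseteq> Y" using N_sub(1) w by auto
  obtain r where "r \<in> N w" using N_pair[of w] w by auto
  then have "r \<notin> insert w (N w')" using N w NY disj by auto
  then have ne: "insert w (N w') \<noteq> insert w' (N w)" using \<open>r \<in> N w\<close> by auto
  fix v assume v: "v \<in> W - ({w, w'} \<union> N w \<union> N w')"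
  have "\<exists>a\<in>insert w (N w'). \<exists>b\<in>insert w' (N w). (v, a) \<in> E \<and> (v, b) \<in> E"
  proof (cases "v \<in> X")
    case True
    then obtain p where p: "p \<in> N w'" "p \<notin> N v" using ex_N_diff[of w' v] w v by auto
    obtain q where q: "q \<in> N w" "q \<notin> N v" using ex_N_diff[of w v] w v True by auto
    have "(v, p) \<in> E" "(v, q) \<in> E" using True p q NY by (auto simp: adj)
    then show ?thesis using p q by blast
  next
    case False
    then have "(v, w) \<in> E" "(v, w') \<in> E" using v w by (auto simp: adj)
    then show ?thesis by blast
  qed
  then show "\<exists>c\<in>{insert w (N w'), insert w' (N w)}. \<exists>c'\<in>{insert w (N w'), insert w' (N w)}.
      c \<noteq> c' \<and> (\<exists>a\<in>c. \<exists>b\<in>c'. (v, a) \<in> E \<and> (v, b) \<in> E)"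
    using ne by (intro bexI[of _ "insert w (N w')"] bexI[of _ "insert w' (N w)"]) simp_all
qed

lemma parts_edge:
  assumes u: "u \<in> X" and v: "v \<in> Y" and uv: "v \<notin> N u"
  shows "parts E W ({u, v} \<union> N u \<union> N v) {{u, v}, N u \<union> N v}"
proof -
  let ?R = "{u, v} \<union> N u \<union> N v"
  have NY: "N u \<subseteq> Y" and NX: "N v \<subseteq> X" using N_sub u v by auto
  have sub: "?R \<subseteq> W" using u v NX NY by auto
  have vu: "u \<notin> N v" using uv adj(3)[OF u v] by simp
  obtain p q where pq: "N u = {p, q}" "p \<noteq> q" using N_pair[of u] u by auto
  obtain x y where xy: "N v = {x, y}" "x \<noteq> y" using N_pair[of v] v by auto
  have mem: "p \<in> Y" "q \<in> Y" "x \<in> X" "y \<in> X" using pq xy NX NY by auto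
  have vN: "v \<in> N x" "v \<in> N y" "u \<in> N p" "u \<in> N q"
    using N_sym[of v x] N_sym[of v y] N_sym[of u p] N_sym[of u q] mem pq xy u v by auto
  \<comment> \<open>At most one of the four pairs between the two sides is a non-edge.\<close>
  have 1: "\<not> (p \<in> N x \<and> q \<in> N x)" "\<not> (p \<in> N y \<and> q \<in> N y)"
    using common_N[of x u p q] common_N[of y u p q] pq mem u xy vu by auto
  have 2: "\<not> (p \<in> N x \<and> p \<in> N y)" "\<not> (q \<in> N x \<and> q \<in> N y)"
    using common_N[of p v x y] common_N[of q v x y] xy mem v pq uv by (auto simp: adj)
  have 3: "\<not> (q \<in> N x \<and> p \<in> N y)" "\<not> (p \<in> N x \<and> q \<in> N y)"
    using no_hexagon[of u q p x y v] no_hexagon[of u p q x y v] u mem pq vN xy vu by (auto simp: adj)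
  have e: "(a, b) \<in> cn ?R" "(b, a) \<in> cn ?R" if "a \<in> {x, y}" "b \<in> {p, q}" "b \<notin> N a" for a b
    using that mem pq xy by (auto intro!: cn_edge simp: adj)
  have t: "(a, d) \<in> cn ?R" if "(a, b) \<in> cn ?R" "(b, c) \<in> cn ?R" "(c, d) \<in> cn ?R" for a b c d
    using that cn_trans sub by blast
  have t2: "(a, c) \<in> cn ?R" if "(a, b) \<in> cn ?R" "(b, c) \<in> cn ?R" for a b c
    using that cn_trans sub by blast
  have xx: "(x, x) \<in> cn ?R" using cn_refl[OF _ sub] xy by auto
  have "(x, a) \<in> cn ?R" if "a \<in> {x, y, p, q}" for a
  proof -
    consider "p \<in> N x" "q \<notin> N x" "p \<notin> N y" "q \<notin> N y" | "p \<notin> N x" "q \<in> N x" "p \<notin> N y" "q \<notin> N y"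
      | "p \<notin> N x" "q \<notin> N x" "p \<notin> N y \<or> q \<notin> N y" using 1 2 3 by blast
    then show ?thesis
    proof cases
      case 1
      then have "(x, q) \<in> cn ?R" "(q, y) \<in> cn ?R" "(y, p) \<in> cn ?R" using e by auto
      then show ?thesis using that xx t t2 by blast
    next
      case 2
      then have "(x, p) \<in> cn ?R" "(p, y) \<in> cn ?R" "(y, q) \<in> cn ?R" using e by auto
      then show ?thesis using that xx t t2 by blast
    next
      case 3
      then have "(x, p) \<in> cn ?R" "(x, q) \<in> cn ?R" "(p, y) \<in> cn ?R \<or> (q, y) \<in> cn ?R" using e by auto
      then show ?thesis using that xx t2 by blast
    qed
  qed
  then have "\<exists>h\<in>N u \<union> N v. \<forall>a\<in>N u \<union> N v. (h, a) \<in> cn ?R" using pq xy by auto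
  moreover have "(u, v) \<in> cn ?R" "(u, u) \<in> cn ?R"
    using cn_refl[OF _ sub] u v uv by (auto intro!: cn_edge simp: adj)
  moreover have "(a, b) \<notin> E" "(b, a) \<notin> E" if ab: "a \<in> {u, v}" "b \<in> N u \<union> N v" for a b
  proof -
    have "v \<in> N b" if "b \<in> N v" using that adj(3)[of b v] v NX by auto
    then show "(a, b) \<notin> E" "(b, a) \<notin> E"
      using ab u v NX NY not_adj by (auto simp: adj subset_iff)
  qed
  moreover have "{u, v} \<inter> (N u \<union> N v) = {}" using u v uv vu NX NY disj by auto
  ultimately show ?thesis
    unfolding parts_def using sub pq by (intro conjI) auto
qed

lemma rest_edge:
  assumes u: "u \<in> X" and v: "v \<in> Y" and uv: "v \<notin> N u"
  shows "rest ({u, v} \<union> N u \<union> N v)"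
proof (rule restI[OF parts_edge[OF assms]])
  have NY: "N u \<subseteq> Y" and NX: "N v \<subseteq> X" using N_sub u v by auto
  have vu: "u \<notin> N v" using uv adj(3)[OF u v] by simp
  then have ne: "{u, v} \<noteq> N u \<union> N v" using u v NX NY disj by auto
  fix t assume t: "t \<in> W - ({u, v} \<union> N u \<union> N v)"
  have "\<exists>a\<in>{u, v}. \<exists>b\<in>N u \<union> N v. (t, a) \<in> E \<and> (t, b) \<in> E"
  proof (cases "t \<in> X")
    case True
    then obtain p where p: "p \<in> N u" "p \<notin> N t" using ex_N_diff[of u t] u t by auto
    have "(t, p) \<in> E" using True p NY by (auto simp: adj)
    moreover have "(t, v) \<in> E" using True t v N_sym[of t v] by (auto simp: adj)
    ultimately show ?thesis using p by blast
  next
    case False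
    then have tY: "t \<in> Y" using t by auto
    then obtain x where x: "x \<in> N v" "x \<notin> N t" using ex_N_diff[of v t] v t by auto
    have "(t, x) \<in> E" using tY x NX N_sym[of x t] by (auto simp: adj)
    moreover have "(t, u) \<in> E" using tY t u by (auto simp: adj)
    ultimately show ?thesis using x by blast
  qed
  then show "\<exists>c\<in>{{u, v}, N u \<union> N v}. \<exists>c'\<in>{{u, v}, N u \<union> N v}.
      c \<noteq> c' \<and> (\<exists>a\<in>c. \<exists>b\<in>c'. (t, a) \<in> E \<and> (t, b) \<in> E)"
    using ne by (intro bexI[of _ "{u, v}"] bexI[of _ "N u \<union> N v"]) simp_all
qed

lemma path_of_length_4:
  assumes w: "w \<in> X"
  obtains a b a' b' where "N w = {a, b}" "N a = {w, a'}" "N b = {w, b'}" "a \<noteq> b" "a' \<noteq> w" "b' \<noteq> w" "a' \<noteq> b'"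
    "a \<in> Y" "b \<in> Y" "a' \<in> X" "b' \<in> X"
proof -
  obtain a b where ab: "N w = {a, b}" "a \<noteq> b" using N_pair[of w] w by auto
  have Y: "a \<in> Y" "b \<in> Y" using N_sub(1)[OF w] ab by auto
  have wN: "w \<in> N a" "w \<in> N b" using N_sym[of w a] N_sym[of w b] w Y ab by auto
  obtain a' where a': "N a = {w, a'}" "a' \<noteq> w" using N_pair[of a] Y wN(1) by (metis UnCI doubleton_eq_iff insertE singletonD)
  obtain b' where b': "N b = {w, b'}" "b' \<noteq> w" using N_pair[of b] Y wN(2) by (metis UnCI doubleton_eq_iff insertE singletonD)
  have "a' \<noteq> b'" using N_inj[of a b] a' b' Y ab by auto
  moreover have "a' \<in> X" "b' \<in> X" using N_sub(2) Y a' b' by auto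
  ultimately show thesis using that ab a' b' Y by blast
qed

lemma parts_path:
  assumes w: "w \<in> X" and N: "N w = {a, b}" "N a = {w, a'}" "N b = {w, b'}" "a \<noteq> b" "a' \<noteq> w" "b' \<noteq> w" "a' \<noteq> b'"
    and mem: "a \<in> Y" "b \<in> Y" "a' \<in> X" "b' \<in> X"
  shows "parts E W (N w \<union> \<Union>(N ` N w)) {{w}, {a, b'}, {b, a'}}"
proof -
  have R: "N w \<union> \<Union>(N ` N w) = {w, a, b, a', b'}" using N by auto
  have sub: "{w, a, b, a', b'} \<subseteq> W" using w mem by auto
  have ne: "w \<noteq> a" "w \<noteq> b" "a \<noteq> a'" "a \<noteq> b'" "b \<noteq> a'" "b \<noteq> b'" using w mem disj by auto
  have adj': "(x, y) \<in> E \<longleftrightarrow> x \<notin> N y" "(y, x) \<in> E \<longleftrightarrow> x \<notin> N y" if "x \<in> X" "y \<in> Y" for x y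
    using adj[OF that] by auto
  have edges: "(a, b') \<in> E" "(b, a') \<in> E" using mem N by (auto simp: adj')
  have non: "(w, a) \<notin> E" "(a, w) \<notin> E" "(w, b) \<notin> E" "(b, w) \<notin> E" "(a, a') \<notin> E" "(a', a) \<notin> E"
    "(b, b') \<notin> E" "(b', b) \<notin> E" using w mem N by (auto simp: adj')
  have non2: "(x, y) \<notin> E" if "x \<in> {w, a', b'} \<and> y \<in> {w, a', b'} \<or> x \<in> {a, b} \<and> y \<in> {a, b}" for x y
    using that w mem not_adj by auto
  have "(w, w) \<in> cn {w, a, b, a', b'}" "(a, a) \<in> cn {w, a, b, a', b'}" "(b, b) \<in> cn {w, a, b, a', b'}"
    using cn_refl[OF _ sub] by auto
  moreover have "(a, b') \<in> cn {w, a, b, a', b'}" "(b, a') \<in> cn {w, a, b, a', b'}"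
    using edges by (auto intro!: cn_edge)
  ultimately show ?thesis
    unfolding R parts_def using sub ne non non2 N(4-7) by (intro conjI) auto
qed

lemma rest_path:
  assumes w: "w \<in> X"
  shows "rest (N w \<union> \<Union>(N ` N w))"
proof -
  obtain a b a' b' where N: "N w = {a, b}" "N a = {w, a'}" "N b = {w, b'}" "a \<noteq> b" "a' \<noteq> w" "b' \<noteq> w" "a' \<noteq> b'"
    and mem: "a \<in> Y" "b \<in> Y" "a' \<in> X" "b' \<in> X" by (rule path_of_length_4[OF w])
  have R: "N w \<union> \<Union>(N ` N w) = {w, a, b, a', b'}" using N by auto
  have ne: "w \<noteq> a" "w \<noteq> b" "a \<noteq> a'" "a \<noteq> b'" "b \<noteq> a'" "b \<noteq> b'" using w mem disj by auto
  show ?thesis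
  proof (rule restI[OF parts_path[OF w N mem]])
    fix t assume t: "t \<in> W - (N w \<union> \<Union>(N ` N w))"
    show "\<exists>c\<in>{{w}, {a, b'}, {b, a'}}. \<exists>c'\<in>{{w}, {a, b'}, {b, a'}}.
        c \<noteq> c' \<and> (\<exists>x\<in>c. \<exists>y\<in>c'. (t, x) \<in> E \<and> (t, y) \<in> E)"
    proof (cases "t \<in> X")
      case True
      have "(t, a) \<in> E" "(t, b) \<in> E"
        using True t mem N N_sym[of t a] N_sym[of t b] unfolding R by (auto simp: adj)
      moreover have "{a, b'} \<noteq> {b, a'}" using N(4) ne by auto
      ultimately show ?thesis by (intro bexI[of _ "{a, b'}"] bexI[of _ "{b, a'}"]) simp_all
    next
      case False
      then have tY: "t \<in> Y" "t \<noteq> a" "t \<noteq> b" using t R by auto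
      then have tw: "(t, w) \<in> E" using w N by (auto simp: adj)
      have "\<not> (t \<in> N a' \<and> t \<in> N b')"
        using no_hexagon[of w a b a' b' t] w N by auto
      then have "(t, a') \<in> E \<or> (t, b') \<in> E" using tY mem by (auto simp: adj)
      then show ?thesis
      proof
        assume "(t, a') \<in> E"
        moreover have "{w} \<noteq> {b, a'}" using ne by auto
        ultimately show ?thesis using tw by (intro bexI[of _ "{w}"] bexI[of _ "{b, a'}"]) simp_all
      next
        assume "(t, b') \<in> E"
        moreover have "{w} \<noteq> {a, b'}" using ne by auto
        ultimately show ?thesis using tw by (intro bexI[of _ "{w}"] bexI[of _ "{a, b'}"]) simp_all
      qed
    qed
  qed
qed

section \<open>Classification of the cut sets\<close>

lemma rest_swap: "cocycle.rest Y X N = rest"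
proof -
  interpret D: cocycle Y X N n by (rule cocycle_swap[OF cocycle_axioms])
  show ?thesis
    by (rule ext) (simp only: D.rest_def rest_def co_edges_swap[of Y X N] Un_commute[of Y X])
qed

lemma rest_sub: "rest R \<Longrightarrow> R \<subseteq> W"
  by (simp add: rest_def)

lemma rest_cover:
  assumes "rest R" "x \<in> X" "\<And>a b. a \<in> R \<Longrightarrow> b \<in> R \<Longrightarrow> a \<in> Y \<Longrightarrow> b \<in> Y \<Longrightarrow> x \<notin> N a \<Longrightarrow> x \<notin> N b \<Longrightarrow> (a, b) \<in> cn R"
  shows "x \<in> R"
proof (rule ccontr)
  assume "x \<notin> R"
  then obtain a b where ab: "a \<in> R" "b \<in> R" "(x, a) \<in> E" "(x, b) \<in> E" "(a, b) \<notin> cn R"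
    using assms(1,2) unfolding rest_def by blast
  then have "a \<in> Y" "b \<in> Y" using assms(2) disj by (auto simp: co_edges_def)
  then show False using ab assms(2,3) adj(1,3)[of x] by blast
qed

lemma rest_no_Y:
  assumes "rest R" "R \<inter> Y = {}"
  shows "R = X"
  using rest_cover[OF assms(1)] assms(2) rest_sub[OF assms(1)] by blast

lemma rest_one_Y:
  assumes "rest R" "R \<inter> Y = {y}"
  shows "R = insert y X"
proof -
  have "x \<in> R" if "x \<in> X" for x
  proof (rule rest_cover[OF assms(1) that])
    fix a b assume "a \<in> R" "b \<in> R" "a \<in> Y" "b \<in> Y"
    then have "a = y" "b = y" using assms(2) by blast+
    then show "(a, b) \<in> cn R" using cn_refl[of y R] assms(2) rest_sub[OF assms(1)] by blast
  qed
  then show ?thesis using assms(2) rest_sub[OF assms(1)] by blast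
qed

text \<open>The remaining vertices in \<open>Y\<close> are the elements \<open>p\<close> and \<open>q\<close> of \<open>N w\<close>. A deleted vertex of \<open>X\<close> sees
  both of them, and they lie in different components. So if there is one, no remaining vertex of \<open>X\<close>
  sees both, while the vertices that miss one of them must remain.\<close>

lemma rest_isolated_cases:
  assumes R: "rest R" and w: "w \<in> R" "w \<in> X" and iso: "\<And>b. b \<in> R \<Longrightarrow> (w, b) \<notin> E"
    and two: "card (R \<inter> Y) \<ge> 2"
  shows "R = X \<union> N w \<or> R = N w \<union> \<Union>(N ` N w)"
proof -
  have sub: "R \<subseteq> W" by (rule rest_sub[OF R])
  have "R \<inter> Y \<subseteq> N w" using iso w(2) adj(1)[of w] by blast
  then have RY: "R \<inter> Y = N w" using two w by (intro N_eq_of_sub) auto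
  obtain p q where pq: "N w = {p, q}" "p \<noteq> q" using N_pair[of w] w by auto
  have Y: "p \<in> Y" "q \<in> Y" "p \<in> R" "q \<in> R" using RY pq by auto
  show ?thesis
  proof (cases "X \<subseteq> R")
    case True
    then have "R = X \<union> N w" using sub RY by blast
    then show ?thesis ..
  next
    case False
    have out: "x \<notin> N p \<and> x \<notin> N q \<and> (p, q) \<notin> cn R" if x: "x \<in> X" "x \<notin> R" for x
    proof (rule ccontr)
      assume c: "\<not> ?thesis"
      have "x \<in> R"
      proof (rule rest_cover[OF R x(1)])
        fix a b assume ab: "a \<in> R" "b \<in> R" "a \<in> Y" "b \<in> Y" "x \<notin> N a" "x \<notin> N b"
        then have "a \<in> {p, q}" "b \<in> {p, q}" using RY pq by auto
        then consider "a = b" | "(a, b) = (p, q)" | "(a, b) = (q, p)" by auto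
        then show "(a, b) \<in> cn R"
        proof cases
          case 1
          then show ?thesis using cn_refl[of a R] ab sub by simp
        next
          case 2
          then show ?thesis using c ab by simp
        next
          case 3
          then have "(p, q) \<in> cn R" using c ab by simp
          then show ?thesis using cn_sym[of p q R] sub 3 by simp
        qed
      qed
      then show False using x by simp
    qed
    then have pq': "(p, q) \<notin> cn R" using False by blast
    have "r \<in> N p \<union> N q" if r: "r \<in> R" "r \<in> X" for r
    proof (rule ccontr)
      assume c: "r \<notin> N p \<union> N q"
      then have "(p, r) \<in> E" "(r, q) \<in> E" using r Y adj[of r p] adj[of r q] by auto
      then show False using cn_path2[of p r q R] r Y sub pq' by blast
    qed
    moreover have "N p \<union> N q \<subseteq> R"
      using out N_sub(2)[OF Y(1)] N_sub(2)[OF Y(2)] by blast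
    moreover have "N p \<union> N q \<subseteq> X" using N_sub(2) Y by blast
    ultimately have "R \<inter> X = N p \<union> N q" by blast
    then have "R = N w \<union> \<Union>(N ` N w)" using sub RY pq by auto
    then show ?thesis ..
  qed
qed

text \<open>As \<open>a\<close> and \<open>b\<close> are not adjacent, \<open>N a\<close> consists of \<open>b\<close> and another vertex \<open>l\<close>. If \<open>l\<close> were deleted,
  its remaining neighbours would be in \<open>D\<close>, where all of them see \<open>b\<close>, so \<open>l\<close> would not separate
  anything. Hence \<open>l\<close> is in \<open>C\<close>, together with a neighbour of \<open>a\<close>.\<close>

lemma rest_split_two:
  assumes R: "rest R" and CD: "R = C \<union> D" and cross: "\<And>x y. x \<in> C \<Longrightarrow> y \<in> D \<Longrightarrow> (x, y) \<notin> E \<and> (y, x) \<notin> E"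
    and noniso: "\<And>v. v \<in> R \<Longrightarrow> \<exists>u\<in>R. (v, u) \<in> E"
    and a: "C \<inter> X = {a}" and b: "D \<inter> Y = {b}"
  shows "card (C \<inter> Y) \<ge> 2"
proof -
  have sub: "R \<subseteq> W" by (rule rest_sub[OF R])
  have aX: "a \<in> X" "a \<in> C" and bY: "b \<in> Y" "b \<in> D" using a b by auto
  have "b \<in> N a" using cross[OF aX(2) bY(2)] adj(1)[OF aX(1) bY(1)] by simp
  then obtain l where l: "N a = {b, l}" "l \<noteq> b" using N_pair[of a] aX by (metis UnCI doubleton_eq_iff insertE singletonD)
  then have lY: "l \<in> Y" using N_sub(1)[OF aX(1)] by auto
  have toY: "y \<in> Y" if "(x, y) \<in> E" "x \<in> X" for x y using that disj by (auto simp: co_edges_def)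
  have "l \<in> R"
  proof (rule ccontr)
    assume "l \<notin> R"
    then obtain x y where xy: "x \<in> R" "y \<in> R" "(l, x) \<in> E" "(l, y) \<in> E" "(x, y) \<notin> cn R"
      using R lY unfolding rest_def by blast
    have b: "(z, b) \<in> E" if z: "z \<in> R" "(l, z) \<in> E" for z
    proof -
      have zX: "z \<in> X" using z lY disj by (auto simp: co_edges_def)
      have "z \<noteq> a" using z(2) l(1) adj(2)[OF aX(1) lY] by auto
      then have zD: "z \<in> D" using zX z(1) CD a by auto
      obtain u where u: "u \<in> R" "(z, u) \<in> E" using noniso[OF z(1)] by auto
      then have "u \<in> D" using cross[of u z] zD CD by auto
      moreover have "u \<in> Y" using toY u zX by auto
      ultimately have "u = b" using b by auto
      then show ?thesis using u by simp
    qed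
    have "(x, b) \<in> E" "(b, y) \<in> E" using b xy symE by (auto simp: sym_def)
    then have "(x, y) \<in> cn R" using xy bY CD sub by (intro cn_path2[of x b y]) auto
    then show False using xy by simp
  qed
  then have lC: "l \<in> C \<inter> Y" using CD b l(2) lY by auto
  obtain u where u: "u \<in> R" "(a, u) \<in> E" using noniso[of a] aX CD by auto
  then have uY: "u \<in> Y" using toY aX by auto
  have "u \<in> C" using cross[of a u] u aX CD by auto
  moreover have "u \<noteq> l" using u(2) l(1) adj(1)[OF aX(1) uY] by auto
  ultimately have "{l, u} \<subseteq> C \<inter> Y" "card {l, u} = 2" using lC uY by auto
  moreover have "finite (C \<inter> Y)" using fin by simp
  ultimately show ?thesis using card_mono[of "C \<inter> Y" "{l, u}"] by simp
qed

text \<open>Without isolated vertices both parts of a separation meet both sides. The two pairs of opposite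
  parts consist of non-edges, hence have at most \<open>1 + 2\<close> elements each as there is no cycle of
  length 4. If one of them had only \<open>1 + 1\<close> elements, the previous lemma would give \<open>2 + 2\<close> elements in
  the other one.\<close>

lemma rest_no_isolated_cases:
  assumes R: "rest R" "R \<noteq> W" and noniso: "\<And>v. v \<in> R \<Longrightarrow> \<exists>u\<in>R. (v, u) \<in> E"
  shows "(\<exists>w\<in>X. \<exists>w'\<in>X. N w \<inter> N w' = {} \<and> R = {w, w'} \<union> N w \<union> N w')
    \<or> (\<exists>w\<in>Y. \<exists>w'\<in>Y. N w \<inter> N w' = {} \<and> R = {w, w'} \<union> N w \<union> N w')
    \<or> (\<exists>u\<in>X. \<exists>v\<in>Y. v \<notin> N u \<and> R = {u, v} \<union> N u \<union> N v)"
proof -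
  interpret D: cocycle Y X N n by (rule cocycle_swap[OF cocycle_axioms])
  have sub: "R \<subseteq> W" by (rule rest_sub[OF R(1)])
  obtain v where "v \<in> W - R" using R sub by auto
  then obtain a0 b0 where ab0: "a0 \<in> R" "b0 \<in> R" "(a0, b0) \<notin> cn R"
    using R(1) unfolding rest_def by blast
  define C where "C = {x \<in> R. (a0, x) \<in> cn R}"
  define D where "D = R - C"
  have CD: "R = C \<union> D" "C \<inter> D = {}" by (auto simp: C_def D_def)
  have cross: "(x, y) \<notin> E \<and> (y, x) \<notin> E" if xy: "x \<in> C" "y \<in> D" for x y
  proof -
    have "(x, y) \<notin> E"
    proof
      assume "(x, y) \<in> E"
      then have "(x, y) \<in> cn R" using xy CD by (intro cn_edge) auto
      then have "(a0, y) \<in> cn R" using cn_trans[of a0 x R y] xy sub by (auto simp: C_def)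
      then show False using xy by (auto simp: C_def D_def)
    qed
    then show ?thesis using symE by (auto simp: sym_def)
  qed
  have a0: "a0 \<in> C" using ab0 cn_refl[of a0 R] sub by (auto simp: C_def)
  have b0: "b0 \<in> D" using ab0 by (auto simp: C_def D_def)
  have sides: "S \<inter> X \<noteq> {} \<and> S \<inter> Y \<noteq> {}" if S: "S = C \<and> S' = D \<or> S = D \<and> S' = C" "s \<in> S" for S S' s
  proof -
    have "s \<in> R" using S CD by auto
    then obtain u where u: "u \<in> R" "(s, u) \<in> E" using noniso by blast
    then have "u \<in> S" using S cross CD by blast
    then show ?thesis using S(2) u(2) by (auto simp: co_edges_def)
  qed
  have ne: "C \<inter> X \<noteq> {}" "C \<inter> Y \<noteq> {}" "D \<inter> X \<noteq> {}" "D \<inter> Y \<noteq> {}"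
    using sides[of C D a0] sides[of D C b0] a0 b0 by auto
  have opp: "y \<in> N x" "x \<in> N y" if "x \<in> C \<and> y \<in> D \<or> x \<in> D \<and> y \<in> C" "x \<in> X" "y \<in> Y" for x y
    using that cross adj(1,3)[of x y] by blast+
  have not_both: "\<not> (card (S \<inter> X) \<ge> 2 \<and> card (S' \<inter> Y) \<ge> 2)" if S: "S = C \<and> S' = D \<or> S = D \<and> S' = C" for S S'
  proof
    assume c: "card (S \<inter> X) \<ge> 2 \<and> card (S' \<inter> Y) \<ge> 2"
    have two: "\<exists>x y. x \<in> A \<and> y \<in> A \<and> x \<noteq> y" if "card A \<ge> 2" for A :: "'v set"
      using that card_le_Suc0_iff_eq[of A] by (metis card.infinite not_less_eq_eq numeral_2_eq_2 zero_le)
    obtain x y where xy: "x \<in> S \<inter> X" "y \<in> S \<inter> X" "x \<noteq> y" using two c by blast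
    obtain p q where pq: "p \<in> S' \<inter> Y" "q \<in> S' \<inter> Y" "p \<noteq> q" using two c by blast
    have "p \<in> N x" "q \<in> N x" "p \<in> N y" "q \<in> N y" using xy pq S opp by auto
    then show False using common_N[of x y p q] xy pq by auto
  qed
  have small: "\<not> (card (S \<inter> X) = 1 \<and> card (S' \<inter> Y) = 1)" if S: "S = C \<and> S' = D \<or> S = D \<and> S' = C" for S S'
  proof
    assume "card (S \<inter> X) = 1 \<and> card (S' \<inter> Y) = 1"
    then obtain a b where a: "S \<inter> X = {a}" and b: "S' \<inter> Y = {b}" by (auto simp: card_1_singleton_iff)
    have SS: "R = S \<union> S'" "R = S' \<union> S" using S CD by auto
    have cr: "(x, y) \<notin> E \<and> (y, x) \<notin> E" if "x \<in> S" "y \<in> S'" for x y using S that cross by blast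
    have "card (S \<inter> Y) \<ge> 2" by (rule rest_split_two[OF R(1) SS(1) cr noniso a b])
    moreover have "card (S' \<inter> X) \<ge> 2"
    proof (rule D.rest_split_two[of R S' S b a])
      show "D.rest R" using R(1) by (simp add: rest_swap)
      show "R = S' \<union> S" by (rule SS(2))
      show "(x, y) \<notin> co_edges Y X N \<and> (y, x) \<notin> co_edges Y X N" if "x \<in> S'" "y \<in> S" for x y
        using cr[OF that(2,1)] by (simp add: co_edges_swap[of Y X N])
      show "\<exists>u\<in>R. (v, u) \<in> co_edges Y X N" if "v \<in> R" for v
        using noniso[OF that] by (simp add: co_edges_swap[of Y X N])
    qed (rule b, rule a)
    ultimately show False using not_both[of S' S] S by auto
  qed
  have dich: "(\<exists>a\<in>X. S \<inter> X = {a} \<and> S' \<inter> Y = N a) \<or> (\<exists>b\<in>Y. S' \<inter> Y = {b} \<and> S \<inter> X = N b)"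
    if S: "S = C \<and> S' = D \<or> S = D \<and> S' = C" for S S'
  proof -
    have fin': "finite (S \<inter> X)" "finite (S' \<inter> Y)" using fin by auto
    have "S \<inter> X \<noteq> {}" "S' \<inter> Y \<noteq> {}" using S ne by auto
    then have pos: "card (S \<inter> X) > 0" "card (S' \<inter> Y) > 0" using fin' by (auto simp: card_gt_0_iff)
    have "card (S \<inter> X) = 1 \<or> card (S \<inter> X) \<ge> 2" "card (S' \<inter> Y) = 1 \<or> card (S' \<inter> Y) \<ge> 2"
      using pos by linarith+
    then consider "card (S \<inter> X) = 1" "card (S' \<inter> Y) \<ge> 2" | "card (S \<inter> X) \<ge> 2" "card (S' \<inter> Y) = 1"
      using not_both[OF S] small[OF S] by blast
    then show ?thesis
    proof cases
      case 1
      then obtain a where a: "S \<inter> X = {a}" by (auto simp: card_1_singleton_iff)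
      then have aX: "a \<in> X" "a \<in> S" by auto
      then have "S' \<inter> Y \<subseteq> N a" using S opp by blast
      then have "S' \<inter> Y = N a" using 1 aX by (intro N_eq_of_sub) auto
      then show ?thesis using a aX by blast
    next
      case 2
      then obtain b where b: "S' \<inter> Y = {b}" by (auto simp: card_1_singleton_iff)
      then have bY: "b \<in> Y" "b \<in> S'" by auto
      then have "S \<inter> X \<subseteq> N b" using S opp by blast
      then have "S \<inter> X = N b" using 2 bY by (intro N_eq_of_sub) auto
      then show ?thesis using b bY by blast
    qed
  qed
  have Rsplit: "R = (C \<inter> X) \<union> (D \<inter> Y) \<union> (D \<inter> X) \<union> (C \<inter> Y)" using sub CD by blast
  have dis: "(D \<inter> Y) \<inter> (C \<inter> Y) = {}" "(D \<inter> X) \<inter> (C \<inter> X) = {}" using CD by auto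
  from dich[of C D] dich[of D C]
  consider a a' where "a \<in> X" "C \<inter> X = {a}" "D \<inter> Y = N a" "a' \<in> X" "D \<inter> X = {a'}" "C \<inter> Y = N a'"
    | a b where "a \<in> X" "C \<inter> X = {a}" "D \<inter> Y = N a" "b \<in> Y" "C \<inter> Y = {b}" "D \<inter> X = N b"
    | a b where "b \<in> Y" "D \<inter> Y = {b}" "C \<inter> X = N b" "a \<in> X" "D \<inter> X = {a}" "C \<inter> Y = N a"
    | b b' where "b \<in> Y" "D \<inter> Y = {b}" "C \<inter> X = N b" "b' \<in> Y" "C \<inter> Y = {b'}" "D \<inter> X = N b'"
    by blast
  then show ?thesis
  proof cases
    case 1
    have "N a \<inter> N a' = {}" using dis(1) unfolding 1(3,6) .
    moreover have "R = {a, a'} \<union> N a \<union> N a'" unfolding Rsplit 1(2,3,5,6) by auto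
    ultimately show ?thesis using 1(1,4) by blast
  next
    case 2
    have "b \<notin> N a" using dis(1) unfolding 2(3,5) by auto
    moreover have "R = {a, b} \<union> N a \<union> N b" unfolding Rsplit 2(2,3,5,6) by auto
    ultimately show ?thesis using 2(1,4) by blast
  next
    case 3
    have "b \<notin> N a" using dis(1) unfolding 3(2,6) by auto
    moreover have "R = {a, b} \<union> N a \<union> N b" unfolding Rsplit 3(2,3,5,6) by auto
    ultimately show ?thesis using 3(1,4) by blast
  next
    case 4
    have "N b \<inter> N b' = {}" using dis(2) unfolding 4(3,6) by auto
    moreover have "R = {b, b'} \<union> N b \<union> N b'" unfolding Rsplit 4(2,3,5,6) by auto
    ultimately show ?thesis using 4(1,4) by blast
  qed
qed

text \<open>The families of remaining sets whose distinguished vertices are in \<open>X\<close>. Exchanging \<open>X\<close> and \<open>Y\<close>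
  gives the others, except that \<open>edge_sets\<close> is symmetric.\<close>

definition stars :: "'v set set" where "stars = (\<lambda>w. insert w Y) ` X"
definition isolated_ones :: "'v set set" where "isolated_ones = (\<lambda>w. X \<union> N w) ` X"
definition two_centres :: "'v set set" where
  "two_centres = {{w, w'} \<union> N w \<union> N w' | w w'. w \<in> X \<and> w' \<in> X \<and> N w \<inter> N w' = {}}"
definition edge_sets :: "'v set set" where
  "edge_sets = {{u, v} \<union> N u \<union> N v | u v. u \<in> X \<and> v \<in> Y \<and> v \<notin> N u}"
definition paths :: "'v set set" where "paths = (\<lambda>w. N w \<union> \<Union>(N ` N w)) ` X"

lemma rest_cases_aux:
  assumes R: "rest R" and two: "card (R \<inter> Y) \<ge> 2" and iso: "w \<in> R" "w \<in> X" "\<And>b. b \<in> R \<Longrightarrow> (w, b) \<notin> E"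
  shows "R \<in> isolated_ones \<union> paths"
  using rest_isolated_cases[OF R iso two] iso(2) by (auto simp: isolated_ones_def paths_def)

text \<open>If at most one vertex of a side remains, then so does the whole other side. Otherwise the cases
  with and without isolated vertices have been treated above.\<close>

theorem rest_iff:
  "{R. rest R} = {W, X, Y} \<union> stars \<union> cocycle.stars Y X \<union> isolated_ones \<union> cocycle.isolated_ones Y N
    \<union> two_centres \<union> cocycle.two_centres Y N \<union> edge_sets \<union> paths \<union> cocycle.paths Y N"
proof -
  interpret D: cocycle Y X N n by (rule cocycle_swap[OF cocycle_axioms])
  have "rest W" using E_sub by (auto simp: rest_def)
  moreover have "rest X" "rest Y" using rest_side D.rest_side by (simp_all add: rest_swap)
  moreover have "rest R" if "R \<in> stars \<union> D.stars" for R
    using that rest_star D.rest_star by (auto simp: rest_swap stars_def D.stars_def)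
  moreover have "rest R" if "R \<in> isolated_ones \<union> D.isolated_ones" for R
    using that rest_isolated D.rest_isolated by (auto simp: rest_swap isolated_ones_def D.isolated_ones_def)
  moreover have "rest R" if "R \<in> two_centres \<union> D.two_centres" for R
    using that rest_two_centres D.rest_two_centres
    unfolding rest_swap two_centres_def D.two_centres_def by blast
  moreover have "rest R" if "R \<in> edge_sets" for R
    using that rest_edge unfolding edge_sets_def by blast
  moreover have "rest R" if "R \<in> paths \<union> D.paths" for R
    using that rest_path D.rest_path by (auto simp: rest_swap paths_def D.paths_def)
  moreover have "R \<in> {W, X, Y} \<union> stars \<union> D.stars \<union> isolated_ones \<union> D.isolated_ones
    \<union> two_centres \<union> D.two_centres \<union> edge_sets \<union> paths \<union> D.paths" if R: "rest R" for R
  proof -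
    have R': "D.rest R" using R by (simp add: rest_swap)
    show ?thesis
    proof (cases "R = W")
      case False
      have fin': "finite (R \<inter> X)" "finite (R \<inter> Y)" using fin by auto
      consider "R \<inter> Y = {}" | "R \<inter> X = {}" | "card (R \<inter> Y) = 1" | "card (R \<inter> X) = 1"
        | "card (R \<inter> Y) \<ge> 2" "card (R \<inter> X) \<ge> 2"
        using fin' card_gt_0_iff[of "R \<inter> X"] card_gt_0_iff[of "R \<inter> Y"] by linarith
      then show ?thesis
      proof cases
        case 1
        then show ?thesis using rest_no_Y[OF R] by simp
      next
        case 2
        then show ?thesis using D.rest_no_Y[OF R'] by simp
      next
        case 3
        then obtain y where y: "R \<inter> Y = {y}" by (auto simp: card_1_singleton_iff)
        then have "R = insert y X" "y \<in> Y" using rest_one_Y[OF R] by auto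
        then have "R \<in> D.stars" unfolding D.stars_def by blast
        then show ?thesis by simp
      next
        case 4
        then obtain x where x: "R \<inter> X = {x}" by (auto simp: card_1_singleton_iff)
        then have "R = insert x Y" "x \<in> X" using D.rest_one_Y[OF R'] by auto
        then have "R \<in> stars" unfolding stars_def by blast
        then show ?thesis by simp
      next
        case 5
        show ?thesis
        proof (cases "\<exists>w\<in>R. \<forall>b\<in>R. (w, b) \<notin> E")
          case True
          then obtain w where w: "w \<in> R" "\<And>b. b \<in> R \<Longrightarrow> (w, b) \<notin> E" by blast
          show ?thesis
          proof (cases "w \<in> X")
            case True
            then have "R \<in> isolated_ones \<union> paths" by (rule rest_cases_aux[OF R 5(1) w(1) _ w(2)])
            then show ?thesis by blast
          next
            case False
            then have "w \<in> Y" using w(1) rest_sub[OF R] by auto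
            then have "R \<in> D.isolated_ones \<union> D.paths"
              using w(2) by (intro D.rest_cases_aux[OF R' 5(2) w(1)]) (simp_all add: co_edges_swap[of Y X N])
            then show ?thesis by blast
          qed
        next
          case noniso: False
          then have "R \<in> two_centres \<union> D.two_centres \<union> edge_sets"
            using rest_no_isolated_cases[OF R False]
            unfolding two_centres_def D.two_centres_def edge_sets_def by blast
          then show ?thesis by blast
        qed
      qed
    qed simp
  qed
  ultimately show ?thesis by blast
qed

section \<open>Counting the cut sets\<close>

text \<open>The multiplicity and the dimension of the prime of the cut set \<open>W - R\<close>.\<close>

definition mult :: "'v set \<Rightarrow> nat" where
  "mult R = (\<Prod>c\<in>R // cn R. card c)"

definition dim :: "'v set \<Rightarrow> nat" where
  "dim R = card R + card (R // cn R)"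

text \<open>As \<open>n\<close> is at least 5, the shape tells the families of remaining sets apart.\<close>

definition shape :: "'v set \<Rightarrow> nat \<times> nat" where
  "shape R = (card (R \<inter> X), card (R \<inter> Y))"

lemma invariants_swap:
  "cocycle.mult Y X N = mult" "cocycle.dim Y X N = dim"
  "cocycle.shape Y X R = (snd (shape R), fst (shape R))"
proof -
  interpret D: cocycle Y X N n by (rule cocycle_swap[OF cocycle_axioms])
  show "cocycle.mult Y X N = mult" "cocycle.dim Y X N = dim"
    by (rule ext, simp only: D.mult_def mult_def D.dim_def dim_def co_edges_swap[of Y X N] Un_commute[of Y X])+
  show "cocycle.shape Y X R = (snd (shape R), fst (shape R))"
    by (simp add: D.shape_def shape_def)
qed

lemma invariants_of_parts:
  assumes "parts E W R P"
  shows "mult R = (\<Prod>c\<in>P. card c)" "dim R = card R + card P"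
  using partsD(2)[OF symE assms] by (simp_all add: mult_def dim_def)

lemma whole_values: "mult W = 2 * n" "shape W = (n, n)"
  using invariants_of_parts[OF parts_whole] cardW card_sides disj
  by (simp_all add: shape_def Int_Un_distrib2 Int_commute)

lemma side_values: "mult X = 1" "dim X = 2 * n" "shape X = (n, 0)"
proof -
  have inj: "inj_on (\<lambda>x. {x}) X" by auto
  show "mult X = 1" using invariants_of_parts(1)[OF parts_side] by (simp add: prod.reindex[OF inj])
  show "dim X = 2 * n"
    using invariants_of_parts(2)[OF parts_side] by (simp add: card_image[OF inj] card_sides)
  show "shape X = (n, 0)" using disj card_sides by (simp add: shape_def)
qed

lemma star_values:
  assumes "R \<in> stars"
  shows "mult R = n - 1" "dim R \<le> 2 * n" "shape R = (1, n)"
proof -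
  obtain w where w: "w \<in> X" "R = insert w Y" using assms by (auto simp: stars_def)
  obtain p q where pq: "N w = {p, q}" "p \<noteq> q" using N_pair[of w] w by auto
  have Y: "p \<in> Y" "q \<in> Y" using N_sub(1)[OF w(1)] pq by auto
  have wY: "w \<notin> Y" using w disj by auto
  have c: "card (insert w (Y - {p, q})) = n - 1"
    using wY Y pq fin card_sides n by (simp add: card_Diff_subset)
  have "insert w (Y - {p, q}) \<noteq> {p}" "insert w (Y - {p, q}) \<noteq> {q}" "{p} \<noteq> {q}" using wY Y pq by auto
  then have "(\<Prod>c\<in>{insert w (Y - {p, q}), {p}, {q}}. card c) = n - 1"
    "card {insert w (Y - {p, q}), {p}, {q}} = 3" using c by simp_all
  moreover have "card R = n + 1" using w wY fin card_sides by simp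
  ultimately show "mult R = n - 1" "dim R \<le> 2 * n"
    using invariants_of_parts[OF parts_star[OF w(1) pq]] w(2) n by simp_all
  have "R \<inter> X = {w}" "R \<inter> Y = Y" using w disj by auto
  then show "shape R = (1, n)" using card_sides by (simp add: shape_def)
qed

lemma isolated_values:
  assumes "R \<in> isolated_ones"
  shows "mult R = n + 1" "dim R \<le> 2 * n" "shape R = (n, 2)"
proof -
  obtain w where w: "w \<in> X" "R = X \<union> N w" using assms by (auto simp: isolated_ones_def)
  have NY: "N w \<subseteq> Y" "card (N w) = 2" "finite (N w)" using N_sub(1)[OF w(1)] card_N fin_N w by auto
  have XN: "X \<inter> N w = {}" using NY disj by auto
  have c: "card ((X - {w}) \<union> N w) = n + 1"
    using XN NY fin w card_sides n by (subst card_Un_disjoint) auto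
  have "{w} \<noteq> (X - {w}) \<union> N w" using c n by force
  then have "(\<Prod>c\<in>{{w}, (X - {w}) \<union> N w}. card c) = n + 1" "card {{w}, (X - {w}) \<union> N w} = 2"
    using c by simp_all
  moreover have "card R = n + 2" using w XN NY fin card_sides by (simp add: card_Un_disjoint)
  ultimately show "mult R = n + 1" "dim R \<le> 2 * n"
    using invariants_of_parts[OF parts_isolated[OF w(1)]] w(2) n by simp_all
  have "R \<inter> X = X" "R \<inter> Y = N w" using w NY disj by auto
  then show "shape R = (n, 2)" using card_sides NY by (simp add: shape_def)
qed

lemma two_centres_values:
  assumes "R \<in> two_centres"
  shows "mult R = 9" "dim R \<le> 2 * n" "shape R = (2, 4)"
proof -
  obtain w w' where w: "w \<in> X" "w' \<in> X" "N w \<inter> N w' = {}" "R = {w, w'} \<union> N w \<union> N w'"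
    using assms by (auto simp: two_centres_def)
  have NY: "N w \<subseteq> Y" "card (N w) = 2" "finite (N w)" "N w' \<subseteq> Y" "card (N w') = 2" "finite (N w')"
    using N_sub(1) card_N fin_N w by auto
  have ne: "w \<noteq> w'" using w NY by auto
  have wN: "w \<notin> N w'" "w' \<notin> N w" "w \<notin> N w" "w' \<notin> N w'" using w NY disj by auto
  have c: "card (insert w (N w')) = 3" "card (insert w' (N w)) = 3" using wN NY by simp_all
  have "insert w (N w') \<noteq> insert w' (N w)" using ne wN by auto
  then have "(\<Prod>c\<in>{insert w (N w'), insert w' (N w)}. card c) = 9"
    "card {insert w (N w'), insert w' (N w)} = 2" using c by simp_all
  moreover have RX: "R \<inter> X = {w, w'}" and RY: "R \<inter> Y = N w \<union> N w'" using w NY disj by auto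
  moreover have "card (N w \<union> N w') = 4" using NY w by (simp add: card_Un_disjoint)
  moreover from this have "card R = 6"
    using w NY ne wN by (subst w(4)) (simp add: insert_is_Un[symmetric])
  ultimately show "mult R = 9" "dim R \<le> 2 * n" "shape R = (2, 4)"
    using invariants_of_parts[OF parts_two_centres[OF w(1-3)]] w(4) n ne by (simp_all add: shape_def)
qed

lemma edge_values:
  assumes "R \<in> edge_sets"
  shows "mult R = 8" "dim R \<le> 2 * n" "shape R = (3, 3)"
proof -
  obtain u v where uv: "u \<in> X" "v \<in> Y" "v \<notin> N u" "R = {u, v} \<union> N u \<union> N v"
    using assms by (auto simp: edge_sets_def)
  have NY: "N u \<subseteq> Y" "card (N u) = 2" "finite (N u)" "N v \<subseteq> X" "card (N v) = 2" "finite (N v)"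
    using N_sub card_N fin_N uv by auto
  have vu: "u \<notin> N v" using uv adj(3)[of u v] by simp
  have ne: "u \<noteq> v" "u \<notin> N u" "v \<notin> N v" "N u \<inter> N v = {}" using uv NY disj by auto
  have c: "card {u, v} = 2" "card (N u \<union> N v) = 4" using ne NY by (simp_all add: card_Un_disjoint)
  have "{u, v} \<noteq> N u \<union> N v" using uv ne vu by auto
  then have "(\<Prod>c\<in>{{u, v}, N u \<union> N v}. card c) = 8" "card {{u, v}, N u \<union> N v} = 2" using c by simp_all
  moreover have "card R = 6"
    using uv vu ne NY c by (subst uv(4)) (simp add: insert_is_Un[symmetric])
  ultimately show "mult R = 8" "dim R \<le> 2 * n"
    using invariants_of_parts[OF parts_edge[OF uv(1-3)]] uv(4) n by simp_all
  have "R \<inter> X = insert u (N v)" "R \<inter> Y = insert v (N u)" using uv NY disj by auto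
  then show "shape R = (3, 3)" using uv vu NY by (simp add: shape_def)
qed

lemma path_values:
  assumes "R \<in> paths"
  shows "mult R = 4" "dim R \<le> 2 * n" "shape R = (3, 2)"
proof -
  obtain w where w: "w \<in> X" "R = N w \<union> \<Union>(N ` N w)" using assms by (auto simp: paths_def)
  obtain a b a' b' where N: "N w = {a, b}" "N a = {w, a'}" "N b = {w, b'}" "a \<noteq> b" "a' \<noteq> w" "b' \<noteq> w" "a' \<noteq> b'"
    and mem: "a \<in> Y" "b \<in> Y" "a' \<in> X" "b' \<in> X" by (rule path_of_length_4[OF w(1)])
  have R: "R = {w, a, b, a', b'}" using w N by auto
  have ne: "w \<noteq> a" "w \<noteq> b" "a \<noteq> a'" "a \<noteq> b'" "b \<noteq> a'" "b \<noteq> b'" using w mem disj by auto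
  have "{w} \<noteq> {a, b'}" "{w} \<noteq> {b, a'}" "{a, b'} \<noteq> {b, a'}" using ne N(4) by auto
  then have "(\<Prod>c\<in>{{w}, {a, b'}, {b, a'}}. card c) = 4" "card {{w}, {a, b'}, {b, a'}} = 3"
    using ne by simp_all
  moreover have "card R = 5" unfolding R using ne N(4-7) by auto
  ultimately show "mult R = 4" "dim R \<le> 2 * n"
    using invariants_of_parts[OF parts_path[OF w(1) N mem]] w(2) n by simp_all
  have "R \<inter> X = {w, a', b'}" "R \<inter> Y = {a, b}" unfolding R using w mem disj by auto
  then show "shape R = (3, 2)" using N(4-7) by (auto simp: shape_def)
qed

lemma card_stars: "finite stars" "card stars = n"
proof -
  show "finite stars" using fin by (simp add: stars_def)
  have "inj_on (\<lambda>w. insert w Y) X" using disj by (auto simp: inj_on_def)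
  then show "card stars = n" unfolding stars_def using card_sides by (simp add: card_image)
qed

lemma card_isolated_ones: "finite isolated_ones" "card isolated_ones = n"
proof -
  show "finite isolated_ones" using fin by (simp add: isolated_ones_def)
  have "inj_on (\<lambda>w. X \<union> N w) X"
  proof (rule inj_onI)
    fix a b assume ab: "a \<in> X" "b \<in> X" "X \<union> N a = X \<union> N b"
    then have "N a = N b" using N_sub(1)[of a] N_sub(1)[of b] disj by blast
    then show "a = b" using N_inj ab by auto
  qed
  then show "card isolated_ones = n" unfolding isolated_ones_def using card_sides by (simp add: card_image)
qed

lemma card_paths: "finite paths" "card paths = n"
proof -
  show "finite paths" using fin by (simp add: paths_def)
  have Y: "(N w \<union> \<Union>(N ` N w)) \<inter> Y = N w" if w: "w \<in> X" for w
  proof -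
    have aux: "(A \<union> B) \<inter> Y = A" if "A \<subseteq> Y" "B \<subseteq> X" for A B using that disj by blast
    show ?thesis
    proof (rule aux[OF N_sub(1)[OF w]])
      show "\<Union>(N ` N w) \<subseteq> X"
      proof (rule UN_least)
        fix y assume "y \<in> N w"
        then have "y \<in> Y" using N_sub(1)[OF w] by (rule rev_subsetD)
        then show "N y \<subseteq> X" by (rule N_sub(2))
      qed
    qed
  qed
  have "inj_on (\<lambda>w. N w \<union> \<Union>(N ` N w)) X"
  proof (rule inj_onI)
    fix a b assume ab: "a \<in> X" "b \<in> X" "N a \<union> \<Union>(N ` N a) = N b \<union> \<Union>(N ` N b)"
    have "N a = (N a \<union> \<Union>(N ` N a)) \<inter> Y" by (rule Y[OF ab(1), symmetric])
    also have "\<dots> = N b" unfolding ab(3) by (rule Y[OF ab(2)])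
    finally show "a = b" using ab(1,2) by (intro N_inj) simp_all
  qed
  then show "card paths = n" unfolding paths_def using card_sides by (simp add: card_image)
qed

text \<open>An edge can be recovered from its set as the component with two elements.\<close>

lemma card_edge_sets: "finite edge_sets" "card edge_sets = n * (n - 2)"
proof -
  let ?I = "SIGMA u:X. Y - N u"
  let ?f = "\<lambda>(u, v). {u, v} \<union> N u \<union> N v"
  have img: "edge_sets = ?f ` ?I" unfolding edge_sets_def by auto
  show "finite edge_sets" unfolding img using fin by auto
  have "inj_on ?f ?I"
  proof (rule inj_onI)
    fix s t assume s: "s \<in> ?I" and t: "t \<in> ?I" and eq: "?f s = ?f t"
    obtain u v where [simp]: "s = (u, v)" by (cases s)
    obtain u' v' where [simp]: "t = (u', v')" by (cases t)
    have uv: "u \<in> X" "v \<in> Y" "v \<notin> N u" "u' \<in> X" "v' \<in> Y" "v' \<notin> N u'" using s t by auto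
    have "{{u, v}, N u \<union> N v} = {{u', v'}, N u' \<union> N v'}"
      using partsD(2)[OF symE parts_edge[OF uv(1-3)]] partsD(2)[OF symE parts_edge[OF uv(4-6)]] eq by simp
    moreover have "card (N u' \<union> N v') = 4"
    proof -
      have "N u' \<inter> N v' = {}" using N_sub uv disj by blast
      then show ?thesis using card_N fin_N uv by (simp add: card_Un_disjoint)
    qed
    moreover have "card {u, v} \<le> 2" by (simp add: card_insert_if)
    ultimately have "{u, v} = {u', v'}" by (metis insertE insertI1 numeral_le_iff semiring_norm(69) singletonD semiring_norm(71))
    then show "s = t" using uv disj by (auto simp: doubleton_eq_iff)
  qed
  moreover have "card (Y - N u) = n - 2" if "u \<in> X" for u
    using that card_sides card_N N_sub(1) fin_N by (simp add: card_Diff_subset)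
  then have "card ?I = n * (n - 2)" using fin card_sides by simp
  ultimately show "card edge_sets = n * (n - 2)" unfolding img by (simp add: card_image)
qed

text \<open>The set determines the two centres as its elements in \<open>X\<close>. The admissible pairs of centres are the
  two-element subsets of \<open>X\<close> other than the \<open>n\<close> sets \<open>N y\<close>.\<close>

lemma card_two_centres: "finite two_centres" "2 * card two_centres = n * (n - 3)"
proof -
  let ?P = "{S. S \<subseteq> X \<and> card S = 2} - N ` Y"
  let ?f = "\<lambda>S. S \<union> \<Union>(N ` S)"
  have img: "two_centres = ?f ` ?P"
  proof (intro equalityI subsetI)
    fix R assume "R \<in> two_centres"
    then obtain w w' where w: "w \<in> X" "w' \<in> X" "N w \<inter> N w' = {}" "R = {w, w'} \<union> N w \<union> N w'"
      by (auto simp: two_centres_def)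
    have "w \<noteq> w'" using w card_N[of w] by auto
    moreover have "{w, w'} \<noteq> N y" if y: "y \<in> Y" for y
    proof
      assume "{w, w'} = N y"
      then have "y \<in> N w" "y \<in> N w'" using adj(3)[of w y] adj(3)[of w' y] w y by auto
      then show False using w by auto
    qed
    ultimately have "{w, w'} \<in> ?P" using w by auto
    moreover have "R = ?f {w, w'}" using w by auto
    ultimately show "R \<in> ?f ` ?P" by (rule rev_image_eqI)
  next
    fix R assume "R \<in> ?f ` ?P"
    then obtain S where S: "S \<subseteq> X" "card S = 2" "S \<notin> N ` Y" "R = ?f S" by auto
    obtain w w' where w: "S = {w, w'}" "w \<noteq> w'" using S(2) by (auto simp: card_2_iff)
    have "N w \<inter> N w' = {}"
    proof (rule ccontr)
      assume "N w \<inter> N w' \<noteq> {}"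
      then obtain y where y: "y \<in> N w" "y \<in> N w'" by auto
      then have yY: "y \<in> Y" using N_sub(1) S w by auto
      then have "w \<in> N y" "w' \<in> N y" using y adj(3)[of w y] adj(3)[of w' y] S w by auto
      then have "N y = S" using N_two[of y w w'] yY w by auto
      then show False using S yY by auto
    qed
    then show "R \<in> two_centres" unfolding two_centres_def using S w by auto
  qed
  have finP: "finite {S. S \<subseteq> X \<and> card S = 2}" using fin by simp
  show "finite two_centres" unfolding img using finP by simp
  have "?f S \<inter> X = S" if "S \<in> ?P" for S using that N_sub(1) disj by fastforce
  then have "inj_on ?f ?P" by (metis (no_types, lifting) inj_onI)
  then have "card two_centres = card ?P" unfolding img by (rule card_image)
  also have "\<dots> = (n choose 2) - n"
  proof -
    have "N ` Y \<subseteq> {S. S \<subseteq> X \<and> card S = 2}" using N_sub(2) card_N by auto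
    moreover have "card (N ` Y) = n"
      using N_inj card_sides by (subst card_image) (auto simp: inj_on_def)
    ultimately show ?thesis
      using fin card_sides by (subst card_Diff_subset) (auto simp: n_subsets intro: finite_subset[OF _ finP])
  qed
  finally have "2 * card two_centres = 2 * (n choose 2) - 2 * n" by simp
  also have "2 * (n choose 2) = n * (n - 1)"
  proof -
    have "even (n * (n - 1))" by (cases n) auto
    then show ?thesis unfolding choose_two by (rule dvd_mult_div_cancel)
  qed
  also have "n * (n - 1) - 2 * n = n * (n - 3)" by (simp add: algebra_simps diff_mult_distrib2)
  finally show "2 * card two_centres = n * (n - 3)" .
qed

end

text \<open>The shapes are pairwise different, so the families are disjoint.\<close>

lemma sum_over_families:
  fixes L :: "('r set \<times> 's \<times> nat) list" and m :: "'r \<Rightarrow> nat"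
  assumes "distinct (map (fst \<circ> snd) L)"
    and "\<And>S s k. (S, s, k) \<in> set L \<Longrightarrow> finite S \<and> (\<forall>R\<in>S. shape R = s \<and> m R = k)"
  shows "(\<Sum>R\<in>\<Union>(fst ` set L). m R) = sum_list (map (\<lambda>(S, s, k). card S * k) L)"
  using assms
proof (induction L)
  case (Cons t L)
  obtain S s k where t: "t = (S, s, k)" by (cases t)
  have S: "finite S" "\<And>R. R \<in> S \<Longrightarrow> shape R = s \<and> m R = k" using Cons.prems(2)[of S s k] t by auto
  have L: "finite S'" "\<And>R. R \<in> S' \<Longrightarrow> shape R = s' \<and> m R = k'" if "(S', s', k') \<in> set L" for S' s' k'
    using Cons.prems(2)[of S' s' k'] that by auto
  have fin: "finite (\<Union>(fst ` set L))" using L(1) by auto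
  have "S \<inter> \<Union>(fst ` set L) = {}"
  proof (rule ccontr)
    assume "\<not> ?thesis"
    then obtain R S' s' k' where R: "R \<in> S" "(S', s', k') \<in> set L" "R \<in> S'" by force
    then have "s = s'" using S(2) L(2) by metis
    then show False using Cons.prems(1) R(2) t by force
  qed
  then have "(\<Sum>R\<in>\<Union>(fst ` set (t # L)). m R) = (\<Sum>R\<in>S. m R) + (\<Sum>R\<in>\<Union>(fst ` set L). m R)"
    using S(1) fin t by (simp add: sum.union_disjoint)
  moreover have "(\<Sum>R\<in>S. m R) = card S * k" using S(2) by simp
  moreover have "(\<Sum>R\<in>\<Union>(fst ` set L). m R) = sum_list (map (\<lambda>(S, s, k). card S * k) L)"
    using Cons.prems by (intro Cons.IH) auto
  ultimately show ?case using t by simp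
qed simp

context cocycle
begin

theorem sum_mult: "rat_of_nat (\<Sum>R\<in>{R. rest R}. mult R) = 21 * of_nat n ^ 2 - 33 * of_nat n + 2"
proof -
  interpret D: cocycle Y X N n by (rule cocycle_swap[OF cocycle_axioms])
  let ?L = "[({W}, (n, n), 2 * n), ({X}, (n, 0), 1), ({Y}, (0, n), 1), (stars, (1, n), n - 1), (D.stars, (n, 1), n - 1),
    (isolated_ones, (n, 2), n + 1), (D.isolated_ones, (2, n), n + 1), (two_centres, (2, 4), 9),
    (D.two_centres, (4, 2), 9), (edge_sets, (3, 3), 8), (paths, (3, 2), 4), (D.paths, (2, 3), 4)]"
  have sw: "shape R = (snd (D.shape R), fst (D.shape R))" for R by (simp add: invariants_swap(3))
  have un: "{R. rest R} = \<Union>(fst ` set ?L)" unfolding rest_iff by auto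
  have "distinct (map (fst \<circ> snd) ?L)" using n by simp
  moreover have "finite S \<and> (\<forall>R\<in>S. shape R = s \<and> mult R = k)" if "(S, s, k) \<in> set ?L" for S s k
  proof -
    define ok where "ok S s k \<longleftrightarrow> finite S \<and> (\<forall>R\<in>S. shape R = s \<and> mult R = k)" for S s k
    have own: "ok {W} (n, n) (2 * n)" "ok {X} (n, 0) 1" "ok stars (1, n) (n - 1)"
      "ok isolated_ones (n, 2) (n + 1)" "ok two_centres (2, 4) 9" "ok edge_sets (3, 3) 8" "ok paths (3, 2) 4"
      by (simp_all add: ok_def whole_values side_values star_values isolated_values two_centres_values
          edge_values path_values card_stars(1) card_isolated_ones(1) card_two_centres(1)
          card_edge_sets(1) card_paths(1))
    have swapped: "ok S (b, a) k" if "finite S" "\<And>R. R \<in> S \<Longrightarrow> D.shape R = (a, b)" "\<And>R. R \<in> S \<Longrightarrow> D.mult R = k" for S a b k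
      using that unfolding ok_def invariants_swap(1) sw by simp
    have other: "ok {Y} (0, n) 1" "ok D.stars (n, 1) (n - 1)" "ok D.isolated_ones (2, n) (n + 1)"
      "ok D.two_centres (4, 2) 9" "ok D.paths (2, 3) 4"
      by (rule swapped; simp add: D.side_values D.star_values D.isolated_values D.two_centres_values
          D.path_values D.card_stars(1) D.card_isolated_ones(1) D.card_two_centres(1) D.card_paths(1))+
    have "ok S s k" using that own other by auto
    then show ?thesis unfolding ok_def .
  qed
  ultimately have "(\<Sum>R\<in>{R. rest R}. mult R) = sum_list (map (\<lambda>(S, s, k). card S * k) ?L)"
    unfolding un by (rule sum_over_families)
  then have sum: "(\<Sum>R\<in>{R. rest R}. mult R) = 2 * n + 2 + 2 * (n * (n - 1)) + 2 * (n * (n + 1))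
      + 9 * card two_centres + 9 * card D.two_centres + 8 * (n * (n - 2)) + 8 * n"
    by (simp add: card_stars card_isolated_ones card_paths card_edge_sets D.card_stars D.card_isolated_ones D.card_paths)
  obtain k where k: "n = k + 5" using n by (metis add.commute le_Suc_ex)
  have "card two_centres = card D.two_centres"
    using card_two_centres(2) D.card_two_centres(2) by simp
  then have "(\<Sum>R\<in>{R. rest R}. mult R) = 2 * n + 2 + 2 * (n * (n - 1)) + 2 * (n * (n + 1))
      + 9 * (n * (n - 3)) + 8 * (n * (n - 2)) + 8 * n"
    using sum card_two_centres(2) by simp
  then have "(\<Sum>R\<in>{R. rest R}. mult R) = 21 * (k + 5) ^ 2 - 33 * (k + 5) + 2"
    unfolding k by (simp add: algebra_simps power2_eq_square)
  moreover have "33 * (k + 5) \<le> 21 * (k + 5) ^ 2" by (simp add: algebra_simps power2_eq_square)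
  ultimately show ?thesis unfolding k by (simp add: of_nat_diff)
qed

lemma dim_le:
  assumes "rest R" "R \<noteq> W"
  shows "dim R \<le> 2 * n"
proof -
  interpret D: cocycle Y X N n by (rule cocycle_swap[OF cocycle_axioms])
  have "R \<in> {W, X, Y} \<union> stars \<union> D.stars \<union> isolated_ones \<union> D.isolated_ones
    \<union> two_centres \<union> D.two_centres \<union> edge_sets \<union> paths \<union> D.paths"
    using assms(1) rest_iff by blast
  then consider "R = X \<or> R = Y" | "R \<in> stars" | "R \<in> D.stars" | "R \<in> isolated_ones" | "R \<in> D.isolated_ones"
    | "R \<in> two_centres" | "R \<in> D.two_centres" | "R \<in> edge_sets" | "R \<in> paths" | "R \<in> D.paths"
    using assms(2) by blast
  then show ?thesis
  proof cases
    case 1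
    then show ?thesis using side_values(2) D.side_values(2) unfolding invariants_swap(2) by (elim disjE) simp_all
  qed (use star_values(2) D.star_values(2) isolated_values(2) D.isolated_values(2) two_centres_values(2)
      D.two_centres_values(2) edge_values(2) path_values(2) D.path_values(2) in
      \<open>unfold invariants_swap(2), iprover+\<close>)
qed

section \<open>Multiplicity and arithmetic degree of the complement of a cycle\<close>

theorem arith_degree_cocycle:
  "arith_degree (gvars W) (cut_ideal W {} E :: ('v edge_var, 'k::field) mpoly set)
    = 21 * of_nat n ^ 2 - 33 * of_nat n + 2"
proof -
  have cut: "T \<subseteq> W" "rest (W - T)" if "cutset W E T" for T
    using that cutset_iff_rest[of T] by (auto simp: cutset_def)
  have "bij_betw (\<lambda>T. W - T) {T. cutset W E T} {R. rest R}"
  proof (rule bij_betw_byWitness[where f' = "\<lambda>R. W - R"])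
    show "\<forall>T\<in>{T. cutset W E T}. W - (W - T) = T" using cut(1) by (simp add: double_diff)
    show "\<forall>R\<in>{R. rest R}. W - (W - R) = R" using rest_sub by (simp add: double_diff)
    show "(\<lambda>T. W - T) ` {T. cutset W E T} \<subseteq> {R. rest R}" using cut(2) by auto
    show "(\<lambda>R. W - R) ` {R. rest R} \<subseteq> {T. cutset W E T}"
      using cutset_iff_rest rest_sub by (auto simp: double_diff)
  qed
  then have "(\<Sum>R\<in>{R. rest R}. rat_of_nat (mult R)) = (\<Sum>T\<in>{T. cutset W E T}. rat_of_nat (mult (W - T)))"
    by (rule sum.reindex_bij_betw[symmetric])
  also have "\<dots> = (\<Sum>T\<in>{T. cutset W E T}. \<Prod>c\<in>(W - T) // con W T E. of_nat (card c))"
    using cut(1) by (intro sum.cong) (auto simp: mult_def double_diff)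
  also have "\<dots> = arith_degree (gvars W) (cut_ideal W {} E :: ('v edge_var, 'k) mpoly set)"
    using finW symE E_sub cardW n by (intro arith_degree_edge_ideal[symmetric]) auto
  finally show ?thesis using sum_mult by simp
qed

theorem multiplicity_cocycle:
  "hilbert_multiplicity (gvars W) (cut_ideal W {} E :: ('v edge_var, 'k::field) mpoly set) = 2 * of_nat n"
proof -
  have "con W {} E = W \<times> W" using partsD(1)[OF symE parts_whole] by auto
  moreover have "cut_dim W T E \<le> card W" if T: "cutset W E T" "T \<noteq> {}" for T
  proof -
    have "T \<subseteq> W" using T(1) by (simp add: cutset_def)
    then have "rest (W - T)" "W - T \<noteq> W" "W - (W - T) = T"
      using T cutset_iff_rest[of T] by auto
    then show ?thesis using dim_le[of "W - T"] by (simp add: dim_def cut_dim_def cardW)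
  qed
  moreover have "W \<noteq> {}" using cardW n by auto
  ultimately have "hilbert_multiplicity (gvars W) (cut_ideal W {} E :: ('v edge_var, 'k) mpoly set) = of_nat (card W)"
    using finW symE E_sub by (intro multiplicity_edge_ideal) simp_all
  then show ?thesis by (simp add: cardW)
qed

end

section \<open>The graph \<open>G\<^sub>n\<close>\<close>

fun cycle_nbrs :: "nat \<Rightarrow> vert \<Rightarrow> vert set" where
  "cycle_nbrs n (U i) = {V i, V (if i = 0 then n - 1 else i - 1)}"
| "cycle_nbrs n (V j) = {U j, U (if j = n - 1 then 0 else j + 1)}"

lemma pred_mod:
  assumes "i < n" "j < n"
  shows "int j = (int i - 1) mod int n \<longleftrightarrow> j = (if i = 0 then n - 1 else i - 1)"
proof (cases "i = 0")
  case True
  have "(int i - 1) mod int n = int n - 1"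
    using True assms by (simp add: zmod_minus1)
  then show ?thesis using True assms by auto
next
  case False
  then have "(int i - 1) mod int n = int i - 1" using assms by (intro mod_pos_pos_trivial) auto
  then show ?thesis using False by auto
qed

lemma cocycle_Gn:
  assumes "n \<ge> 5"
  shows "cocycle (U ` {..<n}) (V ` {..<n}) (cycle_nbrs n) n"
proof
  let ?W = "U ` {..<n} \<union> V ` {..<n}"
  show "finite (U ` {..<n})" "finite (V ` {..<n})" by simp_all
  show "card (U ` {..<n}) = n" "card (V ` {..<n}) = n" by (simp_all add: card_image inj_on_def)
  show "n \<ge> 5" by fact
  show "U ` {..<n} \<inter> V ` {..<n} = {}" by auto
  show "cycle_nbrs n x \<subseteq> V ` {..<n}" if "x \<in> U ` {..<n}" for x using that by auto
  show "cycle_nbrs n y \<subseteq> U ` {..<n}" if "y \<in> V ` {..<n}" for y using that by auto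
  show "card (cycle_nbrs n w) = 2" if "w \<in> ?W" for w using that assms by (auto simp: card_insert_if)
  show "a \<in> cycle_nbrs n b" if "a \<in> ?W" "b \<in> ?W" "b \<in> cycle_nbrs n a" for a b
    using that by (auto split: if_splits)
  show "a = b" if "a \<in> ?W" "b \<in> ?W" "cycle_nbrs n a = cycle_nbrs n b" for a b
    using that assms by (auto simp: doubleton_eq_iff split: if_splits)
  show False if w: "w \<in> ?W" and "a \<in> cycle_nbrs n w" "b \<in> cycle_nbrs n w" "a \<noteq> b"
    "a' \<in> cycle_nbrs n a - {w}" "b' \<in> cycle_nbrs n b - {w}" "t \<in> cycle_nbrs n a'" "t \<in> cycle_nbrs n b'"
    for w a b a' b' t
  proof -
    consider i where "w = U i" "i < n" | j where "w = V j" "j < n" using w by auto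
    then show False
    proof cases
      case 1
      let ?p = "if i = 0 then n - 1 else i - 1"
      have "(a = V i \<and> b = V ?p) \<or> (a = V ?p \<and> b = V i)" using that(2-4) 1(1) by auto
      then show False using that(5-8) 1 assms by (elim disjE) (auto split: if_splits)
    next
      case 2
      let ?s = "if j = n - 1 then 0 else j + 1"
      have "(a = U j \<and> b = U ?s) \<or> (a = U ?s \<and> b = U j)" using that(2-4) 2(1) by auto
      then show False using that(5-8) 2 assms by (elim disjE) (auto split: if_splits)
    qed
  qed
qed

lemma edges_Gn: "{a, b} \<in> snd (Gn n) \<longleftrightarrow> (a, b) \<in> co_edges (U ` {..<n}) (V ` {..<n}) (cycle_nbrs n)"
proof -
  have UV: "{U i, V j} \<in> snd (Gn n) \<longleftrightarrow> i < n \<and> j < n \<and> V j \<notin> cycle_nbrs n (U i)" for i j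
  proof (cases "i < n \<and> j < n")
    case True
    then have "int i mod int n = int i" by simp
    then show ?thesis using True pred_mod[of i n j] by (auto simp: Gn_def doubleton_eq_iff)
  qed (auto simp: Gn_def doubleton_eq_iff)
  have sym: "V j \<in> cycle_nbrs n (U i) \<longleftrightarrow> U i \<in> cycle_nbrs n (V j)" if "i < n" "j < n" for i j
    using that by auto
  have VU: "{V j, U i} \<in> snd (Gn n) \<longleftrightarrow> i < n \<and> j < n \<and> U i \<notin> cycle_nbrs n (V j)" for i j
    using UV[of i j] sym[of i j] by (auto simp only: insert_commute)
  have UU: "{U i, U j} \<notin> snd (Gn n)" and VV: "{V i, V j} \<notin> snd (Gn n)" for i j
    by (auto simp: Gn_def doubleton_eq_iff)
  have mem: "U i \<in> U ` {..<n} \<longleftrightarrow> i < n" "V i \<in> V ` {..<n} \<longleftrightarrow> i < n" "U i \<notin> V ` {..<n}" "V i \<notin> U ` {..<n}" for i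
    by auto
  show ?thesis
    by (cases a; cases b; simp only: UV VU UU VV co_edges_def mem mem_Collect_eq prod.case; blast)
qed

lemma binomial_edge_ideal_Gn:
  fixes n defines "X \<equiv> U ` {..<n}" and "Y \<equiv> V ` {..<n}"
  shows "edge_vars (Gn n) = gvars (X \<union> Y)"
    and "(binomial_edge_ideal (Gn n) :: (vert edge_var, 'k::field) mpoly set)
      = cut_ideal (X \<union> Y) {} (co_edges X Y (cycle_nbrs n))"
proof -
  show v: "edge_vars (Gn n) = gvars (X \<union> Y)" by (simp add: edge_vars_def Gn_def X_def Y_def)
  show "(binomial_edge_ideal (Gn n) :: (vert edge_var, 'k) mpoly set)
      = cut_ideal (X \<union> Y) {} (co_edges X Y (cycle_nbrs n))"
    unfolding binomial_edge_ideal_def cut_ideal_def cut_gens_def v edges_Gn X_def Y_def binom_def by simp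
qed

theorem proposition4p10:
  fixes n :: nat
    and J :: "(vert edge_var, 'k::field) mpoly set"
  assumes "n \<ge> 5"
    and "J = binomial_edge_ideal (Gn n)"
  shows "hilbert_multiplicity (edge_vars (Gn n)) J = 2 * of_nat n
    \<and> arith_degree (edge_vars (Gn n)) J = 21 * of_nat n ^ 2 - 33 * of_nat n + 2"
proof -
  interpret cocycle "U ` {..<n}" "V ` {..<n}" "cycle_nbrs n" n by (rule cocycle_Gn[OF assms(1)])
  show ?thesis
    unfolding assms(2) binomial_edge_ideal_Gn
    using multiplicity_cocycle arith_degree_cocycle by blast
qed

end
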